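(* Consider the joint alignment model described in the context, and assume $k \leq n^{o(1)}$. (a) If $(\lg n/(nk))^{1/4} \leq \delta \leq \frac{1}{2k}$, then there is a non-adaptive and deterministic query algorithm that makes $O\!\left(\frac{n \log n}{\delta^2 k}\right)$ queries, runs in $O\!\left(\frac{n \log n}{\delta^2 k}\right)$ time, and with high probability outputs $g$ up to a global cyclic shift. (b) If $\frac{1}{2k} \leq \delta \leq \frac14$, then there is a non-adaptive and deterministic query algorithm that makes $O\!\left(\frac{n \log n}{\delta}\right)$ queries, runs in $O\!\left(\frac{n \log n}{\delta}\right)$ time, and with high probability outputs $g$ up to a global cyclic shift.
   Context: Joint alignment model: $V = [n] = \{1,\dots,n\}$ is a set of items and $g : V \to \{0,1,\dots,k-1\}$ is an unknown labeling. For a pair of distinct items $x,y$, a query returns the noisy measurement $\tilde{f}(x,y) = (g(x) - g(y) + \eta_{xy}) \bmod k$, where the noise values $\eta_{xy}$ for distinct queried pairs are i.i.d. random variables on $\{0,\dots,k-1\}$ with $\Pr[\eta_{xy}=0] = \frac1k + \delta$ and $\Pr[\eta_{xy}=i] = \frac1k - \frac{\delta}{k-1}$ for each $i \neq 0$, for a parameter $\delta > 0$. Each pair is queried at most once. A non-adaptive algorithm chooses its set of queried pairs before seeing any answers. Outputting $g$ up to a global cyclic shift means outputting a labeling $\hat g$ with $\hat g(v) = (g(v) + \alpha) \bmod k$ for all $v \in V$ for some $\alpha \in \{0,\dots,k-1\}$. "With high probability" means with probability tending to $1$ as $n\to\infty$. *)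

theory Defs
  imports "HOL-Probability.Probability" "HOL-Library.While_Combinator"
begin

section \<open>Word RAM\<close>

text \<open>
  Algorithms are programs for a deterministic unit-cost word RAM with word length \<open>w\<close>: finitely
  many named registers and a word-addressed memory, all arithmetic modulo \<open>2 ^ w\<close>. \<open>Ask a b\<close> adds the
  pair of items held in registers \<open>a\<close>, \<open>b\<close> to the list of queries; \<open>Answer r a\<close> puts into \<open>r\<close> the
  answer to the query whose (zero-based) position in that list is held in register \<open>a\<close>.
  A program halts when the program counter leaves it.
\<close>

datatype arith = Add | Sub | Mul | Div | Mod

datatype instr =
    Const nat nat
  | Arith arith nat nat nat
  | Load nat nat
  | Store nat nat
  | Jump_Less nat nat nat
  | is_Ask: Ask nat nat
  | is_Answer: Answer nat nat

record state =
  pc :: nat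
  reg :: "nat \<Rightarrow> nat"
  mem :: "nat \<Rightarrow> nat"
  asked :: "(nat \<times> nat) list"
  clock :: nat

fun arith_val :: "nat \<Rightarrow> arith \<Rightarrow> nat \<Rightarrow> nat \<Rightarrow> nat" where
  "arith_val w Add a b = (a + b) mod 2 ^ w"
| "arith_val w Sub a b = (a + 2 ^ w - b) mod 2 ^ w"
| "arith_val w Mul a b = (a * b) mod 2 ^ w"
| "arith_val w Div a b = a div b"
| "arith_val w Mod a b = a mod b"

fun exec_instr :: "nat \<Rightarrow> nat list \<Rightarrow> instr \<Rightarrow> state \<Rightarrow> state" where
  "exec_instr w ans (Const r c) s = s\<lparr>reg := (reg s)(r := c mod 2 ^ w)\<rparr>"
| "exec_instr w ans (Arith f r a b) s =
     s\<lparr>reg := (reg s)(r := arith_val w f (reg s a) (reg s b))\<rparr>"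
| "exec_instr w ans (Load r a) s = s\<lparr>reg := (reg s)(r := mem s (reg s a))\<rparr>"
| "exec_instr w ans (Store a b) s = s\<lparr>mem := (mem s)(reg s a := reg s b)\<rparr>"
| "exec_instr w ans (Jump_Less a b l) s = (if reg s a < reg s b then s\<lparr>pc := l\<rparr> else s)"
| "exec_instr w ans (Ask a b) s = s\<lparr>asked := asked s @ [(reg s a, reg s b)]\<rparr>"
| "exec_instr w ans (Answer r a) s =
     s\<lparr>reg := (reg s)(r := if reg s a < length ans then ans ! reg s a mod 2 ^ w else 0)\<rparr>"

definition step :: "nat \<Rightarrow> nat list \<Rightarrow> instr list \<Rightarrow> state \<Rightarrow> state" where
  "step w ans P s = exec_instr w ans (P ! pc s) (s\<lparr>pc := Suc (pc s), clock := Suc (clock s)\<rparr>)"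

definition run :: "nat \<Rightarrow> nat list \<Rightarrow> instr list \<Rightarrow> state \<Rightarrow> state option" where
  "run w ans P = while_option (\<lambda>s. pc s < length P) (step w ans P)"


section \<open>Non-adaptive query algorithms\<close>

text \<open>
  The first program chooses the queries without access to any answer; the second one continues from
  the resulting registers and memory, with access to the answers but without further queries.
\<close>

type_synonym algorithm = "instr list \<times> instr list"

definition nonadaptive :: "algorithm \<Rightarrow> bool" where
  "nonadaptive A \<longleftrightarrow> (\<forall>i \<in> set (fst A). \<not> is_Answer i) \<and> (\<forall>i \<in> set (snd A). \<not> is_Ask i)"

text \<open>
  The input words are \<open>n\<close>, \<open>k\<close> and the first \<open>w\<close> binary digits of \<open>\<delta>\<close> (where \<open>0 < \<delta> < 1\<close>).
\<close>

definition init_state :: "nat \<Rightarrow> nat \<Rightarrow> nat \<Rightarrow> real \<Rightarrow> state" where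
  "init_state w n k \<delta> =
     \<lparr>pc = 0,
      reg = (\<lambda>_. 0)(0 := n mod 2 ^ w, 1 := k mod 2 ^ w, 2 := nat \<lfloor>\<delta> * 2 ^ w\<rfloor> mod 2 ^ w),
      mem = (\<lambda>_. 0), asked = [], clock = 0\<rparr>"

definition ask_phase :: "algorithm \<Rightarrow> nat \<Rightarrow> nat \<Rightarrow> nat \<Rightarrow> real \<Rightarrow> state option" where
  "ask_phase A w n k \<delta> = run w [] (fst A) (init_state w n k \<delta>)"

definition queries :: "algorithm \<Rightarrow> nat \<Rightarrow> nat \<Rightarrow> nat \<Rightarrow> real \<Rightarrow> (nat \<times> nat) list" where
  "queries A w n k \<delta> = (case ask_phase A w n k \<delta> of None \<Rightarrow> [] | Some s \<Rightarrow> asked s)"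

definition execute :: "algorithm \<Rightarrow> nat \<Rightarrow> nat \<Rightarrow> nat \<Rightarrow> real \<Rightarrow> nat list \<Rightarrow> state option" where
  "execute A w n k \<delta> ans =
     Option.bind (ask_phase A w n k \<delta>) (\<lambda>s. run w ans (snd A) (s\<lparr>pc := 0\<rparr>))"

text \<open>The clock is not reset between the phases, so the bound is on the total number of steps.\<close>

definition runs_in_time :: "algorithm \<Rightarrow> nat \<Rightarrow> nat \<Rightarrow> nat \<Rightarrow> real \<Rightarrow> real \<Rightarrow> bool" where
  "runs_in_time A w n k \<delta> T \<longleftrightarrow>
     (\<forall>ans. length ans = length (queries A w n k \<delta>) \<and> set ans \<subseteq> {..<k} \<longrightarrow>
        (\<exists>s. execute A w n k \<delta> ans = Some s \<and> real (clock s) \<le> T))"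

definition valid_queries :: "nat \<Rightarrow> (nat \<times> nat) list \<Rightarrow> bool" where
  "valid_queries n qs \<longleftrightarrow>
     (\<forall>(x, y) \<in> set qs. x \<in> {1..n} \<and> y \<in> {1..n} \<and> x \<noteq> y) \<and>
     distinct (map (\<lambda>(x, y). {x, y}) qs)"


section \<open>Joint alignment\<close>

definition noise_pmf :: "nat \<Rightarrow> real \<Rightarrow> nat pmf" where
  "noise_pmf k \<delta> = embed_pmf (\<lambda>i.
     if i = 0 then 1 / real k + \<delta>
     else if i < k then 1 / real k - \<delta> / (real k - 1)
     else 0)"

lemma pmf_noise_pmf:
  assumes k: "2 \<le> k" and \<delta>: "0 \<le> \<delta>" "\<delta> \<le> 1 - 1 / real k"
  shows "pmf (noise_pmf k \<delta>) i =
     (if i = 0 then 1 / real k + \<delta> else if i < k then 1 / real k - \<delta> / (real k - 1) else 0)"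
proof -
  define f where "f = (\<lambda>i. if i = 0 then 1 / real k + \<delta>
     else if i < k then 1 / real k - \<delta> / (real k - 1) else 0)"
  have nonneg: "0 \<le> f i" for i
  proof -
    have "\<delta> / (real k - 1) \<le> (1 - 1 / real k) / (real k - 1)"
      using k \<delta> by (intro divide_right_mono) auto
    also have "\<dots> = 1 / real k"
      using k by (simp add: field_simps)
    finally show ?thesis using \<delta> by (auto simp: f_def)
  qed
  have "(\<Sum>i<k. f i) = f 0 + (\<Sum>i\<in>{..<k} - {0}. f i)"
    using k by (subst sum.remove[of _ 0]) auto
  also have "(\<Sum>i\<in>{..<k} - {0}. f i) = (\<Sum>i\<in>{..<k} - {0}. 1 / real k - \<delta> / (real k - 1))"
    by (intro sum.cong) (auto simp: f_def)
  also have "\<dots> = (real k - 1) * (1 / real k - \<delta> / (real k - 1))"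
    using k by (simp add: of_nat_diff)
  also have "f 0 + \<dots> = 1"
    using k by (simp add: f_def field_simps)
  finally have sum: "(\<Sum>i<k. f i) = 1" .
  have "(\<integral>\<^sup>+i. ennreal (f i) \<partial>count_space UNIV) = (\<Sum>i<k. ennreal (f i))"
    using k by (intro nn_integral_count_space') (auto simp: f_def)
  also have "\<dots> = 1"
    using sum nonneg by (simp add: sum_ennreal)
  finally have "pmf (embed_pmf f) i = f i"
    using nonneg by (intro pmf_embed_pmf) auto
  then show ?thesis by (simp add: noise_pmf_def f_def)
qed

definition measurement :: "nat \<Rightarrow> (nat \<Rightarrow> nat) \<Rightarrow> (nat \<times> nat \<Rightarrow> nat) \<Rightarrow> nat \<times> nat \<Rightarrow> nat" where
  "measurement k g \<eta> = (\<lambda>(x, y). nat ((int (g x) - int (g y) + int (\<eta> (x, y))) mod int k))"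

definition equal_up_to_shift :: "nat \<Rightarrow> nat \<Rightarrow> (nat \<Rightarrow> nat) \<Rightarrow> (nat \<Rightarrow> nat) \<Rightarrow> bool" where
  "equal_up_to_shift n k g g' \<longleftrightarrow> (\<exists>\<alpha><k. \<forall>v\<in>{1..n}. g' v = (g v + \<alpha>) mod k)"

text \<open>The output label of item \<open>v\<close> is the content of memory cell \<open>v\<close> on termination.\<close>

definition success_prob :: "algorithm \<Rightarrow> nat \<Rightarrow> nat \<Rightarrow> nat \<Rightarrow> real \<Rightarrow> (nat \<Rightarrow> nat) \<Rightarrow> real" where
  "success_prob A w n k \<delta> g =
     (let qs = queries A w n k \<delta> in
      measure_pmf.prob (Pi_pmf (set qs) 0 (\<lambda>_. noise_pmf k \<delta>))
        {\<eta>. \<exists>s. execute A w n k \<delta> (map (measurement k g \<eta>) qs) = Some s \<and>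
              equal_up_to_shift n k g (mem s)})"

definition word_length :: "nat \<Rightarrow> nat \<Rightarrow> nat" where
  "word_length c n = c * nat \<lceil>log 2 (real n)\<rceil>"

text \<open>
  \<open>A\<close>, on words of \<open>c * \<lceil>log 2 n\<rceil>\<close> bits, solves joint alignment with parameters \<open>k n\<close>, \<open>\<delta> n\<close> as
  \<open>n\<close> grows. Since the labelings \<open>g n\<close> are arbitrary, the success probability tends to 1 uniformly
  in the labeling.
\<close>

definition solves_alignment ::
  "algorithm \<Rightarrow> nat \<Rightarrow> (nat \<Rightarrow> nat) \<Rightarrow> (nat \<Rightarrow> real) \<Rightarrow> (nat \<Rightarrow> real) \<Rightarrow> (nat \<Rightarrow> real) \<Rightarrow> bool" where
  "solves_alignment A c k \<delta> Q T \<longleftrightarrow>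
     (\<forall>\<^sub>F n in sequentially.
        valid_queries n (queries A (word_length c n) n (k n) (\<delta> n)) \<and>
        real (length (queries A (word_length c n) n (k n) (\<delta> n))) \<le> Q n \<and>
        runs_in_time A (word_length c n) n (k n) (\<delta> n) (T n)) \<and>
     (\<forall>g. (\<forall>\<^sub>F n in sequentially. g n \<in> {1..n} \<rightarrow> {..<k n}) \<longrightarrow>
        (\<lambda>n. success_prob A (word_length c n) n (k n) (\<delta> n) (g n)) \<longlonglongrightarrow> 1)"

end

theory Submission
  imports Defs "HOL-Real_Asymp.Real_Asymp"
begin

text \<open>
  Label an item \<open>x\<close> by the plurality of the votes \<open>f(x, y) + label y\<close> of a set of labelled voters
  \<open>y\<close>. Let \<open>s\<close> be about \<open>lg n (1 / (\<delta>\<^sup>2 k) + 1 / \<delta>)\<close> and split the items into groups \<open>S\<close>, \<open>S'\<close>, \<open>T\<close> of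
  size \<open>s\<close>, a root \<open>r\<close> with label 0 and the rest \<open>V\<close>. Five rounds are performed: \<open>V\<close> is labelled by
  \<open>r\<close>, \<open>S\<close> by \<open>V\<close>, \<open>S'\<close> by \<open>S\<close>, everything outside \<open>S\<close> and \<open>S'\<close> by \<open>S'\<close>, and finally \<open>S\<close> by \<open>T\<close>.
  No pair is used twice, so the voters' labels are always independent of the votes.

  After the first two rounds an item of \<open>S\<close> has been compared with \<open>r\<close> along about \<open>n\<close> paths of length
  two, each with a bias of about \<open>\<delta>\<^sup>2\<close>. For the smallest admissible \<open>\<delta>\<close> this errs with probability
  \<open>n\<close> to a small negative power, which is too large for a union bound over \<open>S\<close>, but by Markov's
  inequality at most one eighth of \<open>S\<close> is wrong with high probability. Voters of which at most one eighth is
  wrong make the next round err with probability at most \<open>1 / n\<^sup>4\<close> per wrong label, and from then on a union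
  bound suffices.
\<close>

text \<open>Two different error estimates are needed. A voter in \<open>V\<close> owes its label to
  one comparison and is right with probability only \<open>1 / k + \<delta>\<close>, so most of
  these voters may be wrong, and counting wrong voters gives nothing. Instead the noise of both
  comparisons is averaged at once: convolving the noise with itself leaves an excess of about
  \<open>\<delta>\<^sup>2\<close> on one label, and the Chernoff exponent is of order
  \<open>n * \<delta> ^ 4 / (4 / k + \<delta>\<^sup>2)\<close>. At
  \<open>\<delta> ^ 4 = lg n / (n k)\<close> this is a small multiple of \<open>lg n\<close>, which
  survives the union bound over the rival labels because \<open>k\<close> is eventually below every
  positive power of \<open>n\<close>. In the later rounds most voters are right, and
  \<open>m\<close> of them give an exponent of order
  \<open>m * \<delta>\<^sup>2 / (1 / k + \<delta>)\<close>; requiring \<open>4 lg n\<close> here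
  dictates the group size. The additional groups are forced by freshness. The pairs between
  \<open>S\<close> and \<open>V\<close> are spent once \<open>S\<close> is labelled, so
  \<open>S\<close> cannot correct \<open>V\<close> and hands over to \<open>S'\<close>; the pairs
  between \<open>S\<close> and \<open>S'\<close> are then spent too, so \<open>S\<close> is
  corrected by \<open>T\<close>.\<close>

section \<open>Structured programs for the word RAM\<close>

text \<open>
  \<open>Repeat c x y\<close> runs \<open>c\<close> at least once and again as long as register \<open>x\<close> is less than register \<open>y\<close>;
  \<open>Unless x y c\<close> skips \<open>c\<close> if register \<open>x\<close> is less than register \<open>y\<close>. These are the forms that need no
  jump other than \<open>Jump_Less\<close>.
\<close>

datatype com =
    Ops "instr list"
  | Seq com com (infixr ";;" 60)
  | Repeat com nat nat
  | Unless nat nat com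

fun csize :: "com \<Rightarrow> nat" where
  "csize (Ops is) = length is"
| "csize (c ;; d) = csize c + csize d"
| "csize (Repeat c x y) = csize c + 1"
| "csize (Unless x y c) = csize c + 1"

text \<open>Jump targets are absolute, so the code has to know the address \<open>b\<close> at which
  it will be placed.\<close>

fun compile :: "nat \<Rightarrow> com \<Rightarrow> instr list" where
  "compile b (Ops is) = is"
| "compile b (c ;; d) = compile b c @ compile (b + csize c) d"
| "compile b (Repeat c x y) = compile b c @ [Jump_Less x y b]"
| "compile b (Unless x y c) = Jump_Less x y (b + csize c + 1) # compile (b + 1) c"

lemma length_compile [simp]: "length (compile b c) = csize c"
  by (induction c arbitrary: b) auto

definition is_jump :: "instr \<Rightarrow> bool" where
  "is_jump i \<longleftrightarrow> (\<exists>a b l. i = Jump_Less a b l)"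

lemma is_jump_simps [simp]:
  "is_jump (Jump_Less a b l)" "\<not> is_jump (Const r c)" "\<not> is_jump (Arith f r a b)"
  "\<not> is_jump (Load r a)" "\<not> is_jump (Store a b)" "\<not> is_jump (Ask a b)" "\<not> is_jump (Answer r a)"
  by (auto simp: is_jump_def)

definition tick :: "state \<Rightarrow> state" where
  "tick s = s\<lparr>clock := Suc (clock s)\<rparr>"

lemma tick_simps [simp]:
  "reg (tick s) = reg s" "mem (tick s) = mem s" "asked (tick s) = asked s"
  "clock (tick s) = Suc (clock s)" "pc (tick s) = pc s"
  by (simp_all add: tick_def)

text \<open>The effect of \<open>step\<close> without the program counter. In the big-step semantics
  the field \<open>pc\<close> carries no meaning; it is set only when passing to compiled
  code.\<close>

definition do_op :: "nat \<Rightarrow> nat list \<Rightarrow> instr \<Rightarrow> state \<Rightarrow> state" where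
  "do_op w ans i s = exec_instr w ans i (tick s)"

inductive exec_com :: "nat \<Rightarrow> nat list \<Rightarrow> com \<Rightarrow> state \<Rightarrow> state \<Rightarrow> bool" for w ans where
  Ops: "\<forall>i\<in>set is. \<not> is_jump i \<Longrightarrow> exec_com w ans (Ops is) s (fold (do_op w ans) is s)"
| Seq: "exec_com w ans c s t \<Longrightarrow> exec_com w ans d t u \<Longrightarrow> exec_com w ans (c ;; d) s u"
| Repeat_exit: "exec_com w ans c s t \<Longrightarrow> \<not> reg t x < reg t y \<Longrightarrow>
    exec_com w ans (Repeat c x y) s (tick t)"
| Repeat_loop: "exec_com w ans c s t \<Longrightarrow> reg t x < reg t y \<Longrightarrow>
    exec_com w ans (Repeat c x y) (tick t) u \<Longrightarrow> exec_com w ans (Repeat c x y) s u"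
| Unless_skip: "reg s x < reg s y \<Longrightarrow> exec_com w ans (Unless x y c) s (tick s)"
| Unless_do: "\<not> reg s x < reg s y \<Longrightarrow> exec_com w ans c (tick s) t \<Longrightarrow>
    exec_com w ans (Unless x y c) s t"

text \<open>A relational form of the machine step, so that pieces of an execution compose by
  transitivity before \<open>run_moves\<close> turns them into a run of the while loop.\<close>

definition move :: "nat \<Rightarrow> nat list \<Rightarrow> instr list \<Rightarrow> state \<Rightarrow> state \<Rightarrow> bool" where
  "move w ans P s t \<longleftrightarrow> pc s < length P \<and> t = step w ans P s"

lemma move_op:
  assumes "\<not> is_jump (P ! b)" "b < length P"
  shows "move w ans P (s\<lparr>pc := b\<rparr>) ((do_op w ans (P ! b) s)\<lparr>pc := Suc b\<rparr>)"
  using assms by (cases "P ! b") (auto simp: move_def step_def do_op_def tick_def)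

lemma move_jump:
  assumes "P ! b = Jump_Less x y l" "b < length P"
  shows "move w ans P (s\<lparr>pc := b\<rparr>) ((tick s)\<lparr>pc := if reg s x < reg s y then l else Suc b\<rparr>)"
  using assms by (auto simp: move_def step_def tick_def)

lemma moves_ops:
  assumes "\<forall>i\<in>set is. \<not> is_jump i"
  shows "(move w ans (p @ is @ q))\<^sup>*\<^sup>* (s\<lparr>pc := length p\<rparr>)
    ((fold (do_op w ans) is s)\<lparr>pc := length p + length is\<rparr>)"
  using assms
proof (induction "is" arbitrary: p s)
  case (Cons i "is")
  have "move w ans (p @ (i # is) @ q) (s\<lparr>pc := length p\<rparr>)
      ((do_op w ans i s)\<lparr>pc := Suc (length p)\<rparr>)"
    using move_op[of "p @ (i # is) @ q" "length p" w ans s] Cons.prems by simp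
  moreover have "(move w ans ((p @ [i]) @ is @ q))\<^sup>*\<^sup>* ((do_op w ans i s)\<lparr>pc := length (p @ [i])\<rparr>)
    ((fold (do_op w ans) is (do_op w ans i s))\<lparr>pc := length (p @ [i]) + length is\<rparr>)"
    using Cons.prems by (intro Cons.IH) auto
  ultimately show ?case by (simp add: converse_rtranclp_into_rtranclp)
qed simp

text \<open>Compiler correctness by induction on the big-step execution. The arbitrary surrounding
  code \<open>p\<close> and \<open>q\<close> absorbs the neighbours of a subcommand, so that the
  induction hypotheses apply to it in place.\<close>

lemma moves_compile:
  assumes "exec_com w ans c s t"
  shows "(move w ans (p @ compile (length p) c @ q))\<^sup>*\<^sup>*
    (s\<lparr>pc := length p\<rparr>) (t\<lparr>pc := length p + csize c\<rparr>)"
  using assms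
proof (induction arbitrary: p q)
  case (Ops "is" s)
  then show ?case using moves_ops[of "is" w ans p q s] by simp
next
  case (Seq c s t d u)
  show ?case
    using Seq.IH(1)[of p "compile (length p + csize c) d @ q"]
      Seq.IH(2)[of "p @ compile (length p) c" q]
    by (simp add: add.assoc)
next
  case (Repeat_exit c s t x y)
  let ?P = "p @ compile (length p) (Repeat c x y) @ q"
  have "?P ! (length p + csize c) = Jump_Less x y (length p)"
    by (simp add: nth_append)
  then have "move w ans ?P (t\<lparr>pc := length p + csize c\<rparr>)
      ((tick t)\<lparr>pc := Suc (length p + csize c)\<rparr>)"
    using move_jump[of ?P "length p + csize c" x y "length p" w ans t] Repeat_exit by simp
  then show ?case
    using Repeat_exit.IH[of p "Jump_Less x y (length p) # q"]
    by (simp add: rtranclp.rtrancl_into_rtrancl)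
next
  case (Repeat_loop c s t x y u)
  let ?P = "p @ compile (length p) (Repeat c x y) @ q"
  have "?P ! (length p + csize c) = Jump_Less x y (length p)"
    by (simp add: nth_append)
  then have "move w ans ?P (t\<lparr>pc := length p + csize c\<rparr>) ((tick t)\<lparr>pc := length p\<rparr>)"
    using move_jump[of ?P "length p + csize c" x y "length p" w ans t] Repeat_loop by simp
  then show ?case
    using Repeat_loop.IH(1)[of p "Jump_Less x y (length p) # q"] Repeat_loop.IH(2)[of p q]
    by simp
next
  case (Unless_skip s x y c)
  let ?P = "p @ compile (length p) (Unless x y c) @ q"
  have "move w ans ?P (s\<lparr>pc := length p\<rparr>) ((tick s)\<lparr>pc := length p + csize c + 1\<rparr>)"
    using move_jump[of ?P "length p" x y "length p + csize c + 1" w ans s] Unless_skip by simp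
  then show ?case by (auto simp: add.assoc)
next
  case (Unless_do s x y c t)
  let ?j = "Jump_Less x y (length p + csize c + 1)"
  let ?P = "p @ compile (length p) (Unless x y c) @ q"
  have "move w ans ?P (s\<lparr>pc := length p\<rparr>) ((tick s)\<lparr>pc := Suc (length p)\<rparr>)"
    using move_jump[of ?P "length p" x y "length p + csize c + 1" w ans s] Unless_do by simp
  then show ?case
    using Unless_do.IH[of "p @ [?j]" q] by (simp add: converse_rtranclp_into_rtranclp)
qed

lemma run_moves:
  assumes "(move w ans P)\<^sup>*\<^sup>* s t" "length P \<le> pc t"
  shows "run w ans P s = Some t"
  using assms
proof (induction rule: converse_rtranclp_induct)
  case base
  then show ?case by (simp add: run_def while_option_unfold)
next
  case (step y z)
  then show ?case
    by (subst run_def, subst while_option_unfold) (auto simp: move_def run_def)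
qed

lemma run_compile:
  assumes "exec_com w ans c s t"
  shows "run w ans (compile 0 c) (s\<lparr>pc := 0\<rparr>) = Some (t\<lparr>pc := csize c\<rparr>)"
  using run_moves[OF moves_compile[OF assms, of "[]" "[]"]] by simp

text \<open>Existence of one finished execution amounts to total correctness here: by
  \<open>run_compile\<close> it determines the result of the deterministic machine.\<close>

definition wp :: "nat \<Rightarrow> nat list \<Rightarrow> com \<Rightarrow> (state \<Rightarrow> bool) \<Rightarrow> state \<Rightarrow> bool" where
  "wp w ans c Q s \<longleftrightarrow> (\<exists>t. exec_com w ans c s t \<and> Q t)"

lemma wp_mono: "wp w ans c Q s \<Longrightarrow> (\<And>t. Q t \<Longrightarrow> Q' t) \<Longrightarrow> wp w ans c Q' s"
  by (auto simp: wp_def)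

lemma wp_Ops:
  "\<forall>i\<in>set is. \<not> is_jump i \<Longrightarrow> Q (fold (do_op w ans) is s) \<Longrightarrow> wp w ans (Ops is) Q s"
  by (auto simp: wp_def intro: exec_com.Ops)

lemma wp_Seq: "wp w ans c (wp w ans d Q) s \<Longrightarrow> wp w ans (c ;; d) Q s"
  by (auto simp: wp_def intro: exec_com.Seq)

lemma wp_Unless:
  assumes "reg s x < reg s y \<Longrightarrow> Q (tick s)" "\<not> reg s x < reg s y \<Longrightarrow> wp w ans c Q (tick s)"
  shows "wp w ans (Unless x y c) Q s"
  using assms by (cases "reg s x < reg s y") (auto simp: wp_def intro: exec_com.intros)

text \<open>The invariant is indexed by a counter with known final value \<open>hi\<close>, which
  doubles as termination measure. The body precedes the first test, hence \<open>lo < hi\<close>;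
  the \<open>tick\<close> accounts for the jump.\<close>

lemma wp_Repeat:
  assumes "J lo s" "lo < hi"
    and body: "\<And>j s. lo \<le> j \<Longrightarrow> j < hi \<Longrightarrow> J j s \<Longrightarrow>
      wp w ans c (\<lambda>t. (reg t x < reg t y \<longleftrightarrow> Suc j < hi) \<and> J (Suc j) (tick t)) s"
  shows "wp w ans (Repeat c x y) (J hi) s"
proof -
  have "\<exists>t. exec_com w ans (Repeat c x y) s t \<and> J hi t" if "J j s" "lo \<le> j" "j < hi" for j s
    using that
  proof (induction "hi - j" arbitrary: j s rule: less_induct)
    case less
    obtain t where t: "exec_com w ans c s t" "reg t x < reg t y \<longleftrightarrow> Suc j < hi"
      "J (Suc j) (tick t)"
      using body[OF less.prems(2,3,1)] by (auto simp: wp_def)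
    show ?case
    proof (cases "Suc j < hi")
      case True
      have "\<exists>u. exec_com w ans (Repeat c x y) (tick t) u \<and> J hi u"
        using less.hyps[of "Suc j" "tick t"] t True less.prems by auto
      then show ?thesis using t True by (auto intro: exec_com.Repeat_loop)
    next
      case False
      then have "hi = Suc j" using less.prems by simp
      then show ?thesis using t by (auto intro: exec_com.Repeat_exit)
    qed
  qed
  then show ?thesis using assms(1,2) by (auto simp: wp_def)
qed

section \<open>Rounds of plurality votes\<close>

text \<open>Ties are broken as the program does it: a label takes over as soon as it draws level.\<close>

fun plurality_rev :: "nat list \<Rightarrow> nat" where
  "plurality_rev [] = 0"
| "plurality_rev (v # vs) =
     (if count_list vs (plurality_rev vs) \<le> count_list vs v then v else plurality_rev vs)"

text \<open>The reversal puts the newest vote at the head of the recursion, so that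
  \<open>plurality_snoc\<close> describes one iteration of the program's running maximum.\<close>

definition plurality :: "nat list \<Rightarrow> nat" where
  "plurality vs = plurality_rev (rev vs)"

lemma count_list_rev [simp]: "count_list (rev vs) v = count_list vs v"
  by (induction vs) auto

lemma plurality_Nil [simp]: "plurality [] = 0"
  by (simp add: plurality_def)

lemma plurality_snoc:
  "plurality (vs @ [v]) =
     (if count_list vs (plurality vs) \<le> count_list vs v then v else plurality vs)"
  by (simp add: plurality_def)

lemma count_le_count_plurality: "count_list vs j \<le> count_list vs (plurality vs)"
proof (induction vs rule: rev_induct)
  case (snoc v vs)
  then show ?case
    by (auto simp: plurality_snoc intro: le_SucI elim: order_trans)
qed simp

lemma plurality_cases: "vs = [] \<and> plurality vs = 0 \<or> plurality vs \<in> set vs"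
  by (induction vs rule: rev_induct) (auto simp: plurality_snoc)

lemma plurality_less: "set vs \<subseteq> {..<k} \<Longrightarrow> 0 < k \<Longrightarrow> plurality vs < k"
  using plurality_cases[of vs] by auto

lemma plurality_eqI:
  assumes "set vs \<subseteq> {..<k}" "0 < k" "\<And>j. j < k \<Longrightarrow> j \<noteq> c \<Longrightarrow> count_list vs j < count_list vs c"
  shows "plurality vs = c"
  using assms(3)[of "plurality vs"] plurality_less[OF assms(1,2)] count_le_count_plurality[of vs c]
  by force

text \<open>
  A round \<open>(a, b, c, d)\<close> labels the items \<open>a..<b\<close> anew by the votes of the items \<open>c..<d\<close>. In the programs
  a quadruple holds the numbers of the four registers that contain these bounds.
\<close>

type_synonym quad = "nat \<times> nat \<times> nat \<times> nat"

definition votes :: "nat \<Rightarrow> (nat \<times> nat \<Rightarrow> nat) \<Rightarrow> (nat \<Rightarrow> nat) \<Rightarrow> nat \<Rightarrow> nat \<Rightarrow> nat \<Rightarrow> nat list" where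
  "votes k f h x c d = map (\<lambda>y. (f (x, y) + h y) mod k) [c..<d]"

definition relabel ::
  "nat \<Rightarrow> (nat \<times> nat \<Rightarrow> nat) \<Rightarrow> quad \<Rightarrow> (nat \<Rightarrow> nat) \<Rightarrow> nat \<Rightarrow> nat" where
  "relabel k f = (\<lambda>(a, b, c, d) h x.
     if a \<le> x \<and> x < b then plurality (votes k f h x c d) else h x)"

definition round_pairs :: "quad \<Rightarrow> (nat \<times> nat) list" where
  "round_pairs = (\<lambda>(a, b, c, d). List.product [a..<b] [c..<d])"

lemma votes_Suc: "c \<le> d \<Longrightarrow> votes k f h x c (Suc d) = votes k f h x c d @ [(f (x, d) + h d) mod k]"
  by (simp add: votes_def)

lemma votes_Nil [simp]: "votes k f h x c c = []"
  by (simp add: votes_def)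

lemma set_votes: "0 < k \<Longrightarrow> set (votes k f h x c d) \<subseteq> {..<k}"
  by (auto simp: votes_def)

lemma product_upt_Suc:
  assumes "a \<le> b"
  shows "List.product [a..<Suc b] ys = List.product [a..<b] ys @ map (Pair b) ys"
proof -
  have "List.product (xs @ [b]) ys = List.product xs ys @ map (Pair b) ys" for xs
    by (induction xs) auto
  then show ?thesis using assms by simp
qed

text \<open>
  Registers 16 to 19 hold the bounds of the current round, 3 and 9 the constants 1 and 0, 20 and 21 the
  target and the voter, 22 the position of the next answer, 26 and 27 the best count and its address.
  Register 28 is the start of a block of \<open>k\<close> counters; every target gets a fresh block, because clearing
  an old one could cost more than the votes themselves.
\<close>

definition ask_com :: com where
  "ask_com =
     Ops [Arith Add 20 16 9] ;;
     Repeat (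
       Ops [Arith Add 21 18 9] ;;
       Repeat (Ops [Ask 20 21, Arith Add 21 21 3]) 21 19 ;;
       Ops [Arith Add 20 20 3]) 20 17"

text \<open>Registers 24 and 25 are both one larger than the counts before this vote, which are what
  \<open>plurality_snoc\<close> compares. The update also refreshes the best count when the vote
  goes to the current leader.\<close>

definition tally_com :: com where
  "tally_com =
     Ops [Answer 23 22, Load 24 21, Arith Add 23 23 24, Arith Mod 23 23 1, Arith Add 23 23 28,
       Load 24 23, Arith Add 24 24 3, Store 23 24, Arith Add 22 22 3, Arith Add 21 21 3,
       Arith Add 25 26 3] ;;
     Unless 24 25 (Ops [Arith Add 26 24 9, Arith Add 27 23 9])"

definition vote_com :: com where
  "vote_com =
     Ops [Arith Add 20 16 9] ;;
     Repeat (
       Ops [Arith Add 21 18 9, Const 26 0, Arith Add 27 28 9] ;;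
       Repeat tally_com 21 19 ;;
       Ops [Arith Sub 27 27 28, Store 20 27, Arith Add 28 28 1, Arith Add 20 20 3]) 20 17"

text \<open>Absorbs the initial step and the overhead \<open>p\<close> per target into the number
  \<open>u * v\<close> of votes, so that a round costs a constant per query.\<close>

lemma affine_le_product:
  fixes u v :: nat
  assumes "0 < u" "0 < v"
  shows "1 + (p + q * v) * u \<le> (1 + p + q) * u * v"
proof -
  have "p * u \<le> p * (u * v)" "1 \<le> u * v"
    using assms by auto
  then have "1 + p * u \<le> u * v + p * (u * v)"
    by (rule add_mono[rotated])
  then show ?thesis by (simp add: algebra_simps)
qed

lemma wp_ask_com:
  assumes s: "reg s 3 = 1" "reg s 9 = 0" "reg s 16 = a" "reg s 17 = b" "reg s 18 = c" "reg s 19 = d"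
    and ab: "a < b" "b < 2 ^ w" and cd: "c < d" "d < 2 ^ w"
  shows "wp w ans ask_com (\<lambda>t. (\<forall>r<20. reg t r = reg s r) \<and> mem t = mem s \<and>
      asked t = asked s @ round_pairs (a, b, c, d) \<and>
      clock t \<le> clock s + 7 * (b - a) * (d - c)) s"
proof -
  \<comment> \<open>Each voter costs two operations and a jump, each target two further operations
    and a jump; the single 1 is the initialisation of register 20.\<close>
  define J :: "nat \<Rightarrow> state \<Rightarrow> bool" where
    "J = (\<lambda>x t. reg t 20 = x \<and> (\<forall>r<20. reg t r = reg s r) \<and> mem t = mem s \<and>
      asked t = asked s @ round_pairs (a, x, c, d) \<and>
      clock t \<le> clock s + 1 + (3 + 3 * (d - c)) * (x - a))"
  let ?in = "Repeat (Ops [Ask 20 21, Arith Add 21 21 3]) 21 19"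
  let ?out = "Ops [Arith Add 21 18 9] ;; ?in ;; Ops [Arith Add 20 20 3]"
  have inner: "wp w ans ?out (\<lambda>t. (reg t 20 < reg t 17 \<longleftrightarrow> Suc x < b) \<and> J (Suc x) (tick t)) t"
    if x: "a \<le> x" "x < b" and t: "J x t" for x t
  proof -
    define I :: "nat \<Rightarrow> state \<Rightarrow> bool" where
      "I = (\<lambda>y t. reg t 21 = y \<and> reg t 20 = x \<and> (\<forall>r<20. reg t r = reg s r) \<and> mem t = mem s \<and>
        asked t = asked s @ round_pairs (a, x, c, d) @ map (Pair x) [c..<y] \<and>
        clock t \<le> clock s + 2 + (3 + 3 * (d - c)) * (x - a) + 3 * (y - c))"
    have "wp w ans ?in (I d) (fold (do_op w ans) [Arith Add 21 18 9] t)"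
    proof (rule wp_Repeat[where lo = c])
      show "I c (fold (do_op w ans) [Arith Add 21 18 9] t)"
        using s cd t by (auto simp: I_def J_def do_op_def)
      fix y u assume y: "c \<le> y" "y < d" and u: "I y u"
      then show "wp w ans (Ops [Ask 20 21, Arith Add 21 21 3])
          (\<lambda>t. (reg t 21 < reg t 19 \<longleftrightarrow> Suc y < d) \<and> I (Suc y) (tick t)) u"
        using s cd by (intro wp_Ops) (auto simp: I_def do_op_def Suc_diff_le)
    qed (use cd in auto)
    moreover have "wp w ans (Ops [Arith Add 20 20 3])
        (\<lambda>t. (reg t 20 < reg t 17 \<longleftrightarrow> Suc x < b) \<and> J (Suc x) (tick t)) u" if "I d u" for u
      using that x s ab cd
      by (intro wp_Ops)
        (auto simp: I_def J_def do_op_def round_pairs_def product_upt_Suc Suc_diff_le simp del: upt_Suc)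
    ultimately show ?thesis
      by (intro wp_Seq wp_Ops) (auto intro: wp_mono)
  qed
  have "wp w ans (Repeat ?out 20 17) (J b) (fold (do_op w ans) [Arith Add 20 16 9] s)"
  proof (rule wp_Repeat[where lo = a])
    show "J a (fold (do_op w ans) [Arith Add 20 16 9] s)"
      using s ab by (auto simp: J_def do_op_def round_pairs_def)
  qed (use ab inner in auto)
  then have "wp w ans ask_com (J b) s"
    unfolding ask_com_def by (intro wp_Seq wp_Ops) auto
  moreover have "1 + (3 + 3 * (d - c)) * (b - a) \<le> 7 * (b - a) * (d - c)"
    using affine_le_product[of "b - a" "d - c" 3 3] ab cd by simp
  ultimately show ?thesis
    by (elim wp_mono) (auto simp: J_def)
qed

text \<open>By \<open>disj\<close> no label written in this round is also read in it, so overwriting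
  the targets one after the other agrees with the simultaneous \<open>relabel\<close>. The cells
  from \<open>B\<close> on are still 0 and supply the fresh counters, those of target
  \<open>x\<close> starting at \<open>B + (x - a) * k\<close>.\<close>

lemma wp_vote_com:
  fixes w :: nat and f :: "nat \<times> nat \<Rightarrow> nat"
  assumes s: "reg s 1 = k" "reg s 3 = 1" "reg s 9 = 0" "reg s 16 = a" "reg s 17 = b" "reg s 18 = c"
      "reg s 19 = d" "reg s 22 = p" "reg s 28 = B"
    and ab: "a < b" "b \<le> B" and cd: "c < d" "d \<le> B"
    and disj: "b \<le> c \<or> d \<le> a"
    and size: "B + (b - a) * k < 2 ^ w" "p + (b - a) * (d - c) < 2 ^ w" "2 * k < 2 ^ w" "0 < k"
    and ans: "\<And>x y. a \<le> x \<Longrightarrow> x < b \<Longrightarrow> c \<le> y \<Longrightarrow> y < d \<Longrightarrow>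
       p + (x - a) * (d - c) + (y - c) < length ans \<and>
       ans ! (p + (x - a) * (d - c) + (y - c)) = f (x, y) \<and> f (x, y) < k"
    and m: "\<And>v. c \<le> v \<Longrightarrow> v < d \<Longrightarrow> mem s v < k" "\<And>v. B \<le> v \<Longrightarrow> mem s v = 0"
  shows "wp w ans vote_com (\<lambda>t. (\<forall>r<20. reg t r = reg s r) \<and>
      reg t 22 = p + (b - a) * (d - c) \<and> reg t 28 = B + (b - a) * k \<and>
      (\<forall>v<B. mem t v = relabel k f (a, b, c, d) (mem s) v) \<and>
      (\<forall>v\<ge>B + (b - a) * k. mem t v = 0) \<and>
      clock t \<le> clock s + 24 * (b - a) * (d - c)) s"
proof -
  define lab where "lab = (\<lambda>x. relabel k f (a, x, c, d) (mem s))"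
  \<comment> \<open>A voter costs at most 11 + 1 + 2 operations and the loop jump, a target 3 + 4
    operations and a jump.\<close>
  define J :: "nat \<Rightarrow> state \<Rightarrow> bool" where
    "J = (\<lambda>x t. reg t 20 = x \<and> (\<forall>r<20. reg t r = reg s r) \<and>
      reg t 22 = p + (x - a) * (d - c) \<and> reg t 28 = B + (x - a) * k \<and>
      (\<forall>v<B. mem t v = lab x v) \<and> (\<forall>v\<ge>B + (x - a) * k. mem t v = 0) \<and>
      clock t \<le> clock s + 1 + (8 + 15 * (d - c)) * (x - a))"
  let ?in = "Repeat tally_com 21 19"
  let ?pre = "[Arith Add 21 18 9, Const 26 0, Arith Add 27 28 9]"
  let ?post = "[Arith Sub 27 27 28, Store 20 27, Arith Add 28 28 1, Arith Add 20 20 3]"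
  let ?out = "Ops ?pre ;; ?in ;; Ops ?post"
  have inner: "wp w ans ?out (\<lambda>t. (reg t 20 < reg t 17 \<longleftrightarrow> Suc x < b) \<and> J (Suc x) (tick t)) t"
    if x: "a \<le> x" "x < b" and t: "J x t" for x t
  proof -
    define p' where "p' = p + (x - a) * (d - c)"
    define B' where "B' = B + (x - a) * k"
    define vs where "vs = votes k f (mem s) x c"
    have "(x - a) * (d - c) + (d - c) \<le> (b - a) * (d - c)" 
      using x by (metis Suc_diff_le Suc_leI diff_le_mono mult_Suc add.commute mult_le_mono1)
    then have p': "p' + (d - c) < 2 ^ w" using size by (simp add: p'_def)
    have "(x - a) * k + k \<le> (b - a) * k" 
      using x by (metis Suc_diff_le Suc_leI diff_le_mono mult_Suc add.commute mult_le_mono1)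
    then have B': "B' + k < 2 ^ w" "B \<le> B'" using size by (simp_all add: B'_def)
    have pl: "plurality (vs y) < k" "set (vs y) \<subseteq> {..<k}" for y
      unfolding vs_def using size set_votes plurality_less by metis+
    have cnt: "count_list (vs y) j \<le> y - c" for y j
      using count_le_length[of "vs y" j] by (simp add: vs_def votes_def)
    define I :: "nat \<Rightarrow> state \<Rightarrow> bool" where
      "I = (\<lambda>y u. reg u 21 = y \<and> reg u 20 = x \<and> (\<forall>r<20. reg u r = reg s r) \<and>
        reg u 22 = p' + (y - c) \<and> reg u 28 = B' \<and>
        reg u 26 = count_list (vs y) (plurality (vs y)) \<and> reg u 27 = B' + plurality (vs y) \<and>
        mem u = (\<lambda>v. if B' \<le> v \<and> v < B' + k then count_list (vs y) (v - B') else mem t v) \<and>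
        clock u \<le> clock t + 3 + 15 * (y - c))"
    have "wp w ans ?in (I d) (fold (do_op w ans) ?pre t)"
    proof (rule wp_Repeat[where lo = c])
      show "I c (fold (do_op w ans) ?pre t)"
        using s cd t size B' by (auto simp: I_def J_def do_op_def vs_def B'_def p'_def fun_eq_iff)
      fix y u assume y: "c \<le> y" "y < d" and u: "I y u"
      define v where "v = (f (x, y) + mem s y) mod k"
      have v: "v < k" using size by (simp add: v_def)
      have a1: "ans ! (p' + (y - c)) = f (x, y)" "f (x, y) < k" "p' + (y - c) < length ans"
        using ans[OF x y] by (simp_all add: p'_def)
      have a2: "mem t y = mem s y" "mem s y < k" "y < B"
        using t y x disj m cd ab by (auto simp: J_def lab_def relabel_def)
      have vs: "vs (Suc y) = vs y @ [v]" using y by (simp add: vs_def votes_Suc v_def)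
      have cv: "count_list (vs y) v + 1 < 2 ^ w" "count_list (vs y) (plurality (vs y)) + 1 < 2 ^ w"
        using cnt[of y v] cnt[of y "plurality (vs y)"] y p' by simp_all
      have y': "Suc (p' + (y - c)) < 2 ^ w" "Suc y < 2 ^ w" using p' y B' cd size by auto
      have regs: "reg u 1 = k" "reg u 3 = 1" "reg u 9 = 0" "reg u 19 = d" "reg u 21 = y"
        "reg u 22 = p' + (y - c)" "reg u 28 = B'" "reg u 26 = count_list (vs y) (plurality (vs y))"
        "mem u y = mem s y" "mem u (B' + v) = count_list (vs y) v"
        using u s a2 B' v by (auto simp: I_def)
      let ?ops = "[Answer 23 22, Load 24 21, Arith Add 23 23 24, Arith Mod 23 23 1,
        Arith Add 23 23 28, Load 24 23, Arith Add 24 24 3, Store 23 24, Arith Add 22 22 3,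
        Arith Add 21 21 3, Arith Add 25 26 3]"
      define st where "st = fold (do_op w ans) ?ops u"
      have fl: "f (x, y) mod 2 ^ w = f (x, y)" "(f (x, y) + mem s y) mod 2 ^ w = f (x, y) + mem s y"
        "(v + B') mod 2 ^ w = B' + v" 
        using a1 a2 size v B' by (auto simp: add.commute)
      have st: "reg st = (reg u)(23 := B' + v, 24 := Suc (count_list (vs y) v),
          22 := Suc (p' + (y - c)), 21 := Suc y, 25 := Suc (count_list (vs y) (plurality (vs y))))"
        "mem st = (mem u)(B' + v := Suc (count_list (vs y) v))" "clock st = clock u + 11"
        using regs a1 fl cv y' by (auto simp: st_def do_op_def v_def[symmetric] fun_eq_iff)
      have mem: "mem st = (\<lambda>z. if B' \<le> z \<and> z < B' + k then count_list (vs (Suc y)) (z - B') else mem t z)"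
        using u v by (auto simp: st I_def vs fun_eq_iff)
      have r20: "\<forall>r<20. reg st r = reg s r" "reg st 20 = x" using u by (auto simp: st I_def)
      show "wp w ans tally_com
          (\<lambda>t. (reg t 21 < reg t 19 \<longleftrightarrow> Suc y < d) \<and> I (Suc y) (tick t)) u"
        unfolding tally_com_def
      proof (intro wp_Seq wp_Ops, fold st_def)
        show "wp w ans (Unless 24 25 (Ops [Arith Add 26 24 9, Arith Add 27 23 9]))
          (\<lambda>t. (reg t 21 < reg t 19 \<longleftrightarrow> Suc y < d) \<and> I (Suc y) (tick t)) st"
        proof (rule wp_Unless)
          assume "reg st 24 < reg st 25"
          then show "(reg (tick st) 21 < reg (tick st) 19 \<longleftrightarrow> Suc y < d) \<and> I (Suc y) (tick (tick st))"
            using u regs r20 y mem s by (auto simp: I_def st(1,3) vs plurality_snoc Suc_diff_le)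
        next
          assume less: "\<not> reg st 24 < reg st 25"
          show "wp w ans (Ops [Arith Add 26 24 9, Arith Add 27 23 9])
            (\<lambda>t. (reg t 21 < reg t 19 \<longleftrightarrow> Suc y < d) \<and> I (Suc y) (tick t)) (tick st)"
            using less u regs r20 y mem s cv B' v
            by (intro wp_Ops) (auto simp: do_op_def I_def st(1,3) vs plurality_snoc Suc_diff_le)
        qed
      qed auto
    qed (use cd in auto)
    moreover have "wp w ans (Ops ?post)
        (\<lambda>t. (reg t 20 < reg t 17 \<longleftrightarrow> Suc x < b) \<and> J (Suc x) (tick t)) u" if "I d u" for u
    proof (intro wp_Ops)
      define st where "st = fold (do_op w ans) ?post u"
      have regs: "reg u 1 = k" "reg u 3 = 1" "reg u 17 = b" "reg u 20 = x" "reg u 28 = B'"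
          "reg u 27 = B' + plurality (vs d)" "reg u 22 = p' + (d - c)"
        using that s by (auto simp: I_def)
      have fl: "(plurality (vs d) + 2 ^ w) mod 2 ^ w = plurality (vs d)" "Suc x < 2 ^ w"
        using pl[of d] B' x ab by auto
      have st: "reg st = (reg u)(27 := plurality (vs d), 28 := B' + k, 20 := Suc x)"
          "mem st = (mem u)(x := plurality (vs d))" "clock st = clock u + 4"
        using regs fl B' by (auto simp: st_def do_op_def fun_eq_iff)
      have eqs: "p + (Suc x - a) * (d - c) = p' + (d - c)" "B + (Suc x - a) * k = B' + k"
        using x by (simp_all add: p'_def B'_def Suc_diff_le)
      have lab: "lab (Suc x) = (lab x)(x := plurality (vs d))"
        using x by (auto simp: lab_def relabel_def vs_def fun_eq_iff)
      have "clock (tick st) \<le> clock s + 1 + (8 + 15 * (d - c)) * (Suc x - a)"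
        using that t x by (auto simp: I_def J_def st Suc_diff_le)
      moreover have "\<forall>v<B. mem (tick st) v = lab (Suc x) v" 
        using that t B' by (auto simp: I_def J_def st lab)
      moreover have "\<forall>v\<ge>B' + k. mem (tick st) v = 0" 
        using that t B' x ab by (auto simp: I_def J_def st B'_def)
      moreover have "\<forall>r<20. reg (tick st) r = reg s r"
        using that by (auto simp: I_def st)
      ultimately show "(reg st 20 < reg st 17 \<longleftrightarrow> Suc x < b) \<and> J (Suc x) (tick st)"
        unfolding J_def eqs using st regs by simp
    qed auto
    ultimately show ?thesis
      by (intro wp_Seq wp_Ops) (auto intro: wp_mono)
  qed
  have "wp w ans (Repeat ?out 20 17) (J b) (fold (do_op w ans) [Arith Add 20 16 9] s)"
  proof (rule wp_Repeat[where lo = a])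
    show "J a (fold (do_op w ans) [Arith Add 20 16 9] s)"
      using s ab size m by (auto simp: J_def do_op_def lab_def relabel_def)
  qed (use ab inner in auto)
  then have "wp w ans vote_com (J b) s"
    unfolding vote_com_def by (intro wp_Seq wp_Ops) auto
  moreover have "1 + (8 + 15 * (d - c)) * (b - a) \<le> 24 * (b - a) * (d - c)"
    using affine_le_product[of "b - a" "d - c" 8 15] ab cd by simp
  ultimately show ?thesis
    by (elim wp_mono) (auto simp: J_def lab_def)
qed

section \<open>Sequences of rounds and the order of their answers\<close>

definition select_com :: "quad \<Rightarrow> com" where
  "select_com = (\<lambda>(a, b, c, d).
     Ops [Arith Add 16 a 9, Arith Add 17 b 9, Arith Add 18 c 9, Arith Add 19 d 9])"

fun rounds_com :: "com \<Rightarrow> quad list \<Rightarrow> com" where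
  "rounds_com body [] = Ops []"
| "rounds_com body (r # rs) = select_com r ;; body ;; rounds_com body rs"

definition quad_val :: "(nat \<Rightarrow> nat) \<Rightarrow> quad \<Rightarrow> quad" where
  "quad_val \<rho> = (\<lambda>(a, b, c, d). (\<rho> a, \<rho> b, \<rho> c, \<rho> d))"

definition quad_regs :: "quad \<Rightarrow> bool" where
  "quad_regs = (\<lambda>(a, b, c, d). a < 16 \<and> b < 16 \<and> c < 16 \<and> d < 16)"

definition valid_round :: "nat \<Rightarrow> quad \<Rightarrow> bool" where
  "valid_round N = (\<lambda>(a, b, c, d). a < b \<and> b \<le> N \<and> c < d \<and> d \<le> N \<and> (b \<le> c \<or> d \<le> a))"

abbreviation all_pairs :: "quad list \<Rightarrow> (nat \<times> nat) list" where
  "all_pairs rs \<equiv> concat (map round_pairs rs)"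

lemma length_round_pairs: "length (round_pairs (a, b, c, d)) = (b - a) * (d - c)"
  by (simp add: round_pairs_def)

lemma wp_select_com:
  assumes "quad_regs r" "quad_val \<rho> r = (a, b, c, d)" "\<forall>i<16. reg s i = \<rho> i" "\<rho> 9 = 0"
    "a < 2 ^ w" "b < 2 ^ w" "c < 2 ^ w" "d < 2 ^ w"
  shows "wp w ans (select_com r) (\<lambda>t. t = s\<lparr>reg := (reg s)(16 := a, 17 := b, 18 := c, 19 := d),
    clock := clock s + 4\<rparr>) s"
proof -
  obtain a' b' c' d' where r: "r = (a', b', c', d')" by (cases r) auto
  show ?thesis
    using assms unfolding select_com_def r
    by (auto intro!: wp_Ops simp: do_op_def quad_val_def quad_regs_def r tick_def)
qed

text \<open>The bounds of all rounds lie in registers below 16, and the rounds write only to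
  registers from 16 on. One snapshot \<open>\<rho>\<close> therefore serves for all of them.\<close>

lemma wp_ask_rounds:
  assumes "\<forall>r\<in>set rs. quad_regs r \<and> valid_round N (quad_val \<rho> r)" "\<rho> 9 = 0" "\<rho> 3 = 1" "N < 2 ^ w"
    "\<forall>i<16. reg s i = \<rho> i"
  shows "wp w ans (rounds_com ask_com rs) (\<lambda>t. (\<forall>i<16. reg t i = \<rho> i) \<and> mem t = mem s \<and>
     asked t = asked s @ all_pairs (map (quad_val \<rho>) rs) \<and>
     clock t \<le> clock s + 4 * length rs + 7 * length (all_pairs (map (quad_val \<rho>) rs))) s"
  using assms
proof (induction rs arbitrary: s)
  case Nil
  then show ?case by (auto intro!: wp_Ops)
next
  case (Cons r rs)
  obtain a b c d where q: "quad_val \<rho> r = (a, b, c, d)" by (cases "quad_val \<rho> r") auto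
  have v: "a < b" "b < 2 ^ w" "c < d" "d < 2 ^ w" "quad_regs r"
    using Cons.prems q by (auto simp: valid_round_def)
  define s' where "s' = s\<lparr>reg := (reg s)(16 := a, 17 := b, 18 := c, 19 := d), clock := clock s + 4\<rparr>"
  have "wp w ans ask_com (wp w ans (rounds_com ask_com rs) (\<lambda>t. (\<forall>i<16. reg t i = \<rho> i) \<and>
     mem t = mem s \<and> asked t = asked s @ all_pairs (map (quad_val \<rho>) (r # rs)) \<and>
     clock t \<le> clock s + 4 * length (r # rs) + 7 * length (all_pairs (map (quad_val \<rho>) (r # rs))))) s'"
  proof (rule wp_mono[OF wp_ask_com[of s' a b c d]])
    fix t :: state assume t: "(\<forall>r<20. reg t r = reg s' r) \<and> mem t = mem s' \<and>
      asked t = asked s' @ round_pairs (a, b, c, d) \<and>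
      clock t \<le> clock s' + 7 * (b - a) * (d - c)"
    then have "\<forall>i<16. reg t i = \<rho> i" using Cons.prems by (auto simp: s'_def)
    then have "wp w ans (rounds_com ask_com rs) (\<lambda>u. (\<forall>i<16. reg u i = \<rho> i) \<and> mem u = mem t \<and>
     asked u = asked t @ all_pairs (map (quad_val \<rho>) rs) \<and>
     clock u \<le> clock t + 4 * length rs + 7 * length (all_pairs (map (quad_val \<rho>) rs))) t"
      using Cons.prems by (intro Cons.IH) auto
    then show "wp w ans (rounds_com ask_com rs) (\<lambda>t. (\<forall>i<16. reg t i = \<rho> i) \<and>
     mem t = mem s \<and> asked t = asked s @ all_pairs (map (quad_val \<rho>) (r # rs)) \<and>
     clock t \<le> clock s + 4 * length (r # rs) + 7 * length (all_pairs (map (quad_val \<rho>) (r # rs)))) t"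
      by (rule wp_mono) (use t in \<open>auto simp: s'_def q length_round_pairs\<close>)
  qed (use v Cons.prems in \<open>auto simp: s'_def\<close>)
  then show ?case
    unfolding rounds_com.simps using v q Cons.prems
    by (intro wp_Seq wp_mono[OF wp_select_com[of r \<rho> a b c d]]) (auto simp: s'_def)
qed

definition relabel_all :: "nat \<Rightarrow> (nat \<times> nat \<Rightarrow> nat) \<Rightarrow> quad list \<Rightarrow> (nat \<Rightarrow> nat) \<Rightarrow> nat \<Rightarrow> nat" where
  "relabel_all k f rs h = foldl (\<lambda>h r. relabel k f r h) h rs"

lemma relabel_all_simps [simp]:
  "relabel_all k f [] h = h"
  "relabel_all k f (r # rs) h = relabel_all k f rs (relabel k f r h)"
  by (simp_all add: relabel_all_def)

lemma votes_cong:
  assumes "\<And>y. c \<le> y \<Longrightarrow> y < d \<Longrightarrow> f (x, y) = f' (x, y)" "\<And>y. c \<le> y \<Longrightarrow> y < d \<Longrightarrow> h y = h' y"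
  shows "votes k f h x c d = votes k f' h' x c d"
  using assms by (auto simp: votes_def)

lemma relabel_less:
  assumes "0 < k" "h v < k"
  shows "relabel k f r h v < k"
proof -
  obtain a b c d where "r = (a, b, c, d)" by (cases r) auto
  then show ?thesis
    using assms plurality_less[OF set_votes] by (auto simp: relabel_def)
qed

lemma relabel_all_less:
  assumes "0 < k" "\<And>v. h v < k"
  shows "relabel_all k f rs h v < k"
  using assms(2) by (induction rs arbitrary: h) (auto intro: relabel_less assms(1))

lemma relabel_cong:
  assumes "valid_round N r" "\<And>q. q \<in> set (round_pairs r) \<Longrightarrow> f q = f' q" "\<And>v. v < N \<Longrightarrow> h v = h' v"
    "v < N"
  shows "relabel k f r h v = relabel k f' r h' v"
proof -
  obtain a b c d where r: "r = (a, b, c, d)" by (cases r) auto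
  show ?thesis
    using assms by (auto simp: r relabel_def valid_round_def round_pairs_def
      intro!: arg_cong[where f = plurality] votes_cong)
qed

text \<open>Each round reads only its own pairs and the labels before it. This locality is what
  later makes the voters' labels independent of fresh votes.\<close>

lemma relabel_all_cong:
  assumes "\<forall>r\<in>set rs. valid_round N r" "\<And>q. q \<in> set (all_pairs rs) \<Longrightarrow> f q = f' q"
    "\<And>v. v < N \<Longrightarrow> h v = h' v" "v < N"
  shows "relabel_all k f rs h v = relabel_all k f' rs h' v"
  using assms
proof (induction rs arbitrary: h h')
  case (Cons r rs)
  show ?case
    unfolding relabel_all_simps
    using Cons.prems by (intro Cons.IH relabel_cong[where N = N and r = r]) auto
qed simp

text \<open>Row-major indexing. Votes are evaluated in the order in which the pairs were asked, so a
  running position in register 22 finds each answer.\<close>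

lemma product_nth_upt:
  assumes "a \<le> x" "x < b" "c \<le> y" "y < d"
  shows "(x - a) * (d - c) + (y - c) < (b - a) * (d - c)"
    and "List.product [a..<b] [c..<d] ! ((x - a) * (d - c) + (y - c)) = (x, y)"
proof -
  have "(x - a) * (d - c) + (y - c) < Suc (x - a) * (d - c)" using assms by simp
  also have "\<dots> \<le> (b - a) * (d - c)" using assms by (intro mult_le_mono1) auto
  finally show *: "(x - a) * (d - c) + (y - c) < (b - a) * (d - c)" .
  have "0 < d - c" "y - c < d - c" using assms by auto
  then have "((x - a) * (d - c) + (y - c)) div (d - c) = x - a"
    "((x - a) * (d - c) + (y - c)) mod (d - c) = y - c" by simp_all
  then show "List.product [a..<b] [c..<d] ! ((x - a) * (d - c) + (y - c)) = (x, y)"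
    using assms * by (subst product_nth) simp_all
qed

text \<open>The induction needs \<open>pre\<close>, the pairs whose answers have already been
  consumed. Every round takes at most \<open>N * k\<close> new cells for its counters.\<close>

lemma wp_vote_rounds:
  fixes f :: "nat \<times> nat \<Rightarrow> nat"
  assumes "\<forall>r\<in>set rs. quad_regs r \<and> valid_round N (quad_val \<rho> r)" "\<rho> 9 = 0" "\<rho> 3 = 1" "\<rho> 1 = k"
    "\<forall>i<16. reg s i = \<rho> i" "0 < k" "2 * k < 2 ^ w" "N < 2 ^ w" "N \<le> reg s 28" 
    "reg s 28 + length rs * N * k < 2 ^ w"
    "ans = map f (pre @ all_pairs (map (quad_val \<rho>) rs))"
    "reg s 22 = length pre" "length ans < 2 ^ w" "\<forall>q\<in>set (all_pairs (map (quad_val \<rho>) rs)). f q < k"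
    "\<forall>v<N. mem s v = h v" "\<forall>v. h v < k" "\<forall>v\<ge>reg s 28. mem s v = 0"
  shows "wp w ans (rounds_com vote_com rs) (\<lambda>t.
     (\<forall>v<N. mem t v = relabel_all k f (map (quad_val \<rho>) rs) h v) \<and>
     clock t \<le> clock s + 4 * length rs + 24 * length (all_pairs (map (quad_val \<rho>) rs))) s"
  using assms
proof (induction rs arbitrary: s pre h)
  case Nil
  then show ?case by (auto intro!: wp_Ops)
next
  case (Cons r rs)
  obtain a b c d where q: "quad_val \<rho> r = (a, b, c, d)" by (cases "quad_val \<rho> r") auto
  have v: "a < b" "b \<le> N" "c < d" "d \<le> N" "quad_regs r" "b \<le> c \<or> d \<le> a" 
    using Cons.prems q by (auto simp: valid_round_def)
  define p where "p = length pre"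
  define B where "B = reg s 28"
  define s' where "s' = s\<lparr>reg := (reg s)(16 := a, 17 := b, 18 := c, 19 := d), clock := clock s + 4\<rparr>"
  have "(b - a) * k \<le> N * k" using v by (intro mult_le_mono1) auto
  then have B: "B + (b - a) * k + length rs * N * k < 2 ^ w" "N \<le> B"
    using Cons.prems by (auto simp: B_def algebra_simps)
  have len: "p + (b - a) * (d - c) \<le> length ans"
    using Cons.prems by (simp add: p_def q length_round_pairs)
  have ans: "p + (x - a) * (d - c) + (y - c) < length ans \<and>
       ans ! (p + (x - a) * (d - c) + (y - c)) = f (x, y) \<and> f (x, y) < k"
    if "a \<le> x" "x < b" "c \<le> y" "y < d" for x y
  proof -
    let ?i = "(x - a) * (d - c) + (y - c)"
    have "ans ! (p + ?i) = f (round_pairs (a, b, c, d) ! ?i)" "p + ?i < length ans"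
      using product_nth_upt(1)[OF that] len Cons.prems(11)
      by (auto simp: p_def q nth_append length_round_pairs)
    moreover have "(x, y) \<in> set (all_pairs (map (quad_val \<rho>) (r # rs)))"
      using that by (auto simp: q round_pairs_def)
    ultimately show ?thesis
      using product_nth_upt(2)[OF that] Cons.prems(14) by (auto simp: round_pairs_def add.assoc)
  qed
  have "wp w ans vote_com (wp w ans (rounds_com vote_com rs) (\<lambda>t.
     (\<forall>v<N. mem t v = relabel_all k f (map (quad_val \<rho>) (r # rs)) h v) \<and>
     clock t \<le> clock s + 4 * length (r # rs) + 24 * length (all_pairs (map (quad_val \<rho>) (r # rs))))) s'"
  proof (rule wp_mono[OF wp_vote_com[of s' k a b c d p B w ans f]])
    fix t :: state assume t: "(\<forall>r<20. reg t r = reg s' r) \<and>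
      reg t 22 = p + (b - a) * (d - c) \<and> reg t 28 = B + (b - a) * k \<and>
      (\<forall>v<B. mem t v = relabel k f (a, b, c, d) (mem s') v) \<and>
      (\<forall>v\<ge>B + (b - a) * k. mem t v = 0) \<and>
      clock t \<le> clock s' + 24 * (b - a) * (d - c)"
    then have "\<forall>i<16. reg t i = \<rho> i" using Cons.prems by (auto simp: s'_def)
    moreover have "\<forall>v<N. mem t v = relabel k f (quad_val \<rho> r) h v"
    proof (intro allI impI)
      fix v assume "v < N"
      then have "mem t v = relabel k f (quad_val \<rho> r) (mem s') v"
        using t B q by auto
      also have "\<dots> = relabel k f (quad_val \<rho> r) h v"
        using \<open>v < N\<close> Cons.prems by (intro relabel_cong[where N = N]) (auto simp: s'_def)
      finally show "mem t v = relabel k f (quad_val \<rho> r) h v" .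
    qed
    ultimately have "wp w ans (rounds_com vote_com rs) (\<lambda>u.
     (\<forall>v<N. mem u v = relabel_all k f (map (quad_val \<rho>) rs) (relabel k f (quad_val \<rho> r) h) v) \<and>
     clock u \<le> clock t + 4 * length rs + 24 * length (all_pairs (map (quad_val \<rho>) rs))) t"
      using Cons.prems B t
      by (intro Cons.IH[where pre = "pre @ round_pairs (quad_val \<rho> r)"])
        (auto simp: q length_round_pairs p_def intro!: relabel_less)
    then show "wp w ans (rounds_com vote_com rs) (\<lambda>t.
     (\<forall>v<N. mem t v = relabel_all k f (map (quad_val \<rho>) (r # rs)) h v) \<and>
     clock t \<le> clock s + 4 * length (r # rs) + 24 * length (all_pairs (map (quad_val \<rho>) (r # rs)))) t"
      by (rule wp_mono) (use t in \<open>auto simp: s'_def q length_round_pairs\<close>)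
  qed (use v Cons.prems B len ans in \<open>auto simp: s'_def B_def p_def\<close>)
  then show ?case
    unfolding rounds_com.simps using v q Cons.prems
    by (intro wp_Seq wp_mono[OF wp_select_com[of r \<rho> a b c d]]) (auto simp: s'_def)
qed

section \<open>The alignment algorithm\<close>

definition log_ceil :: "nat \<Rightarrow> nat" where
  "log_ceil n = nat \<lceil>log 2 (real n)\<rceil>"

text \<open>Replaces the logarithm by the test that the doubling loop in \<open>setup_com\<close>
  performs.\<close>

lemma less_log_ceil_iff:
  assumes "1 \<le> n"
  shows "l < log_ceil n \<longleftrightarrow> 2 ^ l < n"
proof -
  have "l < log_ceil n \<longleftrightarrow> real l < log 2 (real n)"
    unfolding log_ceil_def by linarith
  also have "\<dots> \<longleftrightarrow> 2 powr real l < real n"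
    using assms by (subst less_log_iff) auto
  also have "\<dots> \<longleftrightarrow> 2 ^ l < n"
    by (simp add: powr_realpow)
  finally show ?thesis .
qed

text \<open>
  \<open>D\<close> is the binary expansion of \<open>\<delta>\<close>, so that \<open>q\<close> approximates \<open>1 / \<delta>\<close>; \<open>2 ^ w\<close> itself does not fit into
  a word.
\<close>

definition group_size :: "nat \<Rightarrow> nat \<Rightarrow> nat \<Rightarrow> nat \<Rightarrow> nat" where
  "group_size w n k D =
     (let q = (2 ^ w - 1) div D in (q * q div k + q + 1) * log_ceil n * 256)"

text \<open>
  Here \<open>S = {1..s}\<close>, \<open>S' = {s + 1..2 * s}\<close>, \<open>T = {2 * s + 1..3 * s}\<close>, the root is \<open>3 * s + 1\<close>, and
  \<open>V = {3 * s + 2..n}\<close>.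
\<close>

definition rounds :: "nat \<Rightarrow> nat \<Rightarrow> quad list" where
  "rounds n s =
     [(3 * s + 2, n + 1, 3 * s + 1, 3 * s + 2),
      (1, s + 1, 3 * s + 2, n + 1),
      (s + 1, 2 * s + 1, 1, s + 1),
      (2 * s + 1, n + 1, s + 1, 2 * s + 1),
      (1, s + 1, 2 * s + 1, 3 * s + 1)]"

definition round_regs :: "quad list" where
  "round_regs = [(14, 15, 13, 14), (10, 11, 14, 15), (11, 12, 10, 11), (12, 15, 11, 12), (10, 11, 12, 13)]"

text \<open>\<open>Arith Sub 6 9 3\<close> is \<open>0 - 1\<close> modulo \<open>2 ^ w\<close>, the
  largest word, which stands in for \<open>2 ^ w\<close> in the quotient. Registers 4 and 7 end up
  with \<open>log_ceil n\<close> and the group size.\<close>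

definition setup_com :: com where
  "setup_com =
     Ops [Const 3 1, Const 5 1, Const 6 2] ;;
     Repeat (Ops [Arith Mul 5 5 6, Arith Add 4 4 3]) 5 0 ;;
     Ops [Arith Sub 6 9 3, Arith Div 6 6 2, Arith Mul 7 6 6, Arith Div 7 7 1, Arith Add 7 7 6,
       Arith Add 7 7 3, Arith Mul 7 7 4, Const 8 256, Arith Mul 7 7 8] ;;
     Ops [Const 10 1, Arith Add 11 7 3, Arith Add 12 11 7, Arith Add 13 12 7, Arith Add 14 13 3,
       Arith Add 15 0 3]"

text \<open>The bounds computed by the first program survive in registers 10 to 15. Counters start
  at address \<open>n + 1\<close>, just beyond the output cells \<open>1..n\<close>.\<close>

definition align_alg :: algorithm where
  "align_alg =
     (compile 0 (setup_com ;; rounds_com ask_com round_regs),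
      compile 0 (Ops [Const 22 0, Arith Add 28 0 3] ;; rounds_com vote_com round_regs))"

lemma nonadaptive_align_alg: "nonadaptive align_alg"
  by (simp add: nonadaptive_def align_alg_def setup_com_def round_regs_def select_com_def ask_com_def
    vote_com_def tally_com_def)

definition ready :: "nat \<Rightarrow> nat \<Rightarrow> nat \<Rightarrow> (nat \<Rightarrow> nat) \<Rightarrow> bool" where
  "ready n k s \<rho> \<longleftrightarrow> \<rho> 0 = n \<and> \<rho> 1 = k \<and> \<rho> 3 = 1 \<and> \<rho> 9 = 0 \<and> \<rho> 10 = 1 \<and> \<rho> 11 = s + 1 \<and>
     \<rho> 12 = 2 * s + 1 \<and> \<rho> 13 = 3 * s + 1 \<and> \<rho> 14 = 3 * s + 2 \<and> \<rho> 15 = n + 1"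

lemma map_quad_val_round_regs: "ready n k s \<rho> \<Longrightarrow> map (quad_val \<rho>) round_regs = rounds n s"
  by (simp add: round_regs_def quad_val_def ready_def rounds_def)

lemma length_round_regs [simp]: "length round_regs = 5"
  by (simp add: round_regs_def)

lemma wp_setup_com:
  assumes n: "2 \<le> n" "2 * n < 2 ^ w" "256 < (2 :: nat) ^ w"
    and s: "3 * group_size w n k D + 2 \<le> n"
    and q: "((2 ^ w - 1) div D) ^ 2 < 2 ^ w"
    and init: "reg i = (\<lambda>_. 0)(0 := n, 1 := k, 2 := D)"
  shows "wp w ans setup_com (\<lambda>t. ready n k (group_size w n k D) (reg t) \<and> mem t = mem i \<and>
     asked t = asked i \<and> clock t = clock i + 18 + 3 * log_ceil n) i"
proof -
  let ?L = "log_ceil n"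
  let ?pre = "[Const 3 1, Const 5 1, Const 6 2]"
  have "0 < w" using n by (cases w) auto
  define J :: "nat \<Rightarrow> state \<Rightarrow> bool" where
    "J = (\<lambda>j t. reg t 0 = n \<and> reg t 1 = k \<and> reg t 2 = D \<and> reg t 3 = 1 \<and> reg t 4 = j \<and>
      reg t 5 = 2 ^ j \<and> reg t 6 = 2 \<and> reg t 9 = 0 \<and>
      mem t = mem i \<and> asked t = asked i \<and> clock t = clock i + 3 + 3 * j)"
  have loop: "wp w ans (Repeat (Ops [Arith Mul 5 5 6, Arith Add 4 4 3]) 5 0) (J ?L)
      (fold (do_op w ans) ?pre i)"
  proof (rule wp_Repeat[where lo = 0])
    show "J 0 (fold (do_op w ans) ?pre i)"
      using n \<open>0 < w\<close> by (simp add: J_def do_op_def init)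
    show "0 < ?L" using n by (simp add: less_log_ceil_iff)
    fix j t assume j: "j < ?L" and t: "J j t"
    \<comment> \<open>The body is entered only while \<open>2 ^ j < n\<close>, so doubling stays
      below \<open>2 * n\<close> and cannot overflow.\<close>
    then have j': "2 ^ j < n" using n by (simp add: less_log_ceil_iff)
    have "j < 2 ^ j" by (rule less_exp)
    then have "Suc j < 2 ^ w" using j' n by linarith
    moreover have "2 ^ j * 2 < (2 :: nat) ^ w" using j' n by linarith
    ultimately show "wp w ans (Ops [Arith Mul 5 5 6, Arith Add 4 4 3])
        (\<lambda>t. (reg t 5 < reg t 0 \<longleftrightarrow> Suc j < ?L) \<and> J (Suc j) (tick t)) t"
      using t less_log_ceil_iff[of n "Suc j"] n
      by (intro wp_Ops) (simp_all add: J_def do_op_def mult.commute)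
  qed
  define q where "q = (2 ^ w - 1) div D"
  define c where "c = Suc (q * q div k + q)"
  let ?s = "group_size w n k D"
  let ?mid = "[Arith Sub 6 9 3, Arith Div 6 6 2, Arith Mul 7 6 6, Arith Div 7 7 1, Arith Add 7 7 6,
     Arith Add 7 7 3, Arith Mul 7 7 4, Const 8 256, Arith Mul 7 7 8]"
  let ?post = "[Const 10 1, Arith Add 11 7 3,
     Arith Add 12 11 7, Arith Add 13 12 7, Arith Add 14 13 3, Arith Add 15 0 3]"
  have s_eq: "?s = c * ?L * 256" by (simp add: group_size_def Let_def q_def c_def)
  have "0 < ?L" using n by (simp add: less_log_ceil_iff)
  then have le: "c * ?L \<le> ?s" "c \<le> c * ?L" by (simp_all add: s_eq)
  have fl: "(2 ^ w - Suc 0) div D = q" "q * q mod 2 ^ w = q * q"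
    "(q * q div k + q) mod 2 ^ w = q * q div k + q" "Suc (q * q div k + q) mod 2 ^ w = c"
    "c * ?L mod 2 ^ w = c * ?L" "c * ?L * 256 mod 2 ^ w = ?s"
    using assms le s_eq by (simp_all add: power2_eq_square c_def q_def)
  have fl2: "Suc ?s mod 2 ^ w = Suc ?s" "Suc (?s + ?s) mod 2 ^ w = Suc (?s + ?s)" 
    "Suc (?s + ?s + ?s) mod 2 ^ w = Suc (?s + ?s + ?s)"
    "Suc (Suc (?s + ?s + ?s)) mod 2 ^ w = Suc (Suc (?s + ?s + ?s))"
    "Suc n mod 2 ^ w = Suc n" "Suc 0 mod 2 ^ w = Suc 0" "256 mod 2 ^ w = (256 :: nat)"
    using s n \<open>0 < w\<close> by simp_all
  have mid: "wp w ans (Ops ?mid ;; Ops ?post) (\<lambda>t. ready n k ?s (reg t) \<and> mem t = mem i \<and>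
     asked t = asked i \<and> clock t = clock i + 18 + 3 * ?L) t" if "J ?L t" for t
  proof (intro wp_Seq wp_Ops[of ?mid])
    define u where "u = fold (do_op w ans) ?mid t"
    have u: "reg u 0 = n \<and> reg u 1 = k \<and> reg u 3 = 1 \<and> reg u 7 = ?s \<and> reg u 9 = 0 \<and>
        mem u = mem i \<and> asked u = asked i \<and> clock u = clock i + 12 + 3 * ?L"
      using that by (simp add: u_def J_def do_op_def fl fl2)
    then have "wp w ans (Ops ?post) (\<lambda>t. ready n k ?s (reg t) \<and> mem t = mem i \<and>
        asked t = asked i \<and> clock t = clock i + 18 + 3 * ?L) u"
      using \<open>0 < w\<close> by (intro wp_Ops) (simp_all add: ready_def do_op_def fl2)
    then show "wp w ans (Ops ?post) (\<lambda>t. ready n k ?s (reg t) \<and> mem t = mem i \<and>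
        asked t = asked i \<and> clock t = clock i + 18 + 3 * ?L) (fold (do_op w ans) ?mid t)"
      by (simp only: u_def)
  qed auto
  show ?thesis
    unfolding setup_com_def
    by (rule wp_Seq, rule wp_Ops, simp, rule wp_Seq, rule wp_mono[OF loop mid])
qed

lemma valid_rounds:
  assumes "1 \<le> s" "3 * s + 2 \<le> n"
  shows "\<forall>r\<in>set (rounds n s). valid_round (n + 1) r"
  using assms by (auto simp: rounds_def valid_round_def)

lemma length_all_pairs_rounds:
  assumes "1 \<le> s" "3 * s + 2 \<le> n"
  shows "length (all_pairs (rounds n s)) \<le> 5 * n * s"
proof -
  have "(n - (3 * s + 1)) * 1 \<le> n * s" "s * (n - (3 * s + 1)) \<le> s * n" "s * s \<le> n * s"
    "(n - 2 * s) * s \<le> n * s"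
    using assms by (intro mult_le_mono; simp)+
  moreover have "length (all_pairs (rounds n s)) = (n - (3 * s + 1)) * 1 + (s * (n - (3 * s + 1)) +
      (s * s + ((n - 2 * s) * s + s * s)))"
    by (simp add: rounds_def length_round_pairs)
  moreover have "s * n = n * s" by simp
  ultimately show ?thesis
    by linarith
qed

lemma mem_round_pairs:
  "(x, y) \<in> set (round_pairs (a, b, c, d)) \<longleftrightarrow> a \<le> x \<and> x < b \<and> c \<le> y \<and> y < d"
  by (auto simp: round_pairs_def)

lemma mem_all_pairs_rounds:
  "(x, y) \<in> set (all_pairs (rounds n s)) \<longleftrightarrow>
     (3 * s + 2 \<le> x \<and> x < n + 1 \<and> 3 * s + 1 \<le> y \<and> y < 3 * s + 2) \<or>
     (1 \<le> x \<and> x < s + 1 \<and> 3 * s + 2 \<le> y \<and> y < n + 1) \<or>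
     (s + 1 \<le> x \<and> x < 2 * s + 1 \<and> 1 \<le> y \<and> y < s + 1) \<or>
     (2 * s + 1 \<le> x \<and> x < n + 1 \<and> s + 1 \<le> y \<and> y < 2 * s + 1) \<or>
     (1 \<le> x \<and> x < s + 1 \<and> 2 * s + 1 \<le> y \<and> y < 3 * s + 1)"
  by (simp only: rounds_def list.map concat.simps set_append Un_iff mem_round_pairs list.set
    empty_iff simp_thms)

text \<open>Queries count as unordered pairs, so distinctness of the list is not enough:
  \<open>swap\<close> rules out that a pair returns with its items exchanged.\<close>

lemma valid_queries_rounds:
  assumes "1 \<le> s" "3 * s + 2 \<le> n"
  shows "valid_queries n (all_pairs (rounds n s))"
proof -
  let ?qs = "all_pairs (rounds n s)"
  have range: "x \<in> {1..n} \<and> y \<in> {1..n} \<and> x \<noteq> y" if "(x, y) \<in> set ?qs" for x y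
    using that[unfolded mem_all_pairs_rounds] assms unfolding atLeastAtMost_iff
    by (elim disjE) linarith+
  have swap: "(y, x) \<notin> set ?qs" if "(x, y) \<in> set ?qs" for x y
  proof
    assume "(y, x) \<in> set ?qs"
    then show False
      using that[unfolded mem_all_pairs_rounds] assms unfolding mem_all_pairs_rounds
      by (elim disjE) linarith+
  qed
  have disj: "set (round_pairs r) \<inter> set (round_pairs r') = {}"
    if "\<And>x y. (x, y) \<in> set (round_pairs r) \<Longrightarrow> (x, y) \<notin> set (round_pairs r')" for r r'
    using that by auto
  have "distinct (round_pairs r)" for r
    by (cases r) (simp add: round_pairs_def distinct_product)
  then have "distinct ?qs"
    unfolding rounds_def list.map concat.simps distinct_append set_append Int_Un_distrib Un_empty
    using assms by (intro conjI disj) (auto simp: mem_round_pairs)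
  moreover have "inj_on (\<lambda>(x, y). {x, y}) (set ?qs)"
  proof (intro inj_onI, clarify)
    fix x y x' y' assume "(x, y) \<in> set ?qs" "(x', y') \<in> set ?qs" "{x, y} = {x', y'}"
    then show "x = x' \<and> y = y'"
      using swap[of x y] unfolding doubleton_eq_iff by blast
  qed
  ultimately show ?thesis
    using range unfolding valid_queries_def distinct_map by blast
qed

text \<open>Conditions under which nothing overflows: \<open>10 * n * n < 2 ^ w\<close> covers the
  counter addresses and the positions of answers, and the last assumption makes the squared quotient
  fit into a word.\<close>

locale alignment_run =
  fixes w n k :: nat and \<delta> :: real and s :: nat
  assumes n: "6 \<le> n" "10 * n * n < 2 ^ w" and k: "2 \<le> k" "k \<le> n"
    and \<delta>: "nat \<lfloor>\<delta> * 2 ^ w\<rfloor> < 2 ^ w"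
    and s: "s = group_size w n k (nat \<lfloor>\<delta> * 2 ^ w\<rfloor>)" "3 * s + 2 \<le> n"
    and q: "((2 ^ w - 1) div nat \<lfloor>\<delta> * 2 ^ w\<rfloor>) ^ 2 < (2 :: nat) ^ w"
begin

lemma s_ge: "log_ceil n \<le> s" "256 \<le> s"
proof -
  define c where "c = (let q = (2 ^ w - 1) div nat \<lfloor>\<delta> * 2 ^ w\<rfloor> in q * q div k + q)"
  have "s = Suc c * log_ceil n * 256" by (simp add: s(1) group_size_def c_def Let_def)
  moreover have "0 < log_ceil n" using n by (simp add: less_log_ceil_iff)
  ultimately show "log_ceil n \<le> s" "256 \<le> s" by auto
qed

lemma small: "2 * n < 2 ^ w" "256 < (2 :: nat) ^ w" "n + 1 + 5 * (n + 1) * k < 2 ^ w" "2 * k < 2 ^ w"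
    "5 * n * s < 2 ^ w"
proof -
  have nn: "6 * n \<le> n * n" using n by (intro mult_le_mono1) auto
  have "5 * (n + 1) * k \<le> 5 * (n + 1) * n" "5 * n * s \<le> 5 * n * n" 
    using k s by (intro mult_le_mono2; simp)+
  moreover have "5 * (n + 1) * n = 5 * (n * n) + 5 * n" by (simp add: algebra_simps)
  ultimately show "2 * n < 2 ^ w" "256 < (2 :: nat) ^ w" "n + 1 + 5 * (n + 1) * k < 2 ^ w"
    "2 * k < 2 ^ w" "5 * n * s < 2 ^ w"
    using n k s nn by linarith+
qed

lemma ask_phase_align_alg:
  obtains t where "ask_phase align_alg w n k \<delta> = Some t" "ready n k s (reg t)" "mem t = (\<lambda>_. 0)"
    "asked t = all_pairs (rounds n s)"
    "clock t \<le> 18 + 3 * log_ceil n + 20 + 7 * length (all_pairs (rounds n s))"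
proof -
  define i where "i = init_state w n k \<delta>"
  define D where "D = nat \<lfloor>\<delta> * 2 ^ w\<rfloor>"
  have i: "reg i = (\<lambda>_. 0)(0 := n, 1 := k, 2 := D)" "mem i = (\<lambda>_. 0)" "asked i = []" "clock i = 0"
      "i\<lparr>pc := 0\<rparr> = i"
    using small n k \<delta> by (simp_all add: i_def init_state_def D_def)
  have "wp w [] (setup_com ;; rounds_com ask_com round_regs) (\<lambda>t. ready n k s (reg t) \<and>
      mem t = (\<lambda>_. 0) \<and> asked t = all_pairs (rounds n s) \<and>
      clock t \<le> 18 + 3 * log_ceil n + 20 + 7 * length (all_pairs (rounds n s))) i"
  proof (intro wp_Seq wp_mono[OF wp_setup_com[OF _ _ _ _ _ i(1)]])
    fix t :: state
    assume t: "ready n k (group_size w n k D) (reg t) \<and> mem t = mem i \<and>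
     asked t = asked i \<and> clock t = clock i + 18 + 3 * log_ceil n"
    then have rdy: "ready n k s (reg t)" by (simp add: s(1) D_def)
    have vr: "\<forall>r\<in>set round_regs. quad_regs r \<and> valid_round (n + 1) (quad_val (reg t) r)"
      using valid_rounds[of s n] s_ge s map_quad_val_round_regs[OF rdy, symmetric]
      by (auto simp: round_regs_def quad_regs_def)
    have "wp w [] (rounds_com ask_com round_regs) (\<lambda>u. (\<forall>i<16. reg u i = reg t i) \<and>
      mem u = mem t \<and> asked u = asked t @ all_pairs (rounds n s) \<and>
      clock u \<le> clock t + 20 + 7 * length (all_pairs (rounds n s))) t"
      using wp_ask_rounds[OF vr, of w t "[]"] rdy small n
      unfolding map_quad_val_round_regs[OF rdy] by (simp add: ready_def)
    then show "wp w [] (rounds_com ask_com round_regs) (\<lambda>t. ready n k s (reg t) \<and>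
      mem t = (\<lambda>_. 0) \<and> asked t = all_pairs (rounds n s) \<and>
      clock t \<le> 18 + 3 * log_ceil n + 20 + 7 * length (all_pairs (rounds n s))) t"
    proof (rule wp_mono)
      fix u :: state
      assume u: "(\<forall>i<16. reg u i = reg t i) \<and>
        mem u = mem t \<and> asked u = asked t @ all_pairs (rounds n s) \<and>
        clock u \<le> clock t + 20 + 7 * length (all_pairs (rounds n s))"
      then have "ready n k s (reg u)" using rdy by (simp add: ready_def)
      then show "ready n k s (reg u) \<and> mem u = (\<lambda>_. 0) \<and> asked u = all_pairs (rounds n s) \<and>
        clock u \<le> 18 + 3 * log_ceil n + 20 + 7 * length (all_pairs (rounds n s))"
        using u t i(2-4) by simp
    qed
  qed (use n small s q in \<open>auto simp: D_def\<close>)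
  then obtain t where t: "exec_com w [] (setup_com ;; rounds_com ask_com round_regs) i t"
    "ready n k s (reg t)" "mem t = (\<lambda>_. 0)" "asked t = all_pairs (rounds n s)"
    "clock t \<le> 18 + 3 * log_ceil n + 20 + 7 * length (all_pairs (rounds n s))"
    by (auto simp: wp_def)
  from run_compile[OF t(1)] have "ask_phase align_alg w n k \<delta> =
      Some (t\<lparr>pc := csize (setup_com ;; rounds_com ask_com round_regs)\<rparr>)"
    unfolding ask_phase_def align_alg_def i(5) by (simp add: i_def)
  then show thesis using t that by simp
qed

lemma queries_align_alg: "queries align_alg w n k \<delta> = all_pairs (rounds n s)"
  by (rule ask_phase_align_alg) (simp add: queries_def)

lemma execute_align_alg:
  assumes f: "\<forall>q\<in>set (all_pairs (rounds n s)). f q < k"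
  obtains t where "execute align_alg w n k \<delta> (map f (all_pairs (rounds n s))) = Some t"
    "\<forall>v\<in>{1..n}. mem t v = relabel_all k f (rounds n s) (\<lambda>_. 0) v" "clock t \<le> 200 * n * s"
proof -
  let ?qs = "all_pairs (rounds n s)"
  let ?c = "Ops [Const 22 0, Arith Add 28 0 3] ;; rounds_com vote_com round_regs"
  obtain t where t: "ask_phase align_alg w n k \<delta> = Some t" "ready n k s (reg t)" "mem t = (\<lambda>_. 0)"
    "asked t = ?qs" "clock t \<le> 18 + 3 * log_ceil n + 20 + 7 * length ?qs"
    by (rule ask_phase_align_alg)
  have vr: "\<forall>r\<in>set round_regs. quad_regs r \<and> valid_round (n + 1) (quad_val (reg t) r)"
    using valid_rounds[of s n] s_ge s map_quad_val_round_regs[OF t(2), symmetric]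
    by (auto simp: round_regs_def quad_regs_def)
  have len: "length ?qs \<le> 5 * n * s"
    using length_all_pairs_rounds[of s n] s s_ge by simp
  have "wp w (map f ?qs) ?c (\<lambda>u.
      (\<forall>v<n + 1. mem u v = relabel_all k f (rounds n s) (\<lambda>_. 0) v) \<and>
      clock u \<le> clock t + 22 + 24 * length ?qs) t"
  proof (intro wp_Seq wp_Ops)
    show "wp w (map f ?qs) (rounds_com vote_com round_regs) (\<lambda>u.
      (\<forall>v<n + 1. mem u v = relabel_all k f (rounds n s) (\<lambda>_. 0) v) \<and>
      clock u \<le> clock t + 22 + 24 * length ?qs)
      (fold (do_op w (map f ?qs)) [Const 22 0, Arith Add 28 0 3] t)"
    proof -
      define t' where "t' = fold (do_op w (map f ?qs)) [Const 22 0, Arith Add 28 0 3] t"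
      have r: "\<forall>i<16. reg t' i = reg t i" "reg t' 22 = 0" "reg t' 28 = n + 1" "mem t' = mem t"
        "clock t' = clock t + 2"
        using t(2) small by (simp_all add: t'_def ready_def do_op_def)
      have "length (map f ?qs) < 2 ^ w" using len small by simp
      moreover have "reg t 9 = 0" "reg t 3 = 1" "reg t 1 = k" using t(2) by (simp_all add: ready_def)
      ultimately have "wp w (map f ?qs) (rounds_com vote_com round_regs) (\<lambda>u.
        (\<forall>v<n + 1. mem u v = relabel_all k f (rounds n s) (\<lambda>_. 0) v) \<and>
        clock u \<le> clock t' + 4 * length round_regs + 24 * length ?qs) t'"
        using small k f r t(3)
        by (intro wp_vote_rounds[OF vr, where pre = "[]" and h = "\<lambda>_. 0",
              unfolded map_quad_val_round_regs[OF t(2)]]) simp_all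
      then show ?thesis unfolding t'_def[symmetric] by (rule wp_mono) (use r in simp)
    qed
  qed auto
  then obtain u where u: "exec_com w (map f ?qs) ?c t u"
    "\<forall>v<n + 1. mem u v = relabel_all k f (rounds n s) (\<lambda>_. 0) v"
    "clock u \<le> clock t + 22 + 24 * length ?qs"
    by (auto simp: wp_def)
  have "execute align_alg w n k \<delta> (map f ?qs) = Some (u\<lparr>pc := csize ?c\<rparr>)"
    using run_compile[OF u(1)] t(1) by (simp add: execute_def align_alg_def)
  moreover have "clock u \<le> 200 * n * s"
  proof -
    \<comment> \<open>Asking and voting take 7 + 24 steps for each of at most
      \<open>5 * n * s\<close> queries, that is \<open>155 * n * s\<close>. The setup cost is
      absorbed by \<open>s\<close>, which is at least 256 and at least
      \<open>log_ceil n\<close>.\<close>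
    have "6 * s \<le> n * s" using n by (intro mult_le_mono1) auto
    then show ?thesis using u(3) t(5) len s_ge by linarith
  qed
  ultimately show thesis using u that by simp
qed

text \<open>The time bound must hold for arbitrary answers, not only for measurements. Since the
  queries are distinct, every answer list is the image of the query list under some
  function.\<close>

lemma runs_in_time_align_alg:
  assumes "real (200 * n * s) \<le> T"
  shows "runs_in_time align_alg w n k \<delta> T"
  unfolding runs_in_time_def queries_align_alg
proof (intro allI impI, elim conjE)
  fix ans :: "nat list"
  let ?qs = "all_pairs (rounds n s)"
  assume ans: "length ans = length ?qs" "set ans \<subseteq> {..<k}"
  have "distinct ?qs"
    using valid_queries_rounds[of s n] s s_ge unfolding valid_queries_def by (auto simp: distinct_map)
  define f where "f = (\<lambda>q. the (map_of (zip ?qs ans) q))"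
  have ans_eq: "ans = map f ?qs"
    using ans \<open>distinct ?qs\<close> by (intro nth_equalityI) (auto simp: f_def map_of_zip_nth)
  then have "\<forall>q\<in>set ?qs. f q < k" using ans(2) by auto
  then obtain t where "execute align_alg w n k \<delta> (map f ?qs) = Some t" "clock t \<le> 200 * n * s"
    using execute_align_alg by metis
  moreover from this have "real (clock t) \<le> T"
    using assms by (meson of_nat_le_iff order_trans)
  ultimately show "\<exists>s. execute align_alg w n k \<delta> ans = Some s \<and> real (clock s) \<le> T"
    using ans_eq by simp
qed

end

section \<open>Concentration of votes\<close>

lemma prob_eq_expectation: "measure_pmf.prob M A = measure_pmf.expectation M (indicator A)"
  by simp

lemma exp_neg_le:
  fixes t :: real
  assumes "0 \<le> t"
  shows "exp (- t) \<le> 1 - t + t\<^sup>2"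
proof -
  have "exp (- t) \<le> 1 / (1 + t)"
    using assms exp_ge_add_one_self[of t] by (simp add: exp_minus field_simps)
  also have "\<dots> \<le> 1 - t + t\<^sup>2"
  proof -
    have "(1 - t + t\<^sup>2) * (1 + t) = 1 + t ^ 3"
      by (simp add: algebra_simps power2_eq_square power3_eq_cube)
    then show ?thesis using assms by (simp add: field_simps)
  qed
  finally show ?thesis .
qed

text \<open>The left side is the moment generating function of a variable that is 1 with probability
  \<open>a\<close>, -1 with probability \<open>b\<close> and 0 otherwise. Second-order bounds on
  \<open>exp\<close> give weight \<open>a + b\<close> for the quadratic term and drift
  \<open>b - a\<close> for the linear one.\<close>

lemma exp_combination_le:
  fixes t a b :: real
  assumes "0 \<le> t" "t \<le> 1" "0 \<le> a" "0 \<le> b"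
  shows "1 + (exp t - 1) * a + (exp (- t) - 1) * b \<le> exp (t\<^sup>2 * (a + b) - t * (b - a))"
proof -
  have "(exp t - 1) * a \<le> (t + t\<^sup>2) * a" "(exp (- t) - 1) * b \<le> (- t + t\<^sup>2) * b"
    using assms exp_bound[of t] exp_neg_le[of t] by (intro mult_right_mono; simp)+
  then have "1 + (exp t - 1) * a + (exp (- t) - 1) * b \<le> 1 + (t\<^sup>2 * (a + b) - t * (b - a))"
    by (simp add: algebra_simps)
  then show ?thesis using exp_ge_add_one_self[of "t\<^sup>2 * (a + b) - t * (b - a)"] by linarith
qed

text \<open>Conditioning on the coordinates in \<open>A\<close>: the product measure is a mixture
  over \<open>u\<close>, and finite supports make the integral a finite sum.\<close>

lemma prob_Pi_pmf_Un_le: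
  fixes p :: "'a \<Rightarrow> 'b pmf"
  assumes fin: "finite A" "finite B" "A \<inter> B = {}" "\<And>q. finite (set_pmf (p q))"
    and le: "\<And>u. measure_pmf.prob (Pi_pmf B dflt p) {v. (\<lambda>q. if q \<in> A then u q else v q) \<in> E} \<le> G u"
  shows "measure_pmf.prob (Pi_pmf (A \<union> B) dflt p) E \<le> measure_pmf.expectation (Pi_pmf A dflt p) G"
proof -
  let ?S = "set_pmf (Pi_pmf A dflt p)"
  have finS: "finite (set_pmf (Pi_pmf C dflt p))" if "finite C" for C
    using that fin(4) by (simp add: set_Pi_pmf finite_PiE_dflt)
  have eq: "Pi_pmf (A \<union> B) dflt p = Pi_pmf A dflt p \<bind>
      (\<lambda>u. map_pmf (\<lambda>v q. if q \<in> A then u q else v q) (Pi_pmf B dflt p))"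
    unfolding Pi_pmf_union[OF fin(1-3)] pair_pmf_def
    by (simp add: map_bind_pmf map_pmf_def bind_assoc_pmf bind_return_pmf)
  have "measure_pmf.prob (Pi_pmf (A \<union> B) dflt p) E =
      (\<Sum>u\<in>?S. pmf (Pi_pmf A dflt p) u *\<^sub>R measure_pmf.expectation
        (map_pmf (\<lambda>v q. if q \<in> A then u q else v q) (Pi_pmf B dflt p)) (indicator E))"
    unfolding prob_eq_expectation eq
    using finS fin by (intro pmf_expectation_bind) auto
  also have "\<dots> = (\<Sum>u\<in>?S. pmf (Pi_pmf A dflt p) u *
       measure_pmf.prob (Pi_pmf B dflt p) {v. (\<lambda>q. if q \<in> A then u q else v q) \<in> E})"
    by (simp add: measure_map_pmf vimage_def)
  also have "\<dots> \<le> (\<Sum>u\<in>?S. pmf (Pi_pmf A dflt p) u * G u)"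
    by (intro sum_mono mult_left_mono le) auto
  also have "\<dots> = measure_pmf.expectation (Pi_pmf A dflt p) G"
    using finS fin by (subst integral_measure_pmf_real[of ?S]) (auto simp: mult.commute)
  finally show ?thesis .
qed

lemma count_list_map_upt: "count_list (map F [c..<d]) l = (\<Sum>y\<in>{c..<d}. of_bool (F y = l))"
proof (induction d)
  case (Suc d)
  then show ?case by (cases "c \<le> d") auto
qed simp

text \<open>Exactly one noise value turns the vote \<open>z + i\<close> into \<open>l\<close>, so
  vote probabilities are single values of the noise distribution.\<close>

lemma nat_mod_eq_iff:
  fixes z :: int and k l i :: nat
  assumes "0 < k" "l < k" "i < k"
  shows "nat ((z + int i) mod int k) = l \<longleftrightarrow> i = nat ((int l - z) mod int k)"
proof -
  have "nat ((z + int i) mod int k) = l \<longleftrightarrow> (z + int i) mod int k = int l mod int k"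
    using assms by (auto simp: nat_eq_iff)
  also have "\<dots> \<longleftrightarrow> int k dvd (z + int i - int l)"
    by (simp add: mod_eq_dvd_iff)
  also have "\<dots> \<longleftrightarrow> int k dvd (int i - (int l - z))"
    by (simp add: algebra_simps)
  also have "\<dots> \<longleftrightarrow> int i mod int k = (int l - z) mod int k"
    by (simp add: mod_eq_dvd_iff)
  also have "\<dots> \<longleftrightarrow> i = nat ((int l - z) mod int k)"
    using assms by (auto simp: nat_eq_iff)
  finally show ?thesis .
qed

locale noise =
  fixes k :: nat and \<delta> :: real
  assumes k: "2 \<le> k" and \<delta>: "0 < \<delta>" "\<delta> \<le> 1 / 4"
begin

definition p where "p = noise_pmf k \<delta>"
text \<open>The noise has probability \<open>base\<close> everywhere, plus \<open>\<gamma>\<close> at 0.\<close>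

definition base :: real where "base = 1 / real k - \<delta> / (real k - 1)"
definition \<gamma> :: real where "\<gamma> = \<delta> * real k / (real k - 1)"
text \<open>Of two different labels at most one is hit by zero noise, so \<open>\<sigma>\<close>
  bounds the probability that a vote goes to either of them. It is the weight of the quadratic term
  in the Chernoff exponent.\<close>

definition \<sigma> :: real where "\<sigma> = 2 * base + \<gamma>"

lemma \<gamma>_bounds: "\<delta> \<le> \<gamma>" "\<gamma> \<le> 2 * \<delta>" "0 < \<gamma>" "\<gamma> \<le> 1"
proof -
  have 1: "\<gamma> = \<delta> * (real k / (real k - 1))" by (simp add: \<gamma>_def)
  have 2: "1 \<le> real k / (real k - 1)" "real k / (real k - 1) \<le> 2" using k by (simp_all add: field_simps)
  show "\<delta> \<le> \<gamma>" "\<gamma> \<le> 2 * \<delta>"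
    using mult_left_mono[OF 2(1), of \<delta>] mult_left_mono[OF 2(2), of \<delta>] \<delta> unfolding 1 by auto
  then show "0 < \<gamma>" "\<gamma> \<le> 1" using \<delta> by auto
qed

lemma base_\<gamma>: "base + \<gamma> = 1 / real k + \<delta>" "real k * base + \<gamma> = 1"
proof -
  have "\<gamma> = \<delta> + \<delta> / (real k - 1)" using k by (simp add: \<gamma>_def field_simps)
  then show "base + \<gamma> = 1 / real k + \<delta>" by (simp add: base_def)
  show "real k * base + \<gamma> = 1" using k by (simp add: base_def \<gamma>_def right_diff_distrib mult.commute)
qed

lemma base_bounds: "0 \<le> base" "base \<le> 1 / real k"
proof -
  have "0 \<le> real k * base" using base_\<gamma>(2) \<gamma>_bounds by linarith
  then show "0 \<le> base" using k by (simp add: zero_le_mult_iff)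
  show "base \<le> 1 / real k" using k \<delta> by (simp add: base_def)
qed

lemma \<sigma>_bounds: "\<gamma> \<le> \<sigma>" "0 < \<sigma>" "\<sigma> \<le> 2 / real k + \<delta>"
  using base_bounds base_\<gamma> \<gamma>_bounds by (auto simp: \<sigma>_def)

lemma pmf_p: "i < k \<Longrightarrow> pmf p i = base + \<gamma> * of_bool (i = 0)"
  and pmf_p_ge: "k \<le> i \<Longrightarrow> pmf p i = 0"
proof -
  have "1 / 4 \<le> 1 - 1 / real k" using k by (simp add: field_simps)
  then have "\<delta> \<le> 1 - 1 / real k" using \<delta> by linarith
  then have pmf: "pmf p i =
      (if i = 0 then 1 / real k + \<delta> else if i < k then 1 / real k - \<delta> / (real k - 1) else 0)" for i
    unfolding p_def using k \<delta> by (intro pmf_noise_pmf) auto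
  show "i < k \<Longrightarrow> pmf p i = base + \<gamma> * of_bool (i = 0)"
    using base_\<gamma>(1) by (auto simp: pmf base_def)
  show "k \<le> i \<Longrightarrow> pmf p i = 0" using k by (simp add: pmf)
qed

lemma set_p: "set_pmf p \<subseteq> {..<k}"
  using pmf_p_ge by (auto simp: set_pmf_iff) (meson not_less)

lemma finite_set_p [simp]: "finite (set_pmf p)"
  using set_p finite_subset by blast

lemma expectation_p: "measure_pmf.expectation p F = (\<Sum>i<k. F i * pmf p i)" for F :: "nat \<Rightarrow> real"
  using set_p by (intro integral_measure_pmf_real) auto

lemma sum_pmf_p: "(\<Sum>i<k. pmf p i) = 1"
  using expectation_p[of "\<lambda>_. 1"] by simp

text \<open>
  Moment generating function of the advantage of the label \<open>l\<close> over \<open>c\<close> gained by one vote \<open>z + i\<close> with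
  noise \<open>i\<close>.
\<close>

definition phi :: "real \<Rightarrow> nat \<Rightarrow> nat \<Rightarrow> int \<Rightarrow> real" where
  "phi t l c z = measure_pmf.expectation p (\<lambda>i.
     exp (t * (of_bool (nat ((z + int i) mod int k) = l) - of_bool (nat ((z + int i) mod int k) = c))))"

text \<open>The probability, over the noise \<open>i\<close>, that the vote \<open>z + i\<close>
  equals \<open>l\<close>.\<close>

abbreviation q :: "nat \<Rightarrow> int \<Rightarrow> real" where
  "q l z \<equiv> pmf p (nat ((int l - z) mod int k))"

lemma phi_nonneg: "0 \<le> phi t l c z"
  unfolding phi_def expectation_p by (intro sum_nonneg) auto

lemma idx_less: "nat (z mod int k) < k"
  using k by (simp add: nat_less_iff)

lemma phi_eq:
  assumes "l < k" "c < k" "l \<noteq> c"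
  shows "phi t l c z = 1 + (exp t - 1) * q l z + (exp (- t) - 1) * q c z"
proof -
  let ?i = "\<lambda>l. nat ((int l - z) mod int k)"
  have "phi t l c z = (\<Sum>i<k. exp (t * (of_bool (i = ?i l) - of_bool (i = ?i c))) * pmf p i)"
    unfolding phi_def expectation_p using assms k by (intro sum.cong) (auto simp: nat_mod_eq_iff)
  also have "\<dots> = (\<Sum>i<k. pmf p i + (if i = ?i l then (exp t - 1) * pmf p i else 0)
       + (if i = ?i c then (exp (- t) - 1) * pmf p i else 0))"
  proof (intro sum.cong refl)
    fix i
    have "?i l \<noteq> ?i c"
    proof
      assume "?i l = ?i c"
      then have "(int l - z) mod int k = (int c - z) mod int k"
        using k by (simp add: nat_eq_iff)
      then have "int k dvd int l - int c" by (simp add: mod_eq_dvd_iff)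
      then have "int l mod int k = int c mod int k" by (simp add: mod_eq_dvd_iff)
      then show False using assms by simp
    qed
    then show "exp (t * (of_bool (i = ?i l) - of_bool (i = ?i c))) * pmf p i =
       pmf p i + (if i = ?i l then (exp t - 1) * pmf p i else 0)
       + (if i = ?i c then (exp (- t) - 1) * pmf p i else 0)"
      by (auto simp: algebra_simps)
  qed
  also have "\<dots> = 1 + (exp t - 1) * q l z + (exp (- t) - 1) * q c z"
    using idx_less by (simp add: sum.distrib sum_pmf_p)
  finally show ?thesis .
qed

text \<open>Here \<open>z\<close> is the vote without noise. If it is \<open>c\<close>, then
  \<open>c\<close> is more likely than \<open>l\<close> by exactly \<open>\<gamma>\<close>;
  otherwise \<open>l\<close> is ahead by at most \<open>\<gamma>\<close>.\<close>

lemma phi_le: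
  assumes "l < k" "c < k" "l \<noteq> c" "0 \<le> t" "t \<le> 1"
  shows "phi t l c z \<le>
    exp (t\<^sup>2 * \<sigma> - t * \<gamma> * (if (int c - z) mod int k = 0 then 1 else - 1))"
proof -
  let ?i = "\<lambda>l. nat ((int l - z) mod int k)"
  have pq: "q l z = base + \<gamma> * of_bool (?i l = 0)" for l
    using idx_less by (intro pmf_p)
  have "?i l \<noteq> 0 \<or> ?i c \<noteq> 0"
  proof (rule ccontr)
    assume "\<not> ?thesis"
    then have "(int l - z) mod int k = (int c - z) mod int k"
      using k by (simp add: nat_eq_iff)
    then have "int k dvd int l - int c" by (simp add: mod_eq_dvd_iff)
    then have "int l mod int k = int c mod int k" by (simp add: mod_eq_dvd_iff)
    then show False using assms by simp
  qed
  moreover have "?i c = 0 \<longleftrightarrow> (int c - z) mod int k = 0"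
    using k by (simp add: nat_eq_iff)
  ultimately have *: "q l z + q c z \<le> \<sigma>"
    "\<gamma> * (if (int c - z) mod int k = 0 then 1 else - 1) \<le> q c z - q l z"
    using \<gamma>_bounds unfolding pq \<sigma>_def by auto
  have "phi t l c z \<le> exp (t\<^sup>2 * (q l z + q c z) - t * (q c z - q l z))"
    unfolding phi_eq[OF assms(1-3)] using assms by (intro exp_combination_le) auto
  also have "\<dots> \<le> exp (t\<^sup>2 * \<sigma> - t * (\<gamma> * (if (int c - z) mod int k = 0 then 1 else - 1)))"
    unfolding exp_le_cancel_iff using assms * by (intro diff_mono mult_left_mono) auto
  finally show ?thesis by (simp add: mult.assoc)
qed

text \<open>Convolution of the noise with itself, that is, two comparisons in a row: the excess on a
  single label drops from \<open>\<gamma>\<close> to \<open>\<gamma>\<^sup>2\<close>.\<close>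

lemma sum_p_q:
  "(\<Sum>i<k. pmf p i * q l (z + int i)) =
     real k * base\<^sup>2 + 2 * base * \<gamma> + \<gamma>\<^sup>2 * of_bool ((int l - z) mod int k = 0)"
proof -
  define e where "e = nat ((int l - z) mod int k)"
  have e: "e < k" "e = 0 \<longleftrightarrow> (int l - z) mod int k = 0"
    using idx_less k by (auto simp: e_def nat_eq_iff)
  have q: "q l (z + int i) = base + \<gamma> * of_bool (i = e)" if "i < k" for i
  proof -
    have "nat ((int l - (z + int i)) mod int k) = 0 \<longleftrightarrow> (int l - (z + int i)) mod int k = 0"
      using k by (simp add: nat_eq_iff)
    also have "\<dots> \<longleftrightarrow> int k dvd (int i - (int l - z))"
      by (subst dvd_minus_iff[symmetric]) (simp add: mod_eq_0_iff_dvd algebra_simps)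
    also have "\<dots> \<longleftrightarrow> int i mod int k = (int l - z) mod int k"
      by (simp add: mod_eq_dvd_iff)
    also have "\<dots> \<longleftrightarrow> i = e" using that k by (auto simp: nat_eq_iff e_def)
    finally show ?thesis using pmf_p[OF idx_less] by simp
  qed
  have "(\<Sum>i<k. pmf p i * q l (z + int i)) =
     (\<Sum>i<k. base\<^sup>2 + (if i = 0 then base * \<gamma> + \<gamma>\<^sup>2 * of_bool (e = 0) else 0) +
       (if i = e then base * \<gamma> else 0))"
    by (intro sum.cong refl) (auto simp: pmf_p q algebra_simps power2_eq_square)
  also have "\<dots> = real k * base\<^sup>2 + 2 * base * \<gamma> + \<gamma>\<^sup>2 * of_bool (e = 0)"
    using k e(1) by (simp add: sum.distrib)
  finally show ?thesis using e(2) by simp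
qed

text \<open>The counterpart of \<open>phi_le\<close> for two comparisons in a row. A rival gets
  probability \<open>b\<close>, which is at most \<open>2 / real k\<close>, and \<open>c\<close>
  gets \<open>b + \<gamma>\<^sup>2\<close>; hence the 4 in the quadratic term.\<close>

lemma expectation_phi_le:
  assumes "l < k" "c < k" "l \<noteq> c" "0 \<le> t" "t \<le> 1" "(int c - z) mod int k = 0"
  shows "measure_pmf.expectation p (\<lambda>i. phi t l c (z + int i)) \<le> exp (t\<^sup>2 * (4 / real k + \<gamma>\<^sup>2) - t * \<gamma>\<^sup>2)"
proof -
  define b where "b = real k * base\<^sup>2 + 2 * base * \<gamma>"
  have nz: "(int l - z) mod int k \<noteq> 0"
  proof
    assume "(int l - z) mod int k = 0"
    then have "(int l - z) mod int k = (int c - z) mod int k" using assms by simp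
    then have "int k dvd int l - int c" by (simp add: mod_eq_dvd_iff)
    then have "int l mod int k = int c mod int k" by (simp add: mod_eq_dvd_iff)
    then show False using assms by simp
  qed
  have "measure_pmf.expectation p (\<lambda>i. phi t l c (z + int i)) =
     (\<Sum>i<k. pmf p i + (exp t - 1) * (pmf p i * q l (z + int i)) +
       (exp (- t) - 1) * (pmf p i * q c (z + int i)))"
    unfolding expectation_p phi_eq[OF assms(1-3)] by (intro sum.cong) (auto simp: algebra_simps)
  also have "\<dots> = 1 + (exp t - 1) * b + (exp (- t) - 1) * (b + \<gamma>\<^sup>2)"
    using nz assms(6) sum_p_q
    by (simp add: sum.distrib sum_pmf_p sum_distrib_left[symmetric] b_def)
  also have "\<dots> \<le> exp (t\<^sup>2 * (b + (b + \<gamma>\<^sup>2)) - t * (b + \<gamma>\<^sup>2 - b))"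
    using assms base_bounds \<gamma>_bounds by (intro exp_combination_le) (auto simp: b_def)
  also have "\<dots> \<le> exp (t\<^sup>2 * (4 / real k + \<gamma>\<^sup>2) - t * \<gamma>\<^sup>2)"
  proof -
    have "b = base * (real k * base + \<gamma> + \<gamma>)" by (simp add: b_def algebra_simps power2_eq_square)
    also have "\<dots> \<le> (1 / real k) * 2"
      using base_\<gamma>(2) base_bounds \<gamma>_bounds by (intro mult_mono) auto
    finally have "b + (b + \<gamma>\<^sup>2) \<le> 4 / real k + \<gamma>\<^sup>2" by simp
    then show ?thesis using mult_left_mono[of "b + (b + \<gamma>\<^sup>2)" "4 / real k + \<gamma>\<^sup>2" "t\<^sup>2"] by simp
  qed
  finally show ?thesis .
qed

end

section \<open>Chernoff bounds for a single relabelled item\<close>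

lemma votes_measurement:
  assumes "0 < k"
  shows "votes k (measurement k g \<eta>) h x c d =
    map (\<lambda>y. nat ((int (g x) - int (g y) + int (h y) + int (\<eta> (x, y))) mod int k)) [c..<d]"
proof -
  have "(nat (a mod int k) + h) mod k = nat ((a + int h) mod int k)" for a h
  proof -
    have "int ((nat (a mod int k) + h) mod k) = (a mod int k + int h) mod int k"
      using assms by (simp add: zmod_int)
    also have "\<dots> = (a + int h) mod int k" by (rule mod_add_left_eq)
    finally show ?thesis by (metis nat_int)
  qed
  then show ?thesis by (auto simp: votes_def measurement_def algebra_simps)
qed

context noise
begin

lemma phi_mod:
  assumes "z mod int k = z' mod int k"
  shows "phi t l c z = phi t l c z'"
proof -
  have "(z + int i) mod int k = (z' + int i) mod int k" for i
    using assms by (intro mod_add_cong) auto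
  then show ?thesis by (simp only: phi_def)
qed

text \<open>Chernoff's method: where \<open>l\<close> draws at least level with \<open>m\<close>,
  the exponential of \<open>t\<close> times its lead is at least 1, and its expectation factorises
  over the independent votes. The noise \<open>u\<close> on \<open>A\<close> is fixed and disjoint
  from these votes.\<close>

lemma prob_votes_le:
  assumes t: "0 \<le> t" and A: "A \<inter> {x} \<times> {c..<d} = {}"
  shows "measure_pmf.prob (Pi_pmf ({x} \<times> {c..<d}) 0 (\<lambda>_. p))
      {v. count_list (votes k (measurement k g (\<lambda>q. if q \<in> A then u q else v q)) h x c d) m
        \<le> count_list (votes k (measurement k g (\<lambda>q. if q \<in> A then u q else v q)) h x c d) l}
    \<le> (\<Prod>y\<in>{c..<d}. phi t l m (int (g x) - int (g y) + int (h y)))"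
proof -
  let ?B = "{x} \<times> {c..<d}" and ?M = "Pi_pmf ({x} \<times> {c..<d}) 0 (\<lambda>_. p)"
  define V where "V = (\<lambda>y i. nat ((int (g x) - int (g y) + int (h y) + int i) mod int k))"
  define W where "W = (\<lambda>(q :: nat \<times> nat) i. exp (t * (of_bool (V (snd q) i = l) - of_bool (V (snd q) i = m))))"
  define E where "E = {v. count_list (votes k (measurement k g (\<lambda>q. if q \<in> A then u q else v q)) h x c d) m
        \<le> count_list (votes k (measurement k g (\<lambda>q. if q \<in> A then u q else v q)) h x c d) l}"
  have fin: "finite (set_pmf ?M)"
    by (simp add: set_Pi_pmf finite_PiE_dflt)
  have cnt: "real (count_list (votes k (measurement k g (\<lambda>q. if q \<in> A then u q else v q)) h x c d) j) =
      (\<Sum>y\<in>{c..<d}. of_bool (V y (v (x, y)) = j))" for v j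
  proof -
    have "(x, y) \<notin> A" if "y \<in> {c..<d}" for y using A that by auto
    then show ?thesis
      unfolding votes_measurement[OF order.strict_trans2[OF zero_less_numeral k]] count_list_map_upt
      by (auto simp: V_def intro!: sum.cong)
  qed
  have "measure_pmf.prob ?M E \<le> measure_pmf.expectation ?M (\<lambda>v. \<Prod>q\<in>?B. W q (v q))"
    unfolding prob_eq_expectation
  proof (intro integral_mono integrable_measure_pmf_finite fin)
    fix v
    show "indicator E v \<le> (\<Prod>q\<in>?B. W q (v q))"
    proof (cases "v \<in> E")
      case True
      have "(\<Prod>q\<in>?B. W q (v q)) = (\<Prod>y\<in>{c..<d}. W (x, y) (v (x, y)))"
        by (rule prod.reindex_bij_witness[of _ "\<lambda>y. (x, y)" snd]) auto
      also have "\<dots> = exp (t * (\<Sum>y\<in>{c..<d}. of_bool (V y (v (x, y)) = l) - of_bool (V y (v (x, y)) = m)))"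
        by (simp add: W_def exp_sum sum_distrib_left)
      also have "\<dots> = exp (t * (real (count_list (votes k (measurement k g (\<lambda>q. if q \<in> A then u q else v q)) h x c d) l)
         - real (count_list (votes k (measurement k g (\<lambda>q. if q \<in> A then u q else v q)) h x c d) m)))"
        unfolding cnt by (simp add: sum_subtractf)
      also have "\<dots> \<ge> 1" using True t by (simp add: E_def)
      finally show ?thesis using True by simp
    qed (auto simp: W_def intro: prod_nonneg)
  qed
  also have "\<dots> = (\<Prod>q\<in>?B. measure_pmf.expectation p (W q))"
    by (subst expectation_prod_Pi_pmf) (auto simp: W_def intro: integrable_measure_pmf_finite)
  also have "\<dots> = (\<Prod>y\<in>{c..<d}. measure_pmf.expectation p (W (x, y)))"
    by (rule prod.reindex_bij_witness[of _ "\<lambda>y. (x, y)" snd]) auto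
  also have "\<dots> = (\<Prod>y\<in>{c..<d}. phi t l m (int (g x) - int (g y) + int (h y)))"
    by (simp add: W_def V_def phi_def)
  finally show ?thesis by (simp add: E_def)
qed

text \<open>Conditions on all noise except that of the votes on \<open>x\<close>. \<open>H\<close>
  stands for the voters' labels, which the fresh noise cannot influence, and \<open>R\<close> for a
  property of these labels, such as few of them being wrong.\<close>

lemma prob_count_le:
  fixes H :: "(nat \<times> nat \<Rightarrow> nat) \<Rightarrow> nat \<Rightarrow> nat"
  assumes t: "0 \<le> t" and Q: "finite Q" "{x} \<times> {c..<d} \<subseteq> Q"
    and H: "\<And>\<eta> \<eta>' y. (\<And>q. q \<in> Q - {x} \<times> {c..<d} \<Longrightarrow> \<eta> q = \<eta>' q) \<Longrightarrow> c \<le> y \<Longrightarrow> y < d \<Longrightarrow> H \<eta> y = H \<eta>' y"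
    and R: "\<And>\<eta> \<eta>'. (\<And>y. c \<le> y \<Longrightarrow> y < d \<Longrightarrow> H \<eta> y = H \<eta>' y) \<Longrightarrow> R (H \<eta>) \<longleftrightarrow> R (H \<eta>')"
  shows "measure_pmf.prob (Pi_pmf Q 0 (\<lambda>_. p))
      {\<eta>. R (H \<eta>) \<and> count_list (votes k (measurement k g \<eta>) (H \<eta>) x c d) m
        \<le> count_list (votes k (measurement k g \<eta>) (H \<eta>) x c d) l}
    \<le> measure_pmf.expectation (Pi_pmf (Q - {x} \<times> {c..<d}) 0 (\<lambda>_. p))
        (\<lambda>u. if R (H u) then \<Prod>y\<in>{c..<d}. phi t l m (int (g x) - int (g y) + int (H u y)) else 0)"
proof -
  define A where "A = Q - {x} \<times> {c..<d}"
  let ?B = "{x} \<times> {c..<d}"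
  let ?E = "{\<eta>. R (H \<eta>) \<and> count_list (votes k (measurement k g \<eta>) (H \<eta>) x c d) m
        \<le> count_list (votes k (measurement k g \<eta>) (H \<eta>) x c d) l}"
  have disj: "A \<inter> ?B = {}" by (auto simp: A_def)
  have "Q = A \<union> ?B" using Q by (auto simp: A_def)
  moreover have "measure_pmf.prob (Pi_pmf (A \<union> ?B) 0 (\<lambda>_. p)) ?E \<le> measure_pmf.expectation (Pi_pmf A 0 (\<lambda>_. p))
     (\<lambda>u. if R (H u) then \<Prod>y\<in>{c..<d}. phi t l m (int (g x) - int (g y) + int (H u y)) else 0)"
  proof (rule prob_Pi_pmf_Un_le)
    fix u :: "nat \<times> nat \<Rightarrow> nat"
    let ?m = "\<lambda>(v :: nat \<times> nat \<Rightarrow> nat) q. if q \<in> A then u q else v q"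
    have Hm: "H (?m v) y = H u y" if "c \<le> y" "y < d" for v y
      using that by (intro H) (auto simp: A_def)
    then have Rm: "R (H (?m v)) \<longleftrightarrow> R (H u)" for v by (intro R)
    have vm: "votes k f (H (?m v)) x c d = votes k f (H u) x c d" for f v
      using Hm by (intro votes_cong) auto
    show "measure_pmf.prob (Pi_pmf ?B 0 (\<lambda>_. p)) {v. ?m v \<in> ?E} \<le>
      (if R (H u) then \<Prod>y\<in>{c..<d}. phi t l m (int (g x) - int (g y) + int (H u y)) else 0)"
      using prob_votes_le[OF t disj, of g u "H u" m l] by (simp add: Rm vm)
  qed (use Q in \<open>auto simp: A_def\<close>)
  ultimately show ?thesis by (simp add: A_def)
qed

text \<open>A union bound over rivals: if the plurality is not \<open>m\<close>, some other label
  has drawn at least level with it, however ties are broken.\<close>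

lemma prob_plurality_le:
  assumes "m < k" "\<And>l. l < k \<Longrightarrow> l \<noteq> m \<Longrightarrow> measure_pmf.prob M
      {\<eta>. P \<eta> \<and> count_list (votes k (f \<eta>) (H \<eta>) x c d) m \<le> count_list (votes k (f \<eta>) (H \<eta>) x c d) l} \<le> b"
    and "0 \<le> b"
  shows "measure_pmf.prob M {\<eta>. P \<eta> \<and> plurality (votes k (f \<eta>) (H \<eta>) x c d) \<noteq> m} \<le> real k * b"
proof -
  let ?E = "\<lambda>l. {\<eta>. P \<eta> \<and> count_list (votes k (f \<eta>) (H \<eta>) x c d) m \<le> count_list (votes k (f \<eta>) (H \<eta>) x c d) l}"
  have k0: "0 < k" using k by simp
  have "{\<eta>. P \<eta> \<and> plurality (votes k (f \<eta>) (H \<eta>) x c d) \<noteq> m} \<subseteq> (\<Union>l\<in>{..<k} - {m}. ?E l)"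
  proof safe
    fix \<eta> assume "P \<eta>" "plurality (votes k (f \<eta>) (H \<eta>) x c d) \<noteq> m"
    then obtain l where "l < k" "l \<noteq> m"
      "\<not> count_list (votes k (f \<eta>) (H \<eta>) x c d) l < count_list (votes k (f \<eta>) (H \<eta>) x c d) m"
      using plurality_eqI[OF set_votes[OF k0] k0] by metis
    then show "\<eta> \<in> (\<Union>l\<in>{..<k} - {m}. ?E l)"
      using \<open>P \<eta>\<close> by (intro UN_I[of l]) auto
  qed
  then have "measure_pmf.prob M {\<eta>. P \<eta> \<and> plurality (votes k (f \<eta>) (H \<eta>) x c d) \<noteq> m} \<le>
      measure_pmf.prob M (\<Union>l\<in>{..<k} - {m}. ?E l)"
    by (intro measure_pmf.finite_measure_mono) auto
  also have "\<dots> \<le> (\<Sum>l\<in>{..<k} - {m}. measure_pmf.prob M (?E l))"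
    by (intro measure_pmf.finite_measure_subadditive_finite) auto
  also have "\<dots> \<le> (\<Sum>l\<in>{..<k} - {m}. b)"
    by (intro sum_mono assms) auto
  also have "\<dots> \<le> real k * b"
    using assms by (simp add: mult_right_mono)
  finally show ?thesis .
qed

text \<open>Labels are recoverable only relative to a reference; \<open>g0\<close> will be the label
  of the root.\<close>

definition true_label :: "int \<Rightarrow> (nat \<Rightarrow> nat) \<Rightarrow> nat \<Rightarrow> nat" where
  "true_label g0 g v = nat ((int (g v) - g0) mod int k)"

lemma true_label_less: "true_label g0 g v < k"
  unfolding true_label_def by (rule idx_less)

text \<open>Differences telescope along reference, \<open>y\<close> and \<open>x\<close>, so the
  noise-free vote of \<open>y\<close> on \<open>x\<close> is right precisely if \<open>y\<close>
  itself is labelled correctly.\<close>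

lemma true_label_index_iff:
  assumes "h < k"
  shows "(int (true_label g0 g x) - (int (g x) - int (g y) + int h)) mod int k = 0 \<longleftrightarrow> h = true_label g0 g y"
proof -
  have target: "int (true_label g0 g x) = (int (g x) - g0) mod int k" for x
    using k by (simp add: true_label_def)
  have "(int (true_label g0 g x) - (int (g x) - int (g y) + int h)) mod int k =
      ((int (g x) - g0) - (int (g x) - int (g y) + int h)) mod int k"
    unfolding target by (simp add: mod_diff_left_eq)
  also have "\<dots> = ((int (g y) - g0) - int h) mod int k" by (simp add: algebra_simps)
  finally have eq: "(int (true_label g0 g x) - (int (g x) - int (g y) + int h)) mod int k =
      ((int (g y) - g0) - int h) mod int k" .
  have "(int (true_label g0 g x) - (int (g x) - int (g y) + int h)) mod int k = 0 \<longleftrightarrow>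
      (int (g y) - g0) mod int k = int h mod int k"
    unfolding eq by (simp only: mod_eq_dvd_iff mod_eq_0_iff_dvd)
  then show ?thesis using assms k by (auto simp: true_label_def nat_eq_iff)
qed

text \<open>A right voter contributes drift \<open>\<gamma>\<close> and a wrong one at worst
  \<open>- \<gamma>\<close>. With at most one eighth wrong, the net drift is still 3/4 of that of
  unanimous voters.\<close>

lemma prob_relabel_wrong_le:
  fixes H :: "(nat \<times> nat \<Rightarrow> nat) \<Rightarrow> nat \<Rightarrow> nat"
  assumes Q: "finite Q" "{x} \<times> {c..<d} \<subseteq> Q"
    and H: "\<And>\<eta> \<eta>' y. (\<And>q. q \<in> Q - {x} \<times> {c..<d} \<Longrightarrow> \<eta> q = \<eta>' q) \<Longrightarrow> c \<le> y \<Longrightarrow> y < d \<Longrightarrow> H \<eta> y = H \<eta>' y"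
    and H_less: "\<And>\<eta> y. H \<eta> y < k"
  shows "measure_pmf.prob (Pi_pmf Q 0 (\<lambda>_. p))
      {\<eta>. 8 * card {y \<in> {c..<d}. H \<eta> y \<noteq> true_label g0 g y} \<le> d - c \<and>
         plurality (votes k (measurement k g \<eta>) (H \<eta>) x c d) \<noteq> true_label g0 g x}
    \<le> real k * exp (- (\<gamma>\<^sup>2 * real (d - c) / (8 * \<sigma>)))"
proof (rule prob_plurality_le[OF true_label_less])
  fix l assume l: "l < k" "l \<noteq> true_label g0 g x"
  let ?m = "true_label g0 g x"
  define R where "R = (\<lambda>h. 8 * card {y \<in> {c..<d}. h y \<noteq> true_label g0 g y} \<le> d - c)"
  \<comment> \<open>Per voter the exponent becomes \<open>\<gamma>\<^sup>2 / \<sigma>\<close> times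
    1/16 - 3/16, that is, -1/8.\<close>
  define t where "t = \<gamma> / (4 * \<sigma>)"
  define e where "e = exp (- (\<gamma>\<^sup>2 * real (d - c) / (8 * \<sigma>)))"
  have t: "0 \<le> t" "t \<le> 1" using \<gamma>_bounds \<sigma>_bounds by (auto simp: t_def field_simps)
  have R_cong: "R h \<longleftrightarrow> R h'" if "\<And>y. c \<le> y \<Longrightarrow> y < d \<Longrightarrow> h y = h' y" for h h'
  proof -
    have "{y \<in> {c..<d}. h y \<noteq> true_label g0 g y} = {y \<in> {c..<d}. h' y \<noteq> true_label g0 g y}"
      using that by auto
    then show ?thesis by (simp add: R_def)
  qed
  have bound: "(\<Prod>y\<in>{c..<d}. phi t l ?m (int (g x) - int (g y) + int (h y))) \<le> e"
    if R: "R h" and h: "\<And>y. h y < k" for h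
  proof -
    let ?bad = "{y \<in> {c..<d}. h y \<noteq> true_label g0 g y}"
    have "(\<Prod>y\<in>{c..<d}. phi t l ?m (int (g x) - int (g y) + int (h y))) \<le>
      (\<Prod>y\<in>{c..<d}. exp (t\<^sup>2 * \<sigma> - t * \<gamma> * (if h y = true_label g0 g y then 1 else - 1)))"
    proof (intro prod_mono conjI phi_nonneg)
      fix y
      show "phi t l ?m (int (g x) - int (g y) + int (h y)) \<le>
          exp (t\<^sup>2 * \<sigma> - t * \<gamma> * (if h y = true_label g0 g y then 1 else - 1))"
        using phi_le[OF l(1) true_label_less l(2) t, of "int (g x) - int (g y) + int (h y)"]
        unfolding true_label_index_iff[OF h] .
    qed
    also have "\<dots> = exp (\<Sum>y\<in>{c..<d}. t\<^sup>2 * \<sigma> - t * \<gamma> * (if h y = true_label g0 g y then 1 else - 1))"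
      by (simp add: exp_sum)
    also have "(\<Sum>y\<in>{c..<d}. t\<^sup>2 * \<sigma> - t * \<gamma> * (if h y = true_label g0 g y then 1 else - 1)) =
        real (d - c) * (t\<^sup>2 * \<sigma>) - t * \<gamma> * (\<Sum>y\<in>{c..<d}. if h y = true_label g0 g y then 1 else - 1)"
      by (simp add: sum_subtractf sum_distrib_left)
    also have "(\<Sum>y\<in>{c..<d}. if h y = true_label g0 g y then 1 else - 1 :: real) =
        (\<Sum>y\<in>{c..<d}. 1 - 2 * of_bool (h y \<noteq> true_label g0 g y))"
      by (intro sum.cong) auto
    also have "\<dots> = real (d - c) - 2 * real (card ?bad)"
      by (simp add: sum_subtractf sum_distrib_left[symmetric] Int_def)
    also have "real (d - c) * (t\<^sup>2 * \<sigma>) - t * \<gamma> * \<dots> \<le> real (d - c) * (t\<^sup>2 * \<sigma>) - t * \<gamma> * (3 / 4 * real (d - c))"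
      using R t \<gamma>_bounds by (intro diff_left_mono mult_left_mono) (auto simp: R_def)
    also have "\<dots> = - (\<gamma>\<^sup>2 * real (d - c) / (8 * \<sigma>))"
      using \<sigma>_bounds by (simp add: t_def field_simps power2_eq_square)
    finally show ?thesis by (simp add: e_def)
  qed
  have "measure_pmf.prob (Pi_pmf Q 0 (\<lambda>_. p))
      {\<eta>. R (H \<eta>) \<and> count_list (votes k (measurement k g \<eta>) (H \<eta>) x c d) ?m
        \<le> count_list (votes k (measurement k g \<eta>) (H \<eta>) x c d) l}
    \<le> measure_pmf.expectation (Pi_pmf (Q - {x} \<times> {c..<d}) 0 (\<lambda>_. p))
        (\<lambda>u. if R (H u) then \<Prod>y\<in>{c..<d}. phi t l ?m (int (g x) - int (g y) + int (H u y)) else 0)"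
    by (rule prob_count_le[OF t(1) Q H R_cong])
  also have "\<dots> \<le> measure_pmf.expectation (Pi_pmf (Q - {x} \<times> {c..<d}) 0 (\<lambda>_. p)) (\<lambda>_. e)"
    using Q bound H_less
    by (intro integral_mono integrable_measure_pmf_finite)
      (auto simp: set_Pi_pmf finite_PiE_dflt e_def)
  finally show "measure_pmf.prob (Pi_pmf Q 0 (\<lambda>_. p))
      {\<eta>. 8 * card {y \<in> {c..<d}. H \<eta> y \<noteq> true_label g0 g y} \<le> d - c \<and>
        count_list (votes k (measurement k g \<eta>) (H \<eta>) x c d) ?m
        \<le> count_list (votes k (measurement k g \<eta>) (H \<eta>) x c d) l} \<le> e"
    by (simp add: R_def)
qed auto

text \<open>The voters' labels are themselves single measurements against \<open>w0\<close>, on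
  pairwise different pairs. The conditional bound is therefore a product of independent factors, and
  averaging each one brings in \<open>expectation_phi_le\<close>.\<close>

lemma prob_relabel_noisy_wrong_le:
  fixes H :: "(nat \<times> nat \<Rightarrow> nat) \<Rightarrow> nat \<Rightarrow> nat"
  assumes Q: "finite Q" "{x} \<times> {c..<d} \<subseteq> Q" "{c..<d} \<times> {w0} \<subseteq> Q" "x \<notin> {c..<d}"
    and H: "\<And>\<eta> y. c \<le> y \<Longrightarrow> y < d \<Longrightarrow> H \<eta> y = measurement k g \<eta> (y, w0)"
  shows "measure_pmf.prob (Pi_pmf Q 0 (\<lambda>_. p))
      {\<eta>. plurality (votes k (measurement k g \<eta>) (H \<eta>) x c d) \<noteq> true_label (int (g w0)) g x}
    \<le> real k * exp (- (\<gamma> ^ 4 * real (d - c) / (4 * (4 / real k + \<gamma>\<^sup>2))))"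
proof -
  let ?m = "true_label (int (g w0)) g x"
  define \<sigma>' where "\<sigma>' = 4 / real k + \<gamma>\<^sup>2"
  \<comment> \<open>The minimiser of
    \<open>t\<^sup>2 * \<sigma>' - t * \<gamma>\<^sup>2\<close>.\<close>
  define t where "t = \<gamma>\<^sup>2 / (2 * \<sigma>')"
  define e where "e = exp (- (\<gamma> ^ 4 * real (d - c) / (4 * \<sigma>')))"
  define z where "z = int (g x) - int (g w0)"
  have \<sigma>': "0 < \<sigma>'" "\<gamma>\<^sup>2 \<le> \<sigma>'" using k \<gamma>_bounds by (auto simp: \<sigma>'_def intro: add_pos_pos)
  have t: "0 \<le> t" "t \<le> 1" using \<sigma>' by (auto simp: t_def field_simps)
  have z: "(int ?m - z) mod int k = 0"
    using true_label_index_iff[of "true_label (int (g w0)) g w0" "int (g w0)" g x w0] k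
    by (simp add: true_label_def z_def)
  have "measure_pmf.prob (Pi_pmf Q 0 (\<lambda>_. p))
      {\<eta>. True \<and> plurality (votes k (measurement k g \<eta>) (H \<eta>) x c d) \<noteq> ?m} \<le> real k * e"
  proof (rule prob_plurality_le[OF true_label_less])
    fix l assume l: "l < k" "l \<noteq> ?m"
    define A where "A = Q - {x} \<times> {c..<d}"
    define C where "C = {c..<d} \<times> {w0}"
    define Z where "Z = (\<lambda>i. phi t l ?m (z + int i))"
    have A: "finite A" "C \<subseteq> A" using Q by (auto simp: A_def C_def)
    have "measure_pmf.prob (Pi_pmf Q 0 (\<lambda>_. p))
      {\<eta>. (\<lambda>_. True) (H \<eta>) \<and> count_list (votes k (measurement k g \<eta>) (H \<eta>) x c d) ?m
        \<le> count_list (votes k (measurement k g \<eta>) (H \<eta>) x c d) l}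
      \<le> measure_pmf.expectation (Pi_pmf A 0 (\<lambda>_. p))
        (\<lambda>u. if (\<lambda>_. True) (H u) then \<Prod>y\<in>{c..<d}. phi t l ?m (int (g x) - int (g y) + int (H u y)) else 0)"
      unfolding A_def
    proof (intro prob_count_le t Q)
      fix \<eta> \<eta>' :: "nat \<times> nat \<Rightarrow> nat" and y
      assume "\<And>q. q \<in> Q - {x} \<times> {c..<d} \<Longrightarrow> \<eta> q = \<eta>' q" "c \<le> y" "y < d"
      moreover from this(2-) have "(y, w0) \<in> Q - {x} \<times> {c..<d}" using Q by auto
      ultimately show "H \<eta> y = H \<eta>' y" by (simp add: H measurement_def)
    qed auto
    \<comment> \<open>The product is extended from \<open>C\<close> to all of \<open>A\<close> by
      factors 1, the form in which the expectation under the product measure factorises.\<close>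
    also have "(\<lambda>u. if (\<lambda>_. True) (H u) then \<Prod>y\<in>{c..<d}. phi t l ?m (int (g x) - int (g y) + int (H u y)) else 0)
       = (\<lambda>u. \<Prod>q\<in>A. (\<lambda>q i. if q \<in> C then Z i else 1) q (u q))"
    proof
      fix u
      have "phi t l ?m (int (g x) - int (g y) + int (H u y)) = Z (u (y, w0))" if "c \<le> y" "y < d" for y
      proof -
        have "int (H u y) = (int (g y) - int (g w0) + int (u (y, w0))) mod int k"
          using that k by (simp add: H measurement_def)
        then have "(int (g x) - int (g y) + int (H u y)) mod int k =
            (int (g x) - int (g y) + (int (g y) - int (g w0) + int (u (y, w0)))) mod int k"
          by (simp only: mod_add_right_eq)
        also have "\<dots> = (z + int (u (y, w0))) mod int k" by (simp add: z_def algebra_simps)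
        finally show ?thesis unfolding Z_def by (rule phi_mod)
      qed
      then have "(\<Prod>y\<in>{c..<d}. phi t l ?m (int (g x) - int (g y) + int (H u y))) = (\<Prod>y\<in>{c..<d}. Z (u (y, w0)))"
        by (intro prod.cong) auto
      also have "\<dots> = (\<Prod>q\<in>C. Z (u q))"
        unfolding C_def by (rule prod.reindex_bij_witness[of _ fst "\<lambda>y. (y, w0)"]) auto
      also have "\<dots> = (\<Prod>q\<in>A. if q \<in> C then Z (u q) else 1)"
        using A by (simp add: prod.If_cases Int_absorb1)
      finally show "(if True then \<Prod>y\<in>{c..<d}. phi t l ?m (int (g x) - int (g y) + int (H u y)) else 0)
         = (\<Prod>q\<in>A. if q \<in> C then Z (u q) else 1)" by simp
    qed
    also have "measure_pmf.expectation (Pi_pmf A 0 (\<lambda>_. p)) \<dots> =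
        (\<Prod>q\<in>A. measure_pmf.expectation p (\<lambda>i. if q \<in> C then Z i else 1))"
      using A by (subst expectation_prod_Pi_pmf)
        (auto intro: integrable_measure_pmf_finite simp: Z_def phi_nonneg)
    also have "\<dots> = (\<Prod>q\<in>A. if q \<in> C then measure_pmf.expectation p Z else 1)"
      by (intro prod.cong) auto
    also have "\<dots> = measure_pmf.expectation p Z ^ card C"
      using A by (simp add: prod.If_cases Int_absorb1)
    also have "card C = d - c" by (simp add: C_def card_cartesian_product)
    also have "measure_pmf.expectation p Z ^ (d - c) \<le> exp (t\<^sup>2 * \<sigma>' - t * \<gamma>\<^sup>2) ^ (d - c)"
      unfolding Z_def \<sigma>'_def using l true_label_less t z
      by (intro power_mono expectation_phi_le) (auto simp: expectation_p phi_nonneg intro!: sum_nonneg)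
    also have "\<dots> = exp (real (d - c) * (t\<^sup>2 * \<sigma>' - t * \<gamma>\<^sup>2))"
      by (simp add: exp_of_nat_mult)
    also have "real (d - c) * (t\<^sup>2 * \<sigma>' - t * \<gamma>\<^sup>2) = - (\<gamma> ^ 4 * real (d - c) / (4 * \<sigma>'))"
      using \<sigma>' by (simp add: t_def field_simps power2_eq_square power4_eq_xxxx)
    finally show "measure_pmf.prob (Pi_pmf Q 0 (\<lambda>_. p))
      {\<eta>. True \<and> count_list (votes k (measurement k g \<eta>) (H \<eta>) x c d) ?m
        \<le> count_list (votes k (measurement k g \<eta>) (H \<eta>) x c d) l} \<le> e"
      by (simp add: e_def)
  qed (simp add: e_def)
  then show ?thesis by (simp add: e_def \<sigma>'_def)
qed

end

section \<open>Error probability of the five rounds\<close>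

lemma relabel_all_snoc:
  "relabel_all k f (rs @ [r]) h = relabel k f r (relabel_all k f rs h)"
  by (simp add: relabel_all_def)

lemma measurement_less: "0 < k \<Longrightarrow> measurement k g \<eta> q < k"
  by (cases q) (simp add: measurement_def nat_less_iff)

locale alignment = noise +
  fixes n s :: nat and g :: "nat \<Rightarrow> nat"
  assumes s: "1 \<le> s" "3 * s + 2 \<le> n"
begin

definition Q where "Q = set (all_pairs (rounds n s))"
definition M where "M = Pi_pmf Q 0 (\<lambda>_. p)"
definition lab where "lab i \<eta> = relabel_all k (measurement k g \<eta>) (take i (rounds n s)) (\<lambda>_. 0)"
definition target where "target = true_label (int (g (3 * s + 1))) g"

lemma length_rounds: "length (rounds n s) = 5"
  by (simp add: rounds_def)

lemma rounds_nth:
  "rounds n s ! 0 = (3 * s + 2, n + 1, 3 * s + 1, 3 * s + 2)"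
  "rounds n s ! 1 = (1, s + 1, 3 * s + 2, n + 1)"
  "rounds n s ! 2 = (s + 1, 2 * s + 1, 1, s + 1)"
  "rounds n s ! 3 = (2 * s + 1, n + 1, s + 1, 2 * s + 1)"
  "rounds n s ! 4 = (1, s + 1, 2 * s + 1, 3 * s + 1)"
  by (simp_all add: rounds_def)

lemma lab_0: "lab 0 \<eta> = (\<lambda>_. 0)"
  by (simp add: lab_def)

lemma lab_Suc: "i < 5 \<Longrightarrow> lab (Suc i) \<eta> = relabel k (measurement k g \<eta>) (rounds n s ! i) (lab i \<eta>)"
  by (simp add: lab_def take_Suc_conv_app_nth length_rounds relabel_all_snoc)

lemma lab_less: "lab i \<eta> v < k"
  unfolding lab_def using k by (intro relabel_all_less) auto

lemma lab_cong:
  assumes "\<And>q. q \<in> set (all_pairs (take i (rounds n s))) \<Longrightarrow> \<eta> q = \<eta>' q" "v < n + 1"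
  shows "lab i \<eta> v = lab i \<eta>' v"
  unfolding lab_def
proof (rule relabel_all_cong[where N = "n + 1"])
  show "\<forall>r\<in>set (take i (rounds n s)). valid_round (n + 1) r"
    using valid_rounds[OF s] by (meson in_set_takeD)
  fix q assume "q \<in> set (all_pairs (take i (rounds n s)))"
  then show "measurement k g \<eta> q = measurement k g \<eta>' q"
    using assms(1)[of q] by (simp add: measurement_def split_beta)
qed (use assms in auto)

text \<open>Independence between rounds: the distinct query list is the concatenation of the rounds,
  so the pairs of round \<open>i\<close> avoid everything the earlier labels depend on.\<close>

lemma round_fresh:
  assumes "i < 5" "rounds n s ! i = (a, b, c, d)" "a \<le> x" "x < b"
  shows "{x} \<times> {c..<d} \<subseteq> Q" "set (all_pairs (take i (rounds n s))) \<subseteq> Q - {x} \<times> {c..<d}" "d \<le> n + 1"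
proof -
  have sub: "{x} \<times> {c..<d} \<subseteq> set (round_pairs (a, b, c, d))"
    using assms by (auto simp: mem_round_pairs)
  have split: "all_pairs (rounds n s) =
      all_pairs (take i (rounds n s)) @ round_pairs (a, b, c, d) @ all_pairs (drop (Suc i) (rounds n s))"
    using id_take_nth_drop[of i "rounds n s"] assms length_rounds
    by (metis concat.simps(2) concat_append list.simps(9) map_append)
  have "distinct (all_pairs (rounds n s))"
    using valid_queries_rounds[OF s] by (simp add: valid_queries_def distinct_map)
  then have "set (all_pairs (take i (rounds n s))) \<inter> set (round_pairs (a, b, c, d)) = {}"
    unfolding split distinct_append set_append by blast
  then show "{x} \<times> {c..<d} \<subseteq> Q" "set (all_pairs (take i (rounds n s))) \<subseteq> Q - {x} \<times> {c..<d}"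
    using sub unfolding Q_def split set_append by blast+
  have "(a, b, c, d) \<in> set (rounds n s)" using assms length_rounds nth_mem by metis
  then show "d \<le> n + 1" using valid_rounds[OF s] by (auto simp: valid_round_def)
qed

lemma finite_Q: "finite Q"
  by (simp add: Q_def)

abbreviation wrong where "wrong i \<eta> A \<equiv> {y \<in> A. lab i \<eta> y \<noteq> target y}"

text \<open>The joint event of good voters and a wrong target is bounded, not a conditional
  probability, so the failures of successive rounds can simply be added.\<close>

lemma prob_round_le:
  assumes i: "i < 5" "rounds n s ! i = (a, b, c, d)"
  shows "measure_pmf.prob M {\<eta>. 8 * card (wrong i \<eta> {c..<d}) \<le> d - c \<and> wrong (Suc i) \<eta> {a..<b} \<noteq> {}}
    \<le> real (b - a) * (real k * exp (- (\<gamma>\<^sup>2 * real (d - c) / (8 * \<sigma>))))"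
proof -
  let ?e = "real k * exp (- (\<gamma>\<^sup>2 * real (d - c) / (8 * \<sigma>)))"
  let ?E = "\<lambda>x. {\<eta>. 8 * card (wrong i \<eta> {c..<d}) \<le> d - c \<and> lab (Suc i) \<eta> x \<noteq> target x}"
  have single: "measure_pmf.prob M (?E x) \<le> ?e" if x: "a \<le> x" "x < b" for x
  proof -
    note fresh = round_fresh[OF i x]
    have "measure_pmf.prob (Pi_pmf Q 0 (\<lambda>_. p))
      {\<eta>. 8 * card (wrong i \<eta> {c..<d}) \<le> d - c \<and>
         plurality (votes k (measurement k g \<eta>) (lab i \<eta>) x c d) \<noteq> target x} \<le> ?e"
      unfolding target_def
    proof (rule prob_relabel_wrong_le[OF finite_Q fresh(1) _ lab_less])
      fix \<eta> \<eta>' :: "nat \<times> nat \<Rightarrow> nat" and y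
      assume eq: "\<And>q. q \<in> Q - {x} \<times> {c..<d} \<Longrightarrow> \<eta> q = \<eta>' q" and y: "c \<le> y" "y < d"
      show "lab i \<eta> y = lab i \<eta>' y"
      proof (rule lab_cong)
        fix q assume "q \<in> set (all_pairs (take i (rounds n s)))"
        then show "\<eta> q = \<eta>' q" using fresh(2) by (intro eq) blast
      qed (use y fresh(3) in linarith)
    qed
    then show ?thesis using i x by (simp add: M_def lab_Suc relabel_def)
  qed
  have "{\<eta>. 8 * card (wrong i \<eta> {c..<d}) \<le> d - c \<and> wrong (Suc i) \<eta> {a..<b} \<noteq> {}} = (\<Union>x\<in>{a..<b}. ?E x)"
    by auto
  then have "measure_pmf.prob M {\<eta>. 8 * card (wrong i \<eta> {c..<d}) \<le> d - c \<and> wrong (Suc i) \<eta> {a..<b} \<noteq> {}}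
      \<le> (\<Sum>x\<in>{a..<b}. measure_pmf.prob M (?E x))"
    by (simp add: measure_pmf.finite_measure_subadditive_finite)
  also have "\<dots> \<le> (\<Sum>x\<in>{a..<b}. ?e)" using single by (intro sum_mono) auto
  also have "\<dots> = real (b - a) * ?e" by simp
  finally show ?thesis .
qed

lemma lab_1:
  assumes "3 * s + 2 \<le> y" "y < n + 1"
  shows "lab 1 \<eta> y = measurement k g \<eta> (y, 3 * s + 1)"
proof -
  have "[3 * s + 1..<3 * s + 2] = [3 * s + 1]" by (simp add: upt_rec)
  then have "votes k (measurement k g \<eta>) (\<lambda>_. 0) y (3 * s + 1) (3 * s + 2) =
      [] @ [measurement k g \<eta> (y, 3 * s + 1)]"
    using measurement_less[of k g \<eta>] k by (simp add: votes_def)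
  then show ?thesis
    using assms lab_Suc[of 0 \<eta>] by (simp add: rounds_nth lab_0 relabel_def plurality_snoc[of "[]", simplified])
qed

lemma prob_anchor_wrong_le:
  assumes "1 \<le> x" "x < s + 1"
  shows "measure_pmf.prob M {\<eta>. lab 2 \<eta> x \<noteq> target x}
    \<le> real k * exp (- (\<gamma> ^ 4 * real (n + 1 - (3 * s + 2)) / (4 * (4 / real k + \<gamma>\<^sup>2))))"
proof -
  have "{3 * s + 2..<n + 1} \<times> {3 * s + 1} \<subseteq> set (round_pairs (rounds n s ! 0))"
    unfolding rounds_nth by (auto simp: mem_round_pairs)
  also have "\<dots> \<subseteq> Q"
  proof -
    have "rounds n s ! 0 \<in> set (rounds n s)" using length_rounds by (intro nth_mem) simp
    then show ?thesis unfolding Q_def set_concat set_map by blast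
  qed
  finally have "measure_pmf.prob (Pi_pmf Q 0 (\<lambda>_. p)) {\<eta>. plurality (votes k (measurement k g \<eta>)
      (lab 1 \<eta>) x (3 * s + 2) (n + 1)) \<noteq> true_label (int (g (3 * s + 1))) g x}
    \<le> real k * exp (- (\<gamma> ^ 4 * real (n + 1 - (3 * s + 2)) / (4 * (4 / real k + \<gamma>\<^sup>2))))"
    using round_fresh(1)[of 1, OF _ rounds_nth(2) assms] assms finite_Q
    by (intro prob_relabel_noisy_wrong_le) (auto simp: lab_1[simplified])
  moreover have "lab 2 \<eta> x = plurality (votes k (measurement k g \<eta>) (lab 1 \<eta>) x (3 * s + 2) (n + 1))" for \<eta>
  proof -
    have "lab (Suc 1) \<eta> = relabel k (measurement k g \<eta>) (rounds n s ! 1) (lab 1 \<eta>)"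
      by (rule lab_Suc) simp
    then show ?thesis
      using assms unfolding rounds_nth by (simp add: relabel_def numeral_2_eq_2)
  qed
  ultimately show ?thesis by (simp only: M_def target_def)
qed

text \<open>In Markov's inequality the factor \<open>s\<close> of the expected number of wrong items
  cancels against the threshold \<open>s / 8\<close>; a union bound would keep it.\<close>

lemma prob_many_anchors_wrong_le:
  "measure_pmf.prob M {\<eta>. \<not> 8 * card (wrong 2 \<eta> {1..<s + 1}) \<le> s}
    \<le> 8 * (real k * exp (- (\<gamma> ^ 4 * real (n + 1 - (3 * s + 2)) / (4 * (4 / real k + \<gamma>\<^sup>2)))))"
    (is "_ \<le> 8 * ?e")
proof -
  have fin: "finite (set_pmf M)"
    unfolding M_def using finite_Q by (simp add: set_Pi_pmf finite_PiE_dflt)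
  have "measure_pmf.prob M {\<eta>. \<not> 8 * card (wrong 2 \<eta> {1..<s + 1}) \<le> s} \<le>
     measure_pmf.expectation M (\<lambda>\<eta>. 8 / real s * (\<Sum>x\<in>{1..<s + 1}. indicator {\<eta>. lab 2 \<eta> x \<noteq> target x} \<eta>))"
    unfolding prob_eq_expectation
  proof (intro integral_mono integrable_measure_pmf_finite fin)
    fix \<eta>
    have eq: "(\<Sum>x\<in>A. indicator {\<eta>. lab 2 \<eta> x \<noteq> target x} \<eta>) = real (card (wrong 2 \<eta> A))"
      if "finite A" for A
      using that by (simp add: indicator_def of_bool_def[symmetric] Int_def)
    show "indicator {\<eta>. \<not> 8 * card (wrong 2 \<eta> {1..<s + 1}) \<le> s} \<eta> \<le>
        8 / real s * (\<Sum>x\<in>{1..<s + 1}. indicator {\<eta>. lab 2 \<eta> x \<noteq> target x} \<eta>)"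
      unfolding eq[OF finite_atLeastLessThan] using s(1) by (auto simp: indicator_def field_simps)
  qed
  also have "\<dots> = 8 / real s * (\<Sum>x\<in>{1..<s + 1}. measure_pmf.prob M {\<eta>. lab 2 \<eta> x \<noteq> target x})"
    using fin by (subst integral_mult_right_zero, subst Bochner_Integration.integral_sum)
      (auto intro!: integrable_measure_pmf_finite)
  also have "\<dots> \<le> 8 / real s * (\<Sum>x\<in>{1..<s + 1}. ?e)"
    using prob_anchor_wrong_le by (intro mult_left_mono sum_mono) auto
  also have "\<dots> = 8 * ?e" using s(1) by simp
  finally show ?thesis .
qed

lemma prob_all_correct_ge:
  "1 - (8 * (real k * exp (- (\<gamma> ^ 4 * real (n + 1 - (3 * s + 2)) / (4 * (4 / real k + \<gamma>\<^sup>2)))))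
      + 3 * (real n * (real k * exp (- (\<gamma>\<^sup>2 * real s / (8 * \<sigma>))))))
    \<le> measure_pmf.prob M {\<eta>. \<forall>v\<in>{1..n}. lab 5 \<eta> v = target v}"
proof -
  let ?e1 = "8 * (real k * exp (- (\<gamma> ^ 4 * real (n + 1 - (3 * s + 2)) / (4 * (4 / real k + \<gamma>\<^sup>2)))))"
  let ?e2 = "real n * (real k * exp (- (\<gamma>\<^sup>2 * real s / (8 * \<sigma>))))"
  let ?W1 = "{\<eta>. \<not> 8 * card (wrong 2 \<eta> {1..<s + 1}) \<le> s}"
  \<comment> \<open>The failure charged to the round with index \<open>i\<close>, counted from 0.
    Outside these events correctness passes from voters to targets.\<close>
  define W where "W i = {\<eta>. case rounds n s ! i of (a, b, c, d) \<Rightarrow>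
      8 * card (wrong i \<eta> {c..<d}) \<le> d - c \<and> wrong (Suc i) \<eta> {a..<b} \<noteq> {}}" for i
  have W: "measure_pmf.prob M (W i) \<le> ?e2"
    if "i < 5" "rounds n s ! i = (a, b, c, d)" "d - c = s" "b - a \<le> n" for i a b c d
  proof -
    have "measure_pmf.prob M (W i) \<le> real (b - a) * (real k * exp (- (\<gamma>\<^sup>2 * real s / (8 * \<sigma>))))"
      using prob_round_le[OF that(1,2)] that by (simp add: W_def)
    also have "\<dots> \<le> ?e2" using that by (intro mult_right_mono) auto
    finally show ?thesis .
  qed
  have W2: "measure_pmf.prob M (W 2) \<le> ?e2" using W[OF _ rounds_nth(3)] s by simp
  have W3: "measure_pmf.prob M (W 3) \<le> ?e2" using W[OF _ rounds_nth(4)] s by simp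
  have W4: "measure_pmf.prob M (W 4) \<le> ?e2" using W[OF _ rounds_nth(5)] s by simp
  have "lab 5 \<eta> v = target v" if \<eta>: "\<eta> \<notin> ?W1 \<union> (W 2 \<union> (W 3 \<union> W 4))" and v: "v \<in> {1..n}" for \<eta> v
  proof -
    have 3: "lab 3 \<eta> y = target y" if "s + 1 \<le> y" "y < 2 * s + 1" for y
      using \<eta> that by (auto simp: W_def rounds_nth)
    then have "wrong 3 \<eta> {s + 1..<2 * s + 1} = {}" by auto
    moreover have "\<eta> \<notin> W 3" using \<eta> by blast
    ultimately have "wrong 4 \<eta> {2 * s + 1..<n + 1} = {}"
      unfolding W_def rounds_nth mem_Collect_eq prod.case by (simp only: card.empty) auto
    then have 4: "lab 4 \<eta> y = target y" if "2 * s + 1 \<le> y" "y < n + 1" for y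
      using that by auto
    then have "wrong 4 \<eta> {2 * s + 1..<3 * s + 1} = {}" using s by auto
    moreover have "\<eta> \<notin> W 4" using \<eta> by blast
    ultimately have "wrong 5 \<eta> {1..<s + 1} = {}"
      unfolding W_def rounds_nth mem_Collect_eq prod.case by (simp only: card.empty) auto
    then have 5: "lab 5 \<eta> y = target y" if "1 \<le> y" "y < s + 1" for y
      using that by auto
    \<comment> \<open>The last two rounds leave \<open>S'\<close> untouched, and the last one
      changes only \<open>S\<close>, so every item keeps the correct label that it received.\<close>
    have 54: "lab 5 \<eta> y = lab 4 \<eta> y" if "s + 1 \<le> y" for y
      using that lab_Suc[of 4 \<eta>] rounds_nth(5) by (simp add: relabel_def)
    have 43: "lab 4 \<eta> y = lab 3 \<eta> y" if "y < 2 * s + 1" for y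
      using that lab_Suc[of 3 \<eta>] rounds_nth(4) by (simp add: relabel_def)
    show ?thesis
      using v 3[of v] 4[of v] 5[of v] 54[of v] 43[of v] by (cases "v < s + 1"; cases "v < 2 * s + 1") auto
  qed
  then have "UNIV - {\<eta>. \<forall>v\<in>{1..n}. lab 5 \<eta> v = target v} \<subseteq> ?W1 \<union> (W 2 \<union> (W 3 \<union> W 4))"
    by blast
  then have "measure_pmf.prob M (UNIV - {\<eta>. \<forall>v\<in>{1..n}. lab 5 \<eta> v = target v}) \<le>
      measure_pmf.prob M (?W1 \<union> (W 2 \<union> (W 3 \<union> W 4)))"
    by (intro measure_pmf.finite_measure_mono) auto
  also have "\<dots> \<le> measure_pmf.prob M ?W1 + (measure_pmf.prob M (W 2) +
      (measure_pmf.prob M (W 3) + measure_pmf.prob M (W 4)))"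
    by (intro order_trans[OF measure_Un_le] add_mono order_refl) auto
  also have "\<dots> \<le> ?e1 + (?e2 + (?e2 + ?e2))"
    by (intro add_mono prob_many_anchors_wrong_le W2 W3 W4)
  finally have le: "measure_pmf.prob M (UNIV - {\<eta>. \<forall>v\<in>{1..n}. lab 5 \<eta> v = target v}) \<le> ?e1 + (?e2 + (?e2 + ?e2))" .
  have "measure_pmf.prob M (UNIV - A) = 1 - measure_pmf.prob M A" for A
    using measure_pmf.prob_compl[of A M] by simp
  with le show ?thesis by (smt (verit))
qed

lemma equal_up_to_shift_target:
  assumes "\<forall>v\<in>{1..n}. h v = target v"
  shows "equal_up_to_shift n k g h"
  unfolding equal_up_to_shift_def
proof (intro exI[of _ "nat ((- int (g (3 * s + 1))) mod int k)"] conjI ballI)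
  let ?\<alpha> = "nat ((- int (g (3 * s + 1))) mod int k)"
  show "?\<alpha> < k" by (rule idx_less)
  fix v assume "v \<in> {1..n}"
  have "int ((g v + ?\<alpha>) mod k) = (int (g v) + (- int (g (3 * s + 1))) mod int k) mod int k"
    using k by (simp add: zmod_int)
  also have "\<dots> = (int (g v) - int (g (3 * s + 1))) mod int k"
    by (simp add: mod_add_right_eq)
  finally have "(g v + ?\<alpha>) mod k = target v"
    by (simp add: target_def true_label_def)
  then show "h v = (g v + ?\<alpha>) mod k" using assms \<open>v \<in> {1..n}\<close> by simp
qed

end

lemma (in alignment_run) success_prob_ge:
  assumes "0 < \<delta>" "\<delta> \<le> 1 / 4"
  shows "1 - (8 * (real k * exp (- (noise.\<gamma> k \<delta> ^ 4 * real (n + 1 - (3 * s + 2)) /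
          (4 * (4 / real k + (noise.\<gamma> k \<delta>)\<^sup>2)))))
      + 3 * (real n * (real k * exp (- ((noise.\<gamma> k \<delta>)\<^sup>2 * real s / (8 * noise.\<sigma> k \<delta>))))))
    \<le> success_prob align_alg w n k \<delta> g"
proof -
  interpret alignment k \<delta> n s g
    using assms k s s_ge by unfold_locales auto
  have "measure_pmf.prob M {\<eta>. \<forall>v\<in>{1..n}. lab 5 \<eta> v = target v} \<le> success_prob align_alg w n k \<delta> g"
    unfolding success_prob_def queries_align_alg Let_def M_def Q_def p_def
  proof (intro measure_pmf.finite_measure_mono subsetI CollectI)
    fix \<eta> assume \<eta>: "\<eta> \<in> {\<eta>. \<forall>v\<in>{1..n}. lab 5 \<eta> v = target v}"
    have "\<forall>q\<in>set (all_pairs (rounds n s)). measurement k g \<eta> q < k"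
      using measurement_less k by simp
    then obtain t where t: "execute align_alg w n k \<delta> (map (measurement k g \<eta>) (all_pairs (rounds n s))) = Some t"
      "\<forall>v\<in>{1..n}. mem t v = relabel_all k (measurement k g \<eta>) (rounds n s) (\<lambda>_. 0) v"
      by (rule execute_align_alg)
    moreover have "equal_up_to_shift n k g (mem t)"
      using t(2) \<eta> length_rounds by (intro equal_up_to_shift_target) (simp add: lab_def)
    ultimately show "\<exists>t. execute align_alg w n k \<delta> (map (measurement k g \<eta>) (all_pairs (rounds n s))) = Some t \<and>
        equal_up_to_shift n k g (mem t)" by blast
  qed auto
  with prob_all_correct_ge show ?thesis by linarith
qed

section \<open>Asymptotics\<close>

lemma real_div_bounds: "real (a div b) \<le> real a / real b" "real a / real b - 1 \<le> real (a div b)"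
  using floor_divide_of_nat_eq[of a b, where 'a = real] by linarith+

text \<open>The last assumption says that the two-step comparison with the root is right with probability close to 1.\<close>

locale regime =
  fixes n k :: nat and \<delta> :: real
  assumes n: "16 \<le> n" "3 * (3584 * log 2 (real n) * real n powr 0.6) + 2 \<le> real n / 2"
    and k: "2 \<le> k" "real k \<le> real n powr 0.001"
    and \<delta>: "real n powr (- 0.3) \<le> \<delta>" "\<delta> \<le> 1 / 4"
    and two_path: "log 2 (real n) / 5 \<le> real n * (\<delta> ^ 4 / (4 / real k + \<delta>\<^sup>2))"
begin

definition w where "w = word_length 4 n"
definition D where "D = nat \<lfloor>\<delta> * 2 ^ w\<rfloor>"
definition quot where "quot = (2 ^ w - 1) div D"
definition s where "s = group_size w n k D"

lemma \<delta>_pos: "0 < \<delta>"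
proof -
  have "0 < real n powr (- 0.3)" using n by simp
  then show ?thesis using \<delta>(1) by linarith
qed

lemma log_bounds: "ln (real n) \<le> log 2 (real n)" "4 \<le> log 2 (real n)"
    "log 2 (real n) \<le> real (log_ceil n)" "real (log_ceil n) \<le> 2 * log 2 (real n)"
proof -
  have "log 2 16 \<le> log 2 (real n)" using n by (subst log_le_cancel_iff) auto
  moreover have "log 2 (2 ^ 4) = (4 :: real)" by (subst log_nat_power) auto
  ultimately show 4: "4 \<le> log 2 (real n)" by simp
  have "ln 2 \<le> (1 :: real)" using ln_le_minus_one[of 2] by simp
  moreover have "0 \<le> ln (real n)" using n by simp
  ultimately have "ln (real n) * ln 2 \<le> ln (real n) * 1" by (intro mult_left_mono)
  then show "ln (real n) \<le> log 2 (real n)"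
    by (simp add: log_def field_simps)
  show "log 2 (real n) \<le> real (log_ceil n)" "real (log_ceil n) \<le> 2 * log 2 (real n)"
    using 4 unfolding log_ceil_def by linarith+
qed

lemma n_powr_le: "a \<le> b \<Longrightarrow> real n powr a \<le> real n powr b"
  using n by (intro powr_mono) auto

text \<open>The purpose of the factor 4 in the word length: addresses and positions of order
  \<open>n * n\<close> fit, and the quotient can be squared.\<close>

lemma word_ge: "real n ^ 4 \<le> 2 ^ w" "n ^ 4 \<le> 2 ^ w"
proof -
  have "\<not> log_ceil n < log_ceil n" by simp
  then have "n \<le> 2 ^ log_ceil n" using less_log_ceil_iff[of n "log_ceil n"] n by simp
  then have "n ^ 4 \<le> (2 ^ log_ceil n) ^ 4" by (intro power_mono) auto
  also have "\<dots> = 2 ^ w" by (simp add: w_def word_length_def log_ceil_def power_mult[symmetric] mult.commute)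
  finally show 1: "n ^ 4 \<le> 2 ^ w" .
  then have "real (n ^ 4) \<le> real (2 ^ w)" by (simp only: of_nat_le_iff)
  then show "real n ^ 4 \<le> 2 ^ w" by simp
qed

lemma inverse_\<delta>_le: "1 / \<delta> \<le> real n powr 0.3" "1 / \<delta>\<^sup>2 \<le> real n powr 0.6"
proof -
  have "1 / \<delta> \<le> 1 / real n powr (- 0.3)"
    using \<delta> n by (intro divide_left_mono mult_pos_pos \<delta>_pos) auto
  also have "\<dots> = real n powr 0.3" by (simp add: powr_minus field_simps)
  finally show 1: "1 / \<delta> \<le> real n powr 0.3" .
  have "1 / \<delta>\<^sup>2 = (1 / \<delta>)\<^sup>2" by (simp add: power_divide)
  also have "\<dots> \<le> (real n powr 0.3)\<^sup>2" using 1 \<delta>_pos by (intro power_mono) auto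
  also have "\<dots> = real n powr 0.6" by (simp add: power2_eq_square powr_add[symmetric])
  finally show "1 / \<delta>\<^sup>2 \<le> real n powr 0.6" .
qed

text \<open>Ensures that cutting off the digits of \<open>\<delta>\<close> after \<open>w\<close>
  places loses less than a factor of two.\<close>

lemma \<delta>_word: "4 \<le> \<delta> * 2 ^ w"
proof -
  have "real n powr 0.3 \<le> real n powr 1" by (rule n_powr_le) simp
  then have "1 / \<delta> \<le> real n" using inverse_\<delta>_le(1) n by simp
  then have "1 \<le> \<delta> * real n" using \<delta>_pos by (simp add: field_simps)
  moreover have "\<delta> * (real n * 16) \<le> \<delta> * 2 ^ w"
  proof (rule mult_left_mono)
    have "real n * 16 \<le> real n * real n ^ 3"
      using n power_mono[of 16 "real n" 3] by (intro mult_left_mono) auto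
    then show "real n * 16 \<le> 2 ^ w" using word_ge by (simp add: eval_nat_numeral)
  qed (use \<delta>_pos in simp)
  ultimately show ?thesis by (simp add: algebra_simps)
qed

lemma D_bounds: "\<delta> * 2 ^ w / 2 \<le> real D" "real D \<le> \<delta> * 2 ^ w" "0 < D" "D < 2 ^ w"
proof -
  have fl: "real D = of_int \<lfloor>\<delta> * 2 ^ w\<rfloor>" using \<delta>_word by (simp add: D_def)
  then show D: "\<delta> * 2 ^ w / 2 \<le> real D" "real D \<le> \<delta> * 2 ^ w"
    using \<delta>_word by linarith+
  show "0 < D" using D(1) \<delta>_word by (cases D) auto
  have "\<delta> * 2 ^ w \<le> 1 / 4 * 2 ^ w" using \<delta> by (intro mult_right_mono) auto
  also have "\<dots> < 2 ^ w" by simp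
  finally have "real D < real (2 ^ w)"
    using D(2) unfolding of_nat_power of_nat_numeral by (rule le_less_trans[rotated])
  then show "D < 2 ^ w" by (simp only: of_nat_less_iff)
qed

lemma quot_bounds: "1 / (2 * \<delta>) \<le> real quot" "real quot \<le> 2 / \<delta>"
proof -
  define X :: real where "X = 2 ^ w"
  have X: "X \<ge> 1" "real (2 ^ w - 1) = X - 1" by (simp_all add: X_def of_nat_diff)
  have X0: "X > 0" "X * \<delta> \<ge> 4" using \<delta>_word X by (auto simp: X_def mult.commute)
  have "real quot \<le> (X - 1) / real D"
    using real_div_bounds(1)[of "2 ^ w - 1" D] X by (simp add: quot_def)
  also have "\<dots> \<le> X / (\<delta> * X / 2)"
    using D_bounds X0 X \<delta>_pos by (intro frac_le) (auto simp: X_def)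
  also have "\<dots> = 2 / \<delta>" using X0 by simp
  finally show "real quot \<le> 2 / \<delta>" .
  \<comment> \<open>Using \<open>2 ^ w - 1\<close> instead of \<open>2 ^ w\<close> costs at most 1/4
    and rounding down at most 1, together less than half of \<open>1 / \<delta>\<close>, which is at
    least 4.\<close>
  have "1 / (X * \<delta>) \<le> 1 / 4" using X0 by (simp add: divide_simps)
  moreover have "4 \<le> 1 / \<delta>" using \<delta> \<delta>_pos by (simp add: field_simps)
  moreover have "1 / (2 * \<delta>) = 1 / \<delta> / 2" by simp
  ultimately have "1 / (2 * \<delta>) \<le> 1 / \<delta> - 1 / (X * \<delta>) - 1" by linarith
  also have "1 / \<delta> - 1 / (X * \<delta>) = (X - 1) / (\<delta> * X)" using X0 \<delta>_pos by (simp add: field_simps)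
  also have "\<dots> \<le> (X - 1) / real D"
    using D_bounds X by (intro divide_left_mono) (auto simp: X_def)
  also have "\<dots> - 1 \<le> real quot"
    using real_div_bounds(2)[of "2 ^ w - 1" D] X by (simp add: quot_def)
  finally show "1 / (2 * \<delta>) \<le> real quot" by simp
qed

text \<open>The lower bound serves the error estimate, the upper one the cost. The summand 1 in
  \<open>group_size\<close> makes up for rounding in \<open>q * q div k\<close>; 512 is twice 256
  because \<open>log_ceil\<close> at most doubles the logarithm.\<close>

lemma s_bounds:
  "256 * log 2 (real n) * (1 / (4 * \<delta>\<^sup>2 * real k) + 1 / (2 * \<delta>)) \<le> real s"
  "real s \<le> 512 * log 2 (real n) * (4 / (\<delta>\<^sup>2 * real k) + 3 / \<delta>)"
proof -
  let ?c = "real (quot * quot div k + quot + 1)"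
  have s: "real s = 256 * real (log_ceil n) * ?c"
    by (simp add: s_def group_size_def Let_def quot_def algebra_simps)
  have div: "real (quot * quot div k) \<le> real quot * real quot / real k" "real quot * real quot / real k - 1 \<le> real (quot * quot div k)"
    using real_div_bounds(1)[of "quot * quot" k] real_div_bounds(2)[of "quot * quot" k] by auto
  have "(1 / (2 * \<delta>)) * (1 / (2 * \<delta>)) \<le> real quot * real quot"
    using quot_bounds \<delta>_pos by (intro mult_mono) auto
  then have "(1 / (2 * \<delta>)) * (1 / (2 * \<delta>)) / real k \<le> real quot * real quot / real k"
    using k by (intro divide_right_mono) auto
  then have lo: "1 / (4 * \<delta>\<^sup>2 * real k) + 1 / (2 * \<delta>) \<le> ?c"
    using quot_bounds div by (simp add: power2_eq_square)
  have "real quot * real quot \<le> (2 / \<delta>) * (2 / \<delta>)"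
    using quot_bounds \<delta>_pos by (intro mult_mono) auto
  then have "real quot * real quot / real k \<le> (2 / \<delta>) * (2 / \<delta>) / real k"
    using k by (intro divide_right_mono) auto
  moreover have "1 \<le> 1 / \<delta>" using \<delta> \<delta>_pos by (simp add: field_simps)
  ultimately have hi: "?c \<le> 4 / (\<delta>\<^sup>2 * real k) + 3 / \<delta>"
    using quot_bounds div by (simp add: power2_eq_square)
  have "256 * log 2 (real n) * (1 / (4 * \<delta>\<^sup>2 * real k) + 1 / (2 * \<delta>)) \<le> 256 * real (log_ceil n) * ?c"
    using lo log_bounds \<delta>_pos by (intro mult_mono[of "256 * log 2 (real n)"]) auto
  then show "256 * log 2 (real n) * (1 / (4 * \<delta>\<^sup>2 * real k) + 1 / (2 * \<delta>)) \<le> real s" by (simp add: s)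
  have "256 * real (log_ceil n) * ?c \<le> 512 * log 2 (real n) * (4 / (\<delta>\<^sup>2 * real k) + 3 / \<delta>)"
    using hi log_bounds \<delta>_pos by (intro mult_mono[of "256 * real (log_ceil n)"]) auto
  then show "real s \<le> 512 * log 2 (real n) * (4 / (\<delta>\<^sup>2 * real k) + 3 / \<delta>)" by (simp add: s)
qed

text \<open>Guarantees that \<open>V\<close> keeps at least half of the items. The 3584 in the
  locale is 512 * (4 + 3), and the exponent 0.6 comes from
  \<open>1 / \<delta>\<^sup>2\<close>.\<close>

lemma s_small: "real (3 * s + 2) \<le> real n / 2"
proof -
  have "4 / (\<delta>\<^sup>2 * real k) = 4 * (1 / \<delta>\<^sup>2) * (1 / real k)" by simp
  also have "\<dots> \<le> 4 * (1 / \<delta>\<^sup>2) * 1" using k \<delta>_pos by (intro mult_left_mono) auto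
  finally have "4 / (\<delta>\<^sup>2 * real k) \<le> 4 * real n powr 0.6" using inverse_\<delta>_le by simp
  moreover have "real n powr 0.3 \<le> real n powr 0.6" by (rule n_powr_le) simp
  ultimately have "4 / (\<delta>\<^sup>2 * real k) + 3 / \<delta> \<le> 7 * real n powr 0.6"
    using inverse_\<delta>_le(1) by simp
  then have "512 * log 2 (real n) * (4 / (\<delta>\<^sup>2 * real k) + 3 / \<delta>) \<le> 512 * log 2 (real n) * (7 * real n powr 0.6)"
    using log_bounds by (intro mult_left_mono) auto
  then show ?thesis using s_bounds(2) n(2) by simp
qed

lemma k_le_n: "k \<le> n"
proof -
  have "real n powr 0.001 \<le> real n powr 1" by (rule n_powr_le) simp
  then have "real k \<le> real n" using k n by simp
  then show ?thesis by simp
qed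

sublocale run: alignment_run w n k \<delta> s
proof
  have nn: "16 * 16 \<le> n * n" using n by (intro mult_le_mono) auto
  have "10 * n * n < 16 * 16 * (n * n)" using n by simp
  also have "\<dots> \<le> n * n * (n * n)" using nn by (intro mult_le_mono1)
  also have "\<dots> \<le> 2 ^ w" using word_ge(2) by (simp add: eval_nat_numeral algebra_simps)
  finally show "10 * n * n < 2 ^ w" .
  have "real (3 * s + 2) \<le> real n" using s_small by linarith
  then show "3 * s + 2 \<le> n" by (simp only: of_nat_le_iff)
  have "(real quot)\<^sup>2 \<le> (2 / \<delta>)\<^sup>2" using quot_bounds by (intro power_mono) auto
  also have "\<dots> = 4 * (1 / \<delta>\<^sup>2)" by (simp add: power_divide)
  also have "\<dots> \<le> 4 * real n powr 0.6" using inverse_\<delta>_le by simp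
  also have "\<dots> \<le> 4 * real n" using n_powr_le[of "0.6" 1] n by simp
  also have "\<dots> < real n ^ 4"
  proof -
    have "4 * real n < 16 ^ 3 * real n" using n by simp
    also have "\<dots> \<le> real n ^ 3 * real n" using n by (intro mult_right_mono power_mono) auto
    finally show ?thesis by (simp add: eval_nat_numeral)
  qed
  also have "\<dots> \<le> 2 ^ w" by (rule word_ge)
  finally have "real (quot\<^sup>2) < real (2 ^ w)" by simp
  then show "((2 ^ w - 1) div nat \<lfloor>\<delta> * 2 ^ w\<rfloor>)\<^sup>2 < (2 :: nat) ^ w"
    unfolding quot_def D_def of_nat_less_iff .
  show "nat \<lfloor>\<delta> * 2 ^ w\<rfloor> < 2 ^ w" using D_bounds(4) unfolding D_def .
  show "s = group_size w n k (nat \<lfloor>\<delta> * 2 ^ w\<rfloor>)" unfolding s_def D_def ..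
qed (use n(1) k(1) k_le_n in simp_all)

lemma exp_ln_le:
  assumes "c * log 2 (real n) \<le> x" "0 \<le> c"
  shows "exp (- x) \<le> real n powr (- c)"
proof -
  have "c * ln (real n) \<le> x"
    using assms log_bounds(1) mult_left_mono[of "ln (real n)" "log 2 (real n)" c] by linarith
  then show ?thesis using n by (simp add: powr_def)
qed

text \<open>With at least \<open>n / 2\<close> items in \<open>V\<close>, \<open>two_path\<close>
  gives an exponent of at least \<open>lg n\<close> / (5 * 2 * 4), hence
  \<open>n powr (- 0.025)\<close>; the union bound over labels costs
  \<open>n powr 0.001\<close>.\<close>

lemma success_prob_regime_ge:
  "1 - (8 * real n powr (- 0.024) + 3 * real n powr (- 1)) \<le> success_prob align_alg w n k \<delta> g"
proof -
  note k_small = k(2)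
  interpret noise k \<delta> using k \<delta> \<delta>_pos by unfold_locales auto
  have m: "real n / 2 \<le> real (n + 1 - (3 * s + 2))"
    using s_small run.s(2) by (simp add: of_nat_diff)
  have "\<delta> ^ 4 / (4 / real k + \<delta>\<^sup>2) \<le> \<gamma> ^ 4 / (4 / real k + \<gamma>\<^sup>2)"
  proof -
    have "\<delta> ^ 4 \<le> \<gamma> ^ 4" "\<delta>\<^sup>2 \<le> \<gamma>\<^sup>2" using \<gamma>_bounds \<delta>_pos by (auto intro!: power_mono)
    then have "\<delta> ^ 4 * (4 / real k) \<le> \<gamma> ^ 4 * (4 / real k)" "\<delta>\<^sup>2 * \<gamma>\<^sup>2 * \<delta>\<^sup>2 \<le> \<delta>\<^sup>2 * \<gamma>\<^sup>2 * \<gamma>\<^sup>2"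
      by (intro mult_right_mono mult_left_mono; simp)+
    then have "\<delta> ^ 4 * (4 / real k + \<gamma>\<^sup>2) \<le> \<gamma> ^ 4 * (4 / real k + \<delta>\<^sup>2)"
      by (simp add: algebra_simps power2_eq_square power4_eq_xxxx)
    moreover have "0 < 4 / real k + \<gamma>\<^sup>2" "0 < 4 / real k + \<delta>\<^sup>2" using k by (auto intro: add_pos_nonneg)
    ultimately show ?thesis by (simp add: divide_simps mult.commute)
  qed
  then have "real n * (\<delta> ^ 4 / (4 / real k + \<delta>\<^sup>2)) \<le> real n * (\<gamma> ^ 4 / (4 / real k + \<gamma>\<^sup>2))"
    by (intro mult_left_mono) auto
  then have "log 2 (real n) / 5 \<le> real n * (\<gamma> ^ 4 / (4 / real k + \<gamma>\<^sup>2))" using two_path by linarith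
  moreover have "real n / 2 * (\<gamma> ^ 4 / (4 / real k + \<gamma>\<^sup>2)) \<le>
      real (n + 1 - (3 * s + 2)) * (\<gamma> ^ 4 / (4 / real k + \<gamma>\<^sup>2))"
    using m by (intro mult_right_mono) auto
  moreover have "0.025 * l \<le> m * Y / 4" if "l / 5 \<le> N * Y" "N / 2 * Y \<le> m * Y" for l m N Y :: real
    using that by (simp add: field_simps)
  ultimately have "0.025 * log 2 (real n) \<le>
      real (n + 1 - (3 * s + 2)) * (\<gamma> ^ 4 / (4 / real k + \<gamma>\<^sup>2)) / 4"
    by blast
  also have "\<dots> = \<gamma> ^ 4 * real (n + 1 - (3 * s + 2)) / (4 * (4 / real k + \<gamma>\<^sup>2))"
    by (simp add: mult.commute)
  finally have "exp (- (\<gamma> ^ 4 * real (n + 1 - (3 * s + 2)) / (4 * (4 / real k + \<gamma>\<^sup>2)))) \<le>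
      real n powr (- 0.025)"
    by (rule exp_ln_le) simp
  then have "real k * exp (- (\<gamma> ^ 4 * real (n + 1 - (3 * s + 2)) / (4 * (4 / real k + \<gamma>\<^sup>2)))) \<le>
      real n powr 0.001 * real n powr (- 0.025)"
    using k_small by (intro mult_mono) auto
  also have "\<dots> = real n powr (- 0.024)" by (simp add: powr_add[symmetric])
  finally have 1: "real k * exp (- (\<gamma> ^ 4 * real (n + 1 - (3 * s + 2)) / (4 * (4 / real k + \<gamma>\<^sup>2)))) \<le>
      real n powr (- 0.024)" .
  \<comment> \<open>Here the 256 of \<open>group_size\<close> is spent: the target 4 and the 8 in
    the denominator require \<open>32 * log 2 (real n) * \<sigma>\<close>, while \<open>s\<close>
    supplies 64 for the term \<open>1 / real k\<close> and 128 for the term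
    \<open>\<delta>\<close>.\<close>
  have "4 * log 2 (real n) \<le> \<gamma>\<^sup>2 * real s / (8 * \<sigma>)"
  proof -
    have "32 * log 2 (real n) * \<sigma> \<le> 32 * log 2 (real n) * (2 / real k + \<delta>)"
      using \<sigma>_bounds log_bounds by (intro mult_left_mono) auto
    also have "\<dots> \<le> \<delta>\<^sup>2 * (256 * log 2 (real n) * (1 / (4 * \<delta>\<^sup>2 * real k) + 1 / (2 * \<delta>)))"
      using \<delta>_pos k log_bounds by (simp add: field_simps power2_eq_square)
    also have "\<dots> \<le> \<gamma>\<^sup>2 * real s"
      using s_bounds(1) \<gamma>_bounds \<delta>_pos log_bounds by (intro mult_mono power_mono) auto
    finally show ?thesis using \<sigma>_bounds by (simp add: field_simps)
  qed
  then have "exp (- (\<gamma>\<^sup>2 * real s / (8 * \<sigma>))) \<le> real n powr (- 4)"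
    by (rule exp_ln_le) simp
  then have "real n * (real k * exp (- (\<gamma>\<^sup>2 * real s / (8 * \<sigma>)))) \<le> real n * (real n * real n powr (- 4))"
    using k_le_n by (intro mult_left_mono mult_mono) auto
  also have "\<dots> = real n powr 1 * (real n powr 1 * real n powr (- 4))" using n by simp
  also have "\<dots> = real n powr (- 2)" by (simp only: powr_add[symmetric]) simp
  also have "\<dots> \<le> real n powr (- 1)" by (rule n_powr_le) simp
  finally have 2: "real n * (real k * exp (- (\<gamma>\<^sup>2 * real s / (8 * \<sigma>)))) \<le> real n powr (- 1)" .
  from 1 2 run.success_prob_ge[OF \<delta>_pos \<delta>(2), of g] show ?thesis by linarith
qed

lemma cost_le: "real (200 * n * s) \<le> 102400 * (real n * log 2 (real n) * (4 / (\<delta>\<^sup>2 * real k) + 3 / \<delta>))"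
proof -
  have "real (200 * n * s) = 200 * real n * real s" by simp
  also have "\<dots> \<le> 200 * real n * (512 * log 2 (real n) * (4 / (\<delta>\<^sup>2 * real k) + 3 / \<delta>))"
    using s_bounds(2) by (intro mult_left_mono) auto
  finally show ?thesis by (simp add: algebra_simps)
qed

end

lemma solves_alignment_regime:
  assumes "\<forall>\<^sub>F n in sequentially. regime n (k n) (\<delta> n)"
    and "\<forall>\<^sub>F n in sequentially.
      102400 * (real n * log 2 (real n) * (4 / ((\<delta> n)\<^sup>2 * real (k n)) + 3 / \<delta> n)) \<le> B n"
  shows "solves_alignment align_alg 4 k \<delta> B B"
  unfolding solves_alignment_def
proof (intro conjI allI impI)
  show "\<forall>\<^sub>F n in sequentially.
        valid_queries n (queries align_alg (word_length 4 n) n (k n) (\<delta> n)) \<and>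
        real (length (queries align_alg (word_length 4 n) n (k n) (\<delta> n))) \<le> B n \<and>
        runs_in_time align_alg (word_length 4 n) n (k n) (\<delta> n) (B n)"
    using assms
  proof eventually_elim
    case (elim n)
    interpret regime n "k n" "\<delta> n" by (rule elim)
    have s1: "1 \<le> s" "3 * s + 2 \<le> n" using run.s_ge run.s(2) by auto
    have le: "real (200 * n * s) \<le> B n" using cost_le elim(2) by linarith
    have "length (all_pairs (rounds n s)) \<le> 200 * n * s"
      using length_all_pairs_rounds[OF s1] by linarith
    then have "real (length (all_pairs (rounds n s))) \<le> B n" using le by linarith
    then show ?case
      using run.queries_align_alg valid_queries_rounds[OF s1] run.runs_in_time_align_alg[OF le]
      by (simp add: w_def)
  qed
  fix g :: "nat \<Rightarrow> nat \<Rightarrow> nat"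
  show "(\<lambda>n. success_prob align_alg (word_length 4 n) n (k n) (\<delta> n) (g n)) \<longlonglongrightarrow> 1"
  proof (rule tendsto_sandwich)
    show "(\<lambda>n. 1 - (8 * real n powr (- 0.024) + 3 * real n powr (- 1))) \<longlonglongrightarrow> 1"
      by real_asymp
    show "(\<lambda>_. 1 :: real) \<longlonglongrightarrow> 1" by simp
    show "\<forall>\<^sub>F n in sequentially. 1 - (8 * real n powr (- 0.024) + 3 * real n powr (- 1)) \<le>
        success_prob align_alg (word_length 4 n) n (k n) (\<delta> n) (g n)"
      using assms(1)
      by eventually_elim (use regime.success_prob_regime_ge regime.w_def in metis)
    show "\<forall>\<^sub>F n in sequentially. success_prob align_alg (word_length 4 n) n (k n) (\<delta> n) (g n) \<le> 1"
      by (intro always_eventually allI) (simp add: success_prob_def Let_def)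
  qed
qed

section \<open>The two ranges of \<open>\<delta>\<close>\<close>

lemma eventually_large:
  "\<forall>\<^sub>F n in sequentially. 16 \<le> n \<and> 3 * (3584 * log 2 (real n) * real n powr 0.6) + 2 \<le> real n / 2 \<and>
     2 * real n powr 0.001 \<le> real n powr 0.3 \<and> log 2 (real n) / 5 \<le> real n powr 0.1 / 9"
  by (intro eventually_conj eventually_ge_at_top) real_asymp+

lemma eventually_small_k:
  assumes "\<epsilon> \<longlonglongrightarrow> 0" "\<forall>\<^sub>F n in sequentially. real (k n) \<le> real n powr \<epsilon> n"
  shows "\<forall>\<^sub>F n in sequentially. real (k n) \<le> real n powr 0.001"
proof -
  have "\<forall>\<^sub>F n in sequentially. \<epsilon> n < 0.001"
    using assms(1) by (rule order_tendstoD) simp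
  then show ?thesis
    using assms(2) eventually_ge_at_top[of 1]
  proof eventually_elim
    case (elim n)
    then have "real n powr \<epsilon> n \<le> real n powr 0.001" by (intro powr_mono) auto
    with elim show ?case by linarith
  qed
qed

text \<open>For small \<open>\<delta>\<close> the denominator in \<open>two_path\<close> is at most
  \<open>5 / real k\<close>, and the fourth power of the lower bound on \<open>\<delta>\<close>
  yields exactly the required \<open>log 2 (real n) / 5\<close>. That lower bound is at least about
  \<open>n powr (- 0.25025)\<close>, which leaves room for the exponent -0.3.\<close>

lemma regime_small_\<delta>:
  fixes n k :: nat
  assumes n: "16 \<le> n" "3 * (3584 * log 2 (real n) * real n powr 0.6) + 2 \<le> real n / 2"
    and k: "2 \<le> k" "real k \<le> real n powr 0.001"
    and \<delta>: "(log 2 (real n) / (real n * real k)) powr (1 / 4) \<le> \<delta>" "\<delta> \<le> 1 / (2 * real k)"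
  shows "regime n k \<delta>"
proof
  have lg: "1 \<le> log 2 (real n)" using n by (subst le_log_iff) auto
  let ?x = "log 2 (real n) / (real n * real k)"
  have x: "0 < ?x" using lg n k by simp
  have "real n powr (- 0.3) \<le> (real n powr (- 1.001)) powr (1 / 4)"
    using n by (simp add: powr_powr)
  also have "\<dots> \<le> ?x powr (1 / 4)"
  proof (rule powr_mono2)
    have "real n powr (- 1.001) = 1 / (real n powr 1 * real n powr 0.001)"
      by (simp only: powr_add[symmetric]) (simp add: powr_minus field_simps)
    also have "\<dots> \<le> 1 / (real n * real k)"
      using n k by (intro divide_left_mono mult_left_mono mult_pos_pos) auto
    also have "\<dots> \<le> ?x" using lg n k by (intro divide_right_mono) auto
    finally show "real n powr (- 1.001) \<le> ?x" .
  qed auto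
  finally show lower: "real n powr (- 0.3) \<le> \<delta>" using \<delta>(1) by linarith
  have "1 / (2 * real k) \<le> 1 / 4" using k by (simp add: field_simps)
  then show "\<delta> \<le> 1 / 4" using \<delta>(2) by linarith
  have "0 < real n powr (- 0.3)" using n by simp
  then have \<delta>0: "0 < \<delta>" using lower by linarith
  have "(y powr (1 / 4)) ^ 4 = y" if "0 < y" for y :: real
    using that by (simp add: powr_power)
  then have "?x = (?x powr (1 / 4)) ^ 4" using x by metis
  also have "\<dots> \<le> \<delta> ^ 4" using \<delta> by (intro power_mono) auto
  finally have x4: "?x \<le> \<delta> ^ 4" .
  have "\<delta>\<^sup>2 \<le> (1 / (2 * real k))\<^sup>2" using \<delta>0 \<delta> by (intro power_mono) auto
  also have "\<dots> \<le> 1 / real k" using k by (simp add: field_simps power2_eq_square)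
  finally have "4 / real k + \<delta>\<^sup>2 \<le> 5 / real k" by simp
  moreover have "0 < 4 / real k + \<delta>\<^sup>2" using k by (intro add_pos_nonneg) auto
  ultimately have "?x / (5 / real k) \<le> \<delta> ^ 4 / (4 / real k + \<delta>\<^sup>2)"
    using x4 x by (intro frac_le) auto
  then have "real n * (?x / (5 / real k)) \<le> real n * (\<delta> ^ 4 / (4 / real k + \<delta>\<^sup>2))"
    by (intro mult_left_mono) auto
  also have "real n * (?x / (5 / real k)) = log 2 (real n) / 5" using n k by simp
  finally show "log 2 (real n) / 5 \<le> real n * (\<delta> ^ 4 / (4 / real k + \<delta>\<^sup>2))" .
qed (fact n k)+

text \<open>Now \<open>4 / real k \<le> 8 * \<delta>\<close>, so the denominator in
  \<open>two_path\<close> is at most \<open>9 * \<delta>\<close> and the exponent is at least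
  \<open>n * \<delta> ^ 3 / 9\<close>, a positive power of \<open>n\<close>.\<close>

lemma regime_large_\<delta>:
  fixes n k :: nat
  assumes n: "16 \<le> n" "3 * (3584 * log 2 (real n) * real n powr 0.6) + 2 \<le> real n / 2"
      "2 * real n powr 0.001 \<le> real n powr 0.3" "log 2 (real n) / 5 \<le> real n powr 0.1 / 9"
    and k: "2 \<le> k" "real k \<le> real n powr 0.001"
    and \<delta>: "1 / (2 * real k) \<le> \<delta>" "\<delta> \<le> 1 / 4"
  shows "regime n k \<delta>"
proof
  have "real n powr (- 0.3) = 1 / real n powr 0.3" by (simp add: powr_minus field_simps)
  also have "\<dots> \<le> 1 / (2 * real k)"
    using n k by (intro divide_left_mono mult_pos_pos) auto
  finally show lower: "real n powr (- 0.3) \<le> \<delta>" using \<delta> by linarith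
  have "0 < real n powr (- 0.3)" using n by simp
  then have \<delta>0: "0 < \<delta>" using lower by linarith
  have "4 / real k \<le> 8 * \<delta>" using \<delta>(1) k by (simp add: field_simps)
  moreover have "\<delta>\<^sup>2 \<le> \<delta>" using \<delta>0 \<delta> by (simp add: power2_eq_square)
  ultimately have le: "4 / real k + \<delta>\<^sup>2 \<le> 9 * \<delta>" by linarith
  have "0 < 4 / real k + \<delta>\<^sup>2" using k by (intro add_pos_nonneg) auto
  then have "0 < 9 * \<delta> * (4 / real k + \<delta>\<^sup>2)" using \<delta>0 by (intro mult_pos_pos) auto
  then have "\<delta> ^ 4 / (9 * \<delta>) \<le> \<delta> ^ 4 / (4 / real k + \<delta>\<^sup>2)"
    using \<delta>0 by (intro divide_left_mono[OF le]) simp_all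
  moreover have "\<delta> ^ 4 / (9 * \<delta>) = \<delta> ^ 3 / 9" using \<delta>0 by (simp add: eval_nat_numeral)
  moreover have "(real n powr (- 0.3)) ^ 3 \<le> \<delta> ^ 3" using lower by (intro power_mono) auto
  moreover have "(real n powr (- 0.3)) ^ 3 = real n powr (- 0.9)"
    using n by (simp add: powr_realpow[symmetric] powr_powr)
  ultimately have "real n powr (- 0.9) / 9 \<le> \<delta> ^ 4 / (4 / real k + \<delta>\<^sup>2)" by linarith
  then have le: "real n * (real n powr (- 0.9) / 9) \<le> real n * (\<delta> ^ 4 / (4 / real k + \<delta>\<^sup>2))"
    by (intro mult_left_mono) auto
  have "real n powr 0.1 = real n powr 1 * real n powr (- 0.9)"
    by (simp only: powr_add[symmetric]) simp
  also have "\<dots> = real n * real n powr (- 0.9)" by simp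
  finally have "log 2 (real n) / 5 \<le> real n * (real n powr (- 0.9) / 9)"
    using n(4) by (simp only: times_divide_eq_right)
  with le show "log 2 (real n) / 5 \<le> real n * (\<delta> ^ 4 / (4 / real k + \<delta>\<^sup>2))"
    by (rule order_trans[rotated])
qed (fact n k \<delta>)+

text \<open>In this range \<open>1 / \<delta>\<close> is at most
  \<open>1 / (\<delta>\<^sup>2 * k)\<close>, so both terms of the cost merge with factor 4 + 3, and
  7 * 102400 is below the constant.\<close>

lemma solves_alignment_small_\<delta>:
  assumes "\<forall>\<^sub>F n in sequentially. 2 \<le> k n"
    "\<epsilon> \<longlonglongrightarrow> 0" "\<forall>\<^sub>F n in sequentially. real (k n) \<le> real n powr \<epsilon> n"
    "\<forall>\<^sub>F n in sequentially.
       (log 2 (real n) / (real n * real (k n))) powr (1 / 4) \<le> \<delta> n \<and> \<delta> n \<le> 1 / (2 * real (k n))"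
  defines "B \<equiv> \<lambda>n. 2000000 * (real n * log 2 (real n) / ((\<delta> n)\<^sup>2 * real (k n)))"
  shows "solves_alignment align_alg 4 k \<delta> B B"
proof -
  have ev: "\<forall>\<^sub>F n in sequentially. regime n (k n) (\<delta> n) \<and> \<delta> n \<le> 1 / (2 * real (k n))"
    using assms(1) eventually_small_k[OF assms(2,3)] assms(4) eventually_large
    by eventually_elim (auto intro: regime_small_\<delta>)
  have "\<forall>\<^sub>F n in sequentially.
      102400 * (real n * log 2 (real n) * (4 / ((\<delta> n)\<^sup>2 * real (k n)) + 3 / \<delta> n)) \<le> B n"
    using ev
  proof eventually_elim
    case (elim n)
    then interpret regime n "k n" "\<delta> n" by simp
    have "\<delta> n * real (k n) \<le> 1" using elim k by (simp add: field_simps)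
    then have "1 / \<delta> n \<le> 1 / \<delta> n * (1 / (\<delta> n * real (k n)))"
      using \<delta>_pos k by (simp add: field_simps)
    also have "\<dots> = 1 / ((\<delta> n)\<^sup>2 * real (k n))" by (simp add: power2_eq_square)
    finally have "4 / ((\<delta> n)\<^sup>2 * real (k n)) + 3 / \<delta> n \<le> 7 * (1 / ((\<delta> n)\<^sup>2 * real (k n)))" by simp
    then have "real n * log 2 (real n) * (4 / ((\<delta> n)\<^sup>2 * real (k n)) + 3 / \<delta> n) \<le>
        real n * log 2 (real n) * (7 * (1 / ((\<delta> n)\<^sup>2 * real (k n))))"
      using log_bounds by (intro mult_left_mono) auto
    moreover have "0 \<le> real n * log 2 (real n) * (1 / ((\<delta> n)\<^sup>2 * real (k n)))" using log_bounds by simp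
    ultimately show ?case unfolding B_def by simp
  qed
  with ev show ?thesis by (intro solves_alignment_regime) (auto elim: eventually_mono)
qed

text \<open>In this range \<open>1 / (\<delta>\<^sup>2 * k)\<close> is at most
  \<open>2 / \<delta>\<close>, so the terms merge with factor 8 + 3, and 11 * 102400 is below the
  constant.\<close>

lemma solves_alignment_large_\<delta>:
  assumes "\<forall>\<^sub>F n in sequentially. 2 \<le> k n"
    "\<epsilon> \<longlonglongrightarrow> 0" "\<forall>\<^sub>F n in sequentially. real (k n) \<le> real n powr \<epsilon> n"
    "\<forall>\<^sub>F n in sequentially. 1 / (2 * real (k n)) \<le> \<delta> n \<and> \<delta> n \<le> 1 / 4"
  defines "B \<equiv> \<lambda>n. 2000000 * (real n * log 2 (real n) / \<delta> n)"
  shows "solves_alignment align_alg 4 k \<delta> B B"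
proof -
  have ev: "\<forall>\<^sub>F n in sequentially. regime n (k n) (\<delta> n) \<and> 1 / (2 * real (k n)) \<le> \<delta> n"
    using assms(1) eventually_small_k[OF assms(2,3)] assms(4) eventually_large
    by eventually_elim (auto intro: regime_large_\<delta>)
  have "\<forall>\<^sub>F n in sequentially.
      102400 * (real n * log 2 (real n) * (4 / ((\<delta> n)\<^sup>2 * real (k n)) + 3 / \<delta> n)) \<le> B n"
    using ev
  proof eventually_elim
    case (elim n)
    then interpret regime n "k n" "\<delta> n" by simp
    have "1 / (\<delta> n * real (k n)) \<le> 2" using elim k \<delta>_pos by (simp add: field_simps)
    then have "1 / \<delta> n * (1 / (\<delta> n * real (k n))) \<le> 1 / \<delta> n * 2"
      using \<delta>_pos by (intro mult_left_mono) auto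
    moreover have "1 / \<delta> n * (1 / (\<delta> n * real (k n))) = 1 / ((\<delta> n)\<^sup>2 * real (k n))"
      by (simp add: power2_eq_square)
    ultimately have "1 / ((\<delta> n)\<^sup>2 * real (k n)) \<le> 1 / \<delta> n * 2" by (simp only:)
    then have "4 / ((\<delta> n)\<^sup>2 * real (k n)) + 3 / \<delta> n \<le> 11 * (1 / \<delta> n)" by simp
    then have "real n * log 2 (real n) * (4 / ((\<delta> n)\<^sup>2 * real (k n)) + 3 / \<delta> n) \<le>
        real n * log 2 (real n) * (11 * (1 / \<delta> n))"
      using log_bounds by (intro mult_left_mono) auto
    moreover have "0 \<le> real n * log 2 (real n) * (1 / \<delta> n)" using log_bounds \<delta>_pos by simp
    ultimately show ?case unfolding B_def by simp
  qed
  with ev show ?thesis by (intro solves_alignment_regime) (auto elim: eventually_mono)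
qed

text \<open>The group size contains the terms for both ranges of \<open>\<delta>\<close> as
  summands, so one program, word length and constant witness both parts.\<close>

theorem theorem1:
  "(\<exists>A c C. nonadaptive A \<and>
      (\<forall>(k :: nat \<Rightarrow> nat) (\<delta> :: nat \<Rightarrow> real) (\<epsilon> :: nat \<Rightarrow> real).
         (\<forall>\<^sub>F n in sequentially. 2 \<le> k n) \<and>
         \<epsilon> \<longlonglongrightarrow> 0 \<and> (\<forall>\<^sub>F n in sequentially. real (k n) \<le> real n powr \<epsilon> n) \<and>
         (\<forall>\<^sub>F n in sequentially.
            (log 2 (real n) / (real n * real (k n))) powr (1 / 4) \<le> \<delta> n \<and>
            \<delta> n \<le> 1 / (2 * real (k n))) \<longrightarrow>
         solves_alignment A c k \<delta>
           (\<lambda>n. C * (real n * log 2 (real n) / ((\<delta> n)\<^sup>2 * real (k n))))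
           (\<lambda>n. C * (real n * log 2 (real n) / ((\<delta> n)\<^sup>2 * real (k n)))))) \<and>
   (\<exists>A c C. nonadaptive A \<and>
      (\<forall>(k :: nat \<Rightarrow> nat) (\<delta> :: nat \<Rightarrow> real) (\<epsilon> :: nat \<Rightarrow> real).
         (\<forall>\<^sub>F n in sequentially. 2 \<le> k n) \<and>
         \<epsilon> \<longlonglongrightarrow> 0 \<and> (\<forall>\<^sub>F n in sequentially. real (k n) \<le> real n powr \<epsilon> n) \<and>
         (\<forall>\<^sub>F n in sequentially. 1 / (2 * real (k n)) \<le> \<delta> n \<and> \<delta> n \<le> 1 / 4) \<longrightarrow>
         solves_alignment A c k \<delta>
           (\<lambda>n. C * (real n * log 2 (real n) / \<delta> n))
           (\<lambda>n. C * (real n * log 2 (real n) / \<delta> n))))"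
  using nonadaptive_align_alg solves_alignment_small_\<delta> solves_alignment_large_\<delta>
  by (intro conjI exI[of _ align_alg] exI[of _ "4 :: nat"] exI[of _ "2000000 :: real"] allI impI) blast+

end
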